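(* There exist two slits $\Gamma_1=\gamma_1(0,T_1]$, $\Gamma_2=\gamma_2(0,T_2]$ in $\mathbb H$ (simple curves $\gamma_j$ with $\gamma_j(0)\in\mathbb R$, $\gamma_j(0,T_j]\subset\mathbb H$) with $\overline{\Gamma_1}\cap\overline{\Gamma_2}=\{0\}$, such that $h_j(t):=\operatorname{hcap}(\gamma_j(0,t])=t$ for all $t\in[0,\operatorname{hcap}(\Gamma_j)]$ ($j=1,2$), but $c(t):=\operatorname{hcap}(\gamma_1(0,t]\cup\gamma_2(0,t])$ is not differentiable at $t=0$.
   Context: $\mathbb H:=\{z:\operatorname{Im}z>0\}$. A bounded set $A\subset\mathbb H$ is a (compact) hull if $A=\mathbb H\cap\overline A$ and $\mathbb H\setminus A$ is simply connected. $g_A$ denotes the unique conformal map of $\mathbb H\setminus A$ onto $\mathbb H$ with $g_A(z)=z+\frac{b}{z}+O(|z|^{-2})$ as $z\to\infty$; the half-plane capacity is $\operatorname{hcap}(A):=b$. If $\gamma_1(0,t]\cup\gamma_2(0,t]$ is not a hull, its half-plane capacity means that of the smallest hull containing it. *)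

theory Defs
  imports "HOL-Complex_Analysis.Complex_Analysis"
begin

definition upper_half_plane :: "complex set" ("\<H>") where
  "\<H> = {z. Im z > 0}"

definition is_hull :: "complex set \<Rightarrow> bool" where
  "is_hull A \<longleftrightarrow> bounded A \<and> A = \<H> \<inter> closure A \<and> simply_connected (\<H> - A)"

definition is_mapping_out :: "complex set \<Rightarrow> (complex \<Rightarrow> complex) \<Rightarrow> real \<Rightarrow> bool" where
  "is_mapping_out A g b \<longleftrightarrow>
     g holomorphic_on (\<H> - A) \<and> inj_on g (\<H> - A) \<and> g ` (\<H> - A) = \<H> \<and>
     (\<exists>C R. \<forall>z \<in> \<H> - A. norm z > R \<longrightarrow>
        norm (g z - z - complex_of_real b / z) \<le> C / (norm z)^2)"

definition hcap_hull :: "complex set \<Rightarrow> real" where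
  "hcap_hull A = (THE b. \<exists>g. is_mapping_out A g b)"

definition hull_fill :: "complex set \<Rightarrow> complex set" where
  "hull_fill S = (THE A. is_hull A \<and> S \<subseteq> A \<and> (\<forall>B. is_hull B \<and> S \<subseteq> B \<longrightarrow> A \<subseteq> B))"

definition hcap :: "complex set \<Rightarrow> real" where
  "hcap S = hcap_hull (hull_fill S)"

definition is_slit_curve :: "(real \<Rightarrow> complex) \<Rightarrow> real \<Rightarrow> bool" where
  "is_slit_curve \<gamma> T \<longleftrightarrow> T > 0 \<and> continuous_on {0..T} \<gamma> \<and> inj_on \<gamma> {0..T} \<and>
     Im (\<gamma> 0) = 0 \<and> \<gamma> ` {0<..T} \<subseteq> \<H>"

end

theory Submission
  imports Defs "HOL-Real_Asymp.Real_Asymp"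
begin

text \<open>The slits are mirror images of each other in the imaginary axis, one of them the graph
  \<open>x = \<phi>(y)\<close> over an interval of heights, both parametrised by half-plane capacity. The slope
  \<open>\<phi>(y)/y\<close> oscillates so slowly that, rescaled along one sequence of heights tending to \<open>0\<close>, both
  slits approach the same vertical segment, and along another one two distinct straight segments. By scaling,
  \<open>c(t)/t\<close> tends to \<open>1\<close> along the first sequence, and along the second to a number that is greater
  than \<open>1\<close> because half-plane capacity is strictly monotone.
  Capacities of nearby slits are compared by the maximum principle: \<open>hcap B \<le> hcap A + 4 R \<delta>\<close> whenever
  \<open>Im g\<^sub>A \<le> \<delta>\<close> on \<open>B - A\<close>, and \<open>Im g\<^sub>A\<close> is small near any point of a graph by a Beurling-type estimate.\<close>

section \<open>Schwarz--Pick and the maximum principle for mapping-out functions\<close>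

text \<open>Reflection preserves capacity, so at time t both slits have the same height;
  \<open>c(t)/t\<close> is then the capacity of the pair divided by that of one slit at a common
  height, a quotient invariant under scaling. The time change drops out, and only the shape seen at
  each scale matters. The iterated logarithm in \<open>osc\<close> freezes that shape: replacing
  \<open>h\<close> by \<open>h * v\<close> adds \<open>- ln v\<close> to \<open>1 - ln h\<close>,
  which is negligible unless \<open>v\<close> is tiny, and there the factor \<open>v\<close> wins.
  The obstacle is the sequence along which the two slits merge. The limit is a single slit, so the
  comparison must not deteriorate as the distance between the slits tends to 0. The estimate of
  \<open>Im g\<close> achieves this because it looks at one sub-slit only, and enlarging the hull
  can only lower \<open>Im g\<close>. Graphs over the height make the topology of the complements
  elementary and bound the argument around a tip. Since \<open>hcap\<close> is built from definite
  descriptions, the hull property and both existence and uniqueness of the expansion coefficient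
  must be established before a capacity can be evaluated.\<close>

lemma open_upper_half_plane: "open \<H>"
  by (simp add: upper_half_plane_def open_halfspace_Im_gt)

lemma convex_upper_half_plane: "convex \<H>"
  by (simp add: upper_half_plane_def convex_halfspace_Im_gt)

lemma norm_diff_cnj_power2:
  "(norm (z - cnj b))\<^sup>2 - (norm (z - b))\<^sup>2 = 4 * Im z * Im b"
  unfolding cmod_power2 by (simp add: algebra_simps power2_eq_square)

text \<open>The map of \<open>s\<close> is the inverse of the Cayley map
  \<open>z \<mapsto> (z - a) / (z - cnj a)\<close>; the formula shows that it carries the unit disc
  into the half-plane.\<close>

lemma Im_Cayley_inverse:
  "Im ((a - cnj a * s) / (1 - s)) = Im a * (1 - (norm s)\<^sup>2) / (norm (1 - s))\<^sup>2"
proof -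
  have "Im ((a - cnj a * s) * cnj (1 - s)) = Im a * (1 - (norm s)\<^sup>2)"
    unfolding cmod_power2 by (simp add: algebra_simps power2_eq_square)
  moreover have "(a - cnj a * s) / (1 - s) = ((a - cnj a * s) * cnj (1 - s)) / of_real ((norm (1 - s))\<^sup>2)"
    using complex_div_cnj[of "a - cnj a * s" "1 - s"] by simp
  ultimately show ?thesis
    by (metis Im_divide_of_real)
qed

text \<open>Cayley maps \<open>T\<close> centred at \<open>a\<close> and \<open>h a\<close> turn
  \<open>h\<close> into a self-map of the disc fixing 0, to which the Schwarz lemma applies.
  Denominators are cleared so that \<open>w\<close> can later be sent to infinity by dividing by
  powers of its size.\<close>

lemma Schwarz_Pick_half_plane:
  assumes h: "h holomorphic_on \<H>" "h ` \<H> \<subseteq> \<H>" and a: "a \<in> \<H>" and w: "w \<in> \<H>"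
  shows "Im w * Im a * (norm (h w - cnj (h a)))\<^sup>2 \<le> Im (h w) * Im (h a) * (norm (w - cnj a))\<^sup>2"
proof -
  define S where "S = (\<lambda>s. (a - cnj a * s) / (1 - s))"
  define T where "T = (\<lambda>b z. (z - b) / (z - cnj b))"
  have ha: "h a \<in> \<H>" and hw: "h w \<in> \<H>" using h a w by auto
  have nz: "z - cnj b \<noteq> 0" if "z \<in> \<H>" "b \<in> \<H>" for z b
    using that by (auto simp: upper_half_plane_def complex_eq_iff)
  have Tn: "norm (T b z) < 1" if "z \<in> \<H>" "b \<in> \<H>" for z b
  proof -
    have "(norm (z - b))\<^sup>2 < (norm (z - cnj b))\<^sup>2"
    proof -
      have "0 < 4 * Im z * Im b" using that by (simp add: upper_half_plane_def)
      then show ?thesis using norm_diff_cnj_power2[of z b] by linarith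
    qed
    then have "norm (z - b) < norm (z - cnj b)"
      by (rule power2_less_imp_less) simp
    then show ?thesis
      using nz[OF that] by (simp add: T_def norm_divide)
  qed
  have SH: "S s \<in> \<H>" if "norm s < 1" for s
  proof -
    have "s \<noteq> 1" using that by auto
    moreover have "(norm s)\<^sup>2 < 1" using that by (simp add: abs_square_less_1)
    ultimately show ?thesis
      using a by (simp add: S_def upper_half_plane_def Im_Cayley_inverse)
  qed
  define F where "F = (\<lambda>s. T (h a) (h (S s)))"
  have holS: "S holomorphic_on ball 0 1"
    unfolding S_def by (intro holomorphic_intros) auto
  have "F holomorphic_on ball 0 1"
  proof -
    have "(h \<circ> S) holomorphic_on ball 0 1"
      by (rule holomorphic_on_compose_gen[OF holS h(1)]) (use SH in auto)
    then show ?thesis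
      unfolding F_def T_def o_def
      by (intro holomorphic_intros) (use nz ha h SH in \<open>auto simp: image_subset_iff\<close>)
  qed
  moreover have "F 0 = 0" by (simp add: F_def S_def T_def)
  moreover have "norm (F s) < 1" if "norm s < 1" for s
    unfolding F_def using Tn ha h SH[OF that] by (auto simp: image_subset_iff)
  ultimately have "norm (F (T a w)) \<le> norm (T a w)"
    using Schwarz_Lemma(1) Tn a w by blast
  moreover have "S (T a w) = w"
  proof -
    have "a - cnj a \<noteq> 0" using a by (auto simp: upper_half_plane_def complex_eq_iff)
    moreover have "1 - (w - a) / (w - cnj a) = (a - cnj a) / (w - cnj a)"
      using nz[OF w a] by (simp add: field_simps)
    moreover have "a - cnj a * ((w - a) / (w - cnj a)) = w * (a - cnj a) / (w - cnj a)"
      using nz[OF w a] by (simp add: field_simps)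
    ultimately show ?thesis
      using nz[OF w a] unfolding S_def T_def by simp
  qed
  ultimately have "norm (T (h a) (h w)) \<le> norm (T a w)" by (simp add: F_def)
  then have "(norm (T (h a) (h w)))\<^sup>2 \<le> (norm (T a w))\<^sup>2" by (simp add: power_mono)
  moreover define X Y x y where "X = (norm (h w - cnj (h a)))\<^sup>2" and "Y = (norm (h w - h a))\<^sup>2"
    and "x = (norm (w - cnj a))\<^sup>2" and "y = (norm (w - a))\<^sup>2"
  moreover have "0 < X" "0 < x" using nz[OF hw ha] nz[OF w a] by (auto simp: X_def x_def)
  ultimately have "Y * x \<le> y * X"
    by (simp add: T_def norm_divide power_divide divide_simps)
  \<comment> \<open>Both sides are subtracted from \<open>x * X\<close>; the differences
    \<open>x - y\<close> and \<open>X - Y\<close> are products of imaginary parts by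
    \<open>norm_diff_cnj_power2\<close>.\<close>
  then have "(x - y) * X \<le> (X - Y) * x" by (simp add: algebra_simps)
  then show ?thesis
    using norm_diff_cnj_power2[of w a] norm_diff_cnj_power2[of "h w" "h a"]
    by (simp add: X_def Y_def x_def y_def)
qed

text \<open>If \<open>Re f\<close> were positive somewhere, it would attain a maximum on a compact
  superlevel set. Instead of arguing by components, the maximum point with largest real part is
  taken; the maximum propagates to a point on its right, a contradiction. The boundary condition
  ranges over all points outside \<open>\<Omega>\<close>, being vacuous away from the
  closure.\<close>

lemma Re_nonpos_maximum_principle:
  fixes f :: "complex \<Rightarrow> complex"
  assumes opn: "open \<Omega>" and hol: "f holomorphic_on \<Omega>"
    and bd: "\<And>a \<epsilon>. a \<notin> \<Omega> \<Longrightarrow> \<epsilon> > 0 \<Longrightarrow> \<forall>\<^sub>F z in at a within \<Omega>. Re (f z) < \<epsilon>"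
    and inf: "\<And>\<epsilon>. \<epsilon> > 0 \<Longrightarrow> \<exists>R. \<forall>z\<in>\<Omega>. norm z > R \<longrightarrow> Re (f z) < \<epsilon>"
    and z: "z \<in> \<Omega>"
  shows "Re (f z) \<le> 0"
proof (rule ccontr)
  assume "\<not> Re (f z) \<le> 0"
  define \<epsilon> where "\<epsilon> = Re (f z)"
  have e: "\<epsilon> > 0" using \<open>\<not> Re (f z) \<le> 0\<close> by (simp add: \<epsilon>_def)
  define K where "K = {z\<in>\<Omega>. Re (f z) \<ge> \<epsilon>}"
  have cf: "continuous_on \<Omega> (\<lambda>z. Re (f z))"
    by (intro continuous_intros holomorphic_on_imp_continuous_on hol)
  \<comment> \<open>A point outside \<open>\<Omega>\<close> has a neighbourhood in which
    \<open>Re f < \<epsilon>\<close> by \<open>bd\<close>, apart from that point itself, so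
    \<open>K\<close> cannot accumulate at the boundary.\<close>
  have "open (- K)"
  proof (subst open_dist, intro ballI)
    fix a assume a: "a \<in> - K"
    show "\<exists>e>0. \<forall>y. dist y a < e \<longrightarrow> y \<in> - K"
    proof (cases "a \<in> \<Omega>")
      case True
      then have "Re (f a) < \<epsilon>" using a by (simp add: K_def)
      have "open (\<Omega> \<inter> (\<lambda>z. Re (f z)) -` {..<\<epsilon>})"
        by (rule continuous_open_preimage[OF cf opn]) auto
      moreover have "a \<in> \<Omega> \<inter> (\<lambda>z. Re (f z)) -` {..<\<epsilon>}" using True \<open>Re (f a) < \<epsilon>\<close> by simp
      ultimately obtain r where "r > 0" "\<And>y. dist y a < r \<Longrightarrow> y \<in> \<Omega> \<inter> (\<lambda>z. Re (f z)) -` {..<\<epsilon>}"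
        unfolding open_dist by blast
      then show ?thesis by (intro exI[of _ r]) (force simp: K_def)
    next
      case False
      then have "\<forall>\<^sub>F z in at a within \<Omega>. Re (f z) < \<epsilon>" using bd e by blast
      then obtain d where "d > 0" "\<And>x. x \<in> \<Omega> \<Longrightarrow> x \<noteq> a \<Longrightarrow> dist x a < d \<Longrightarrow> Re (f x) < \<epsilon>"
        unfolding eventually_at by blast
      then show ?thesis using a by (intro exI[of _ d]) (force simp: K_def)
    qed
  qed
  moreover obtain R where "\<forall>z\<in>\<Omega>. norm z > R \<longrightarrow> Re (f z) < \<epsilon>" using inf e by blast
  then have "bounded K" unfolding bounded_iff K_def by (intro exI[of _ R]) force
  ultimately have cK: "compact K" by (simp add: compact_eq_bounded_closed closed_def)
  have cfK: "continuous_on K (\<lambda>z. Re (f z))" by (rule continuous_on_subset[OF cf]) (auto simp: K_def)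
  have "z \<in> K" using z by (simp add: K_def \<epsilon>_def)
  then obtain z1 where z1: "z1 \<in> K" "\<And>y. y \<in> K \<Longrightarrow> Re (f y) \<le> Re (f z1)"
    using continuous_attains_sup[OF cK _ cfK] by blast
  \<comment> \<open>The set of maximum points; its rightmost element \<open>z2\<close> is the one
    that yields the contradiction.\<close>
  define M where "M = K \<inter> (\<lambda>z. Re (f z)) -` {Re (f z1)}"
  have "closed M"
    unfolding M_def by (rule continuous_closed_preimage[OF cfK]) (auto simp: cK compact_imp_closed)
  then have "compact M"
    using cK by (metis M_def Int_absorb1 Int_lower1 closed_Int_compact inf_commute)
  moreover have "z1 \<in> M" using z1 by (simp add: M_def)
  moreover have "continuous_on M Re" by (intro continuous_intros)
  ultimately obtain z2 where z2: "z2 \<in> M" "\<And>y. y \<in> M \<Longrightarrow> Re y \<le> Re z2"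
    using continuous_attains_sup[of M Re] by blast
  then have "z2 \<in> \<Omega>" by (simp add: M_def K_def)
  then obtain r where r: "r > 0" "ball z2 r \<subseteq> \<Omega>" using opn open_contains_ball by blast
  have mx: "Re (f y) \<le> Re (f z2)" if "y \<in> \<Omega>" for y
    using z1 z2 that by (cases "y \<in> K") (auto simp: M_def K_def)
  \<comment> \<open>Since \<open>norm (exp (f z)) = exp (Re (f z))\<close>, the maximum modulus
    principle turns a maximum of \<open>Re f\<close> into local constancy.\<close>
  have "(\<lambda>z. exp (f z)) constant_on ball z2 r"
  proof (rule maximum_modulus_principle[where U = "ball z2 r" and \<xi> = z2])
    show "(\<lambda>z. exp (f z)) holomorphic_on ball z2 r"
      by (intro holomorphic_intros holomorphic_on_subset[OF hol] r)
  qed (use r mx in auto)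
  moreover have y: "z2 + of_real (r/2) \<in> ball z2 r" using r by (simp add: dist_norm)
  ultimately have "exp (f (z2 + of_real (r/2))) = exp (f z2)"
    using r unfolding constant_on_def by (metis centre_in_ball)
  then have "Re (f (z2 + of_real (r/2))) = Re (f z2)"
    by (metis exp_inj_iff norm_exp_eq_Re)
  then have "z2 + of_real (r/2) \<in> M"
    using y r z2 by (auto simp: M_def K_def)
  then show False using z2(2)[of "z2 + of_real (r/2)"] r by simp
qed

text \<open>On the ray \<open>z = i y\<close> the term \<open>b / z\<close> equals
  \<open>- i b / y\<close>, so \<open>Im g = y - b / y + O(1 / y^2)\<close> there. All later
  statements about \<open>b\<close> are read off from this single ray.\<close>

lemma is_mapping_out_imaginary_axis:
  assumes g: "is_mapping_out A g b" and A: "bounded A"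
  shows is_mapping_out_eventually_notin: "\<forall>\<^sub>F y in at_top. \<i> * of_real y \<in> \<H> - A"
    and is_mapping_out_asymp: "((\<lambda>y. g (\<i> * of_real y) / of_real y) \<longlongrightarrow> \<i>) at_top"
    and is_mapping_out_Im_asymp: "((\<lambda>y. y * (y - Im (g (\<i> * of_real y)))) \<longlongrightarrow> b) at_top"
proof -
  obtain M where M: "\<And>z. z \<in> A \<Longrightarrow> norm z \<le> M" using A by (auto simp: bounded_iff)
  show ev: "\<forall>\<^sub>F y in at_top. \<i> * of_real y \<in> \<H> - A"
    using eventually_gt_at_top[of "max 0 M"]
  proof eventually_elim
    case (elim y)
    then show ?case using M[of "\<i> * of_real y"] by (auto simp: upper_half_plane_def norm_mult)
  qed
  obtain C R where CR: "\<forall>z \<in> \<H> - A. norm z > R \<longrightarrow>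
      norm (g z - z - complex_of_real b / z) \<le> C / (norm z)^2"
    using g by (auto simp: is_mapping_out_def)
  have est: "\<forall>\<^sub>F y in at_top. norm (g (\<i> * of_real y) - \<i> * of_real y + \<i> * of_real (b / y)) \<le> C / y\<^sup>2"
    using ev eventually_gt_at_top[of "max 0 R"]
  proof eventually_elim
    case (elim y)
    have "complex_of_real b / (\<i> * of_real y) = - (\<i> * of_real (b / y))"
      using elim by (simp add: field_simps)
    then show ?case using elim CR[rule_format, of "\<i> * of_real y"] by (simp add: norm_mult)
  qed
  have "((\<lambda>y. (g (\<i> * of_real y) - \<i> * of_real y + \<i> * of_real (b / y)) / of_real y) \<longlongrightarrow> 0) at_top"
  proof (rule Lim_null_comparison)
    show "\<forall>\<^sub>F y in at_top. norm ((g (\<i> * of_real y) - \<i> * of_real y + \<i> * of_real (b / y)) / of_real y) \<le> C / y\<^sup>2 / y"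
      using est eventually_gt_at_top[of 0]
      by eventually_elim (simp add: norm_divide divide_right_mono del: divide_divide_eq_left)
    show "((\<lambda>y. C / y\<^sup>2 / y) \<longlongrightarrow> 0) at_top" by real_asymp
  qed
  moreover have "((\<lambda>y. \<i> - \<i> * of_real (b / y / y)) \<longlongrightarrow> \<i> - \<i> * of_real 0) at_top"
    by (intro tendsto_intros) real_asymp
  ultimately have "((\<lambda>y. (g (\<i> * of_real y) - \<i> * of_real y + \<i> * of_real (b / y)) / of_real y
      + (\<i> - \<i> * of_real (b / y / y))) \<longlongrightarrow> 0 + (\<i> - \<i> * of_real 0)) at_top"
    by (rule tendsto_add)
  then have "((\<lambda>y. (g (\<i> * of_real y) - \<i> * of_real y + \<i> * of_real (b / y)) / of_real y
      + (\<i> - \<i> * of_real (b / y / y))) \<longlongrightarrow> \<i>) at_top" by simp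
  then show "((\<lambda>y. g (\<i> * of_real y) / of_real y) \<longlongrightarrow> \<i>) at_top"
    by (rule Lim_transform_eventually)
       (use eventually_gt_at_top[of 0] in eventually_elim, simp add: field_simps)
  have "((\<lambda>y. y * (y - Im (g (\<i> * of_real y))) - b) \<longlongrightarrow> 0) at_top"
  proof (rule Lim_null_comparison)
    show "\<forall>\<^sub>F y in at_top. norm (y * (y - Im (g (\<i> * of_real y))) - b) \<le> C / y"
      using est eventually_gt_at_top[of 0]
    proof eventually_elim
      case (elim y)
      have "\<bar>Im (g (\<i> * of_real y)) - y + b / y\<bar> \<le> C / y\<^sup>2"
        using abs_Im_le_cmod[of "g (\<i> * of_real y) - \<i> * of_real y + \<i> * of_real (b / y)"] elim(1) by simp
      then have "y * \<bar>Im (g (\<i> * of_real y)) - y + b / y\<bar> \<le> y * (C / y\<^sup>2)"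
        using elim by (intro mult_left_mono) auto
      moreover have "norm (y * (y - Im (g (\<i> * of_real y))) - b) = y * \<bar>Im (g (\<i> * of_real y)) - y + b / y\<bar>"
      proof -
        have "y * (y - Im (g (\<i> * of_real y))) - b = - (y * (Im (g (\<i> * of_real y)) - y + b / y))"
          using elim by (simp add: field_simps)
        then show ?thesis using elim by (simp add: abs_mult)
      qed
      ultimately show ?case using elim by (simp add: power2_eq_square)
    qed
    show "((\<lambda>y. C / y) \<longlongrightarrow> 0) at_top" by real_asymp
  qed
  then show "((\<lambda>y. y * (y - Im (g (\<i> * of_real y)))) \<longlongrightarrow> b) at_top"
    using Lim_null by blast
qed

lemma tendsto_Im_div:
  assumes "((\<lambda>y. g y / of_real y) \<longlongrightarrow> \<i>) at_top"
  shows "((\<lambda>y. Im (g y) / y) \<longlongrightarrow> 1) at_top"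
  using tendsto_Im[OF assms] by simp

lemma tendsto_norm_diff_div:
  assumes "((\<lambda>y. g y / of_real y) \<longlongrightarrow> \<i>) at_top"
  shows "((\<lambda>y. norm (g y - c) / y) \<longlongrightarrow> 1) at_top"
proof -
  have "((\<lambda>y. c / of_real y) \<longlongrightarrow> 0) at_top"
    by (rule tendsto_divide_0[OF tendsto_const filterlim_of_real_at_infinity])
  then have "((\<lambda>y. norm (g y / of_real y - c / of_real y)) \<longlongrightarrow> norm (\<i> - 0)) at_top"
    by (intro tendsto_intros assms)
  then have "((\<lambda>y. norm (g y / of_real y - c / of_real y)) \<longlongrightarrow> 1) at_top" by simp
  then show ?thesis
    by (rule Lim_transform_eventually)
       (use eventually_gt_at_top[of 0] in eventually_elim, simp add: norm_divide flip: diff_divide_distrib)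
qed

text \<open>Julia's argument: the Schwarz--Pick inequality for \<open>g\<^sub>A \<circ> g\<^sub>B\<^sup>-\<^sup>1\<close> with one of the two points
  sent to infinity.\<close>

lemma is_mapping_out_Im_mono:
  assumes mA: "is_mapping_out A gA a" and mB: "is_mapping_out B gB b"
    and bA: "bounded A" and bB: "bounded B" and oB: "open (\<H> - B)" and AB: "A \<subseteq> B" and z: "z \<in> \<H> - B"
  shows "Im (gB z) \<le> Im (gA z)"
proof -
  have hB: "gB holomorphic_on \<H> - B" "inj_on gB (\<H> - B)" "gB ` (\<H> - B) = \<H>"
    and hA: "gA holomorphic_on \<H> - A" "gA ` (\<H> - A) = \<H>"
    using mA mB by (auto simp: is_mapping_out_def)
  \<comment> \<open>The inverse of \<open>gB\<close>; because \<open>A \<subseteq> B\<close>, the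
    composition of \<open>gA\<close> with it is a holomorphic self-map of the half-plane.\<close>
  obtain k where k: "k holomorphic_on \<H>" "\<And>z. z \<in> \<H> - B \<Longrightarrow> k (gB z) = z"
    using holomorphic_has_inverse[OF hB(1) oB hB(2)] hB(3) by metis
  have kH: "k ` \<H> \<subseteq> \<H> - B" using k(2) by (subst hB(3)[symmetric]) auto
  define h where "h = gA \<circ> k"
  have h1: "h holomorphic_on \<H>"
    unfolding h_def by (rule holomorphic_on_compose_gen[OF k(1) hA(1)]) (use kH AB in blast)
  have h2: "h ` \<H> \<subseteq> \<H>" using kH AB hA(2) by (force simp: h_def)
  have hz: "h (gB z) = gA z" if "z \<in> \<H> - B" for z using k(2) that by (simp add: h_def)
  have gB: "gB z \<in> \<H>" if "z \<in> \<H> - B" for z using that hB by auto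
  let ?I = "\<lambda>y. \<i> * complex_of_real y"
  \<comment> \<open>The two sides of Schwarz-Pick for the points \<open>gB z\<close> and
    \<open>gB (i y)\<close>, divided by \<open>y^3\<close>, so that every factor containing
    \<open>y\<close> tends to 1.\<close>
  let ?L = "\<lambda>y. (Im (gB (?I y)) / y) * Im (gB z) * (norm (gA (?I y) - cnj (gA z)) / y)\<^sup>2"
  let ?R = "\<lambda>y. (Im (gA (?I y)) / y) * Im (gA z) * (norm (gB (?I y) - cnj (gB z)) / y)\<^sup>2"
  note asA = is_mapping_out_asymp[OF mA bA] note asB = is_mapping_out_asymp[OF mB bB]
  have "(?L \<longlongrightarrow> 1 * Im (gB z) * 1\<^sup>2) at_top"
    by (intro tendsto_intros tendsto_Im_div tendsto_norm_diff_div asA asB)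
  moreover have "(?R \<longlongrightarrow> 1 * Im (gA z) * 1\<^sup>2) at_top"
    by (intro tendsto_intros tendsto_Im_div tendsto_norm_diff_div asA asB)
  moreover have "\<forall>\<^sub>F y in at_top. ?L y \<le> ?R y"
    using is_mapping_out_eventually_notin[OF mB bB] eventually_gt_at_top[of 0]
  proof eventually_elim
    case (elim y)
    have "Im (gB (?I y)) * Im (gB z) * (norm (gA (?I y) - cnj (gA z)))\<^sup>2
        \<le> Im (gA (?I y)) * Im (gA z) * (norm (gB (?I y) - cnj (gB z)))\<^sup>2"
      using Schwarz_Pick_half_plane[OF h1 h2 gB[OF z] gB[OF elim(1)]] hz[OF z] hz[OF elim(1)] by simp
    then show ?case using elim(2) by (simp add: field_simps power2_eq_square)
  qed
  ultimately have "1 * Im (gB z) * 1\<^sup>2 \<le> 1 * Im (gA z) * 1\<^sup>2"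
    by (intro tendsto_le[of at_top ?R _ ?L]) auto
  then show ?thesis by simp
qed

lemma is_mapping_out_diff_asymp:
  assumes mA: "is_mapping_out A gA a" and mB: "is_mapping_out B gB b"
    and bA: "bounded A" and bB: "bounded B"
  shows "((\<lambda>y. y * (Im (gA (\<i> * of_real y)) - Im (gB (\<i> * of_real y)))) \<longlongrightarrow> b - a) at_top"
  using tendsto_diff[OF is_mapping_out_Im_asymp[OF mB bB] is_mapping_out_Im_asymp[OF mA bA]]
  by (simp add: algebra_simps)

lemma is_mapping_out_mono:
  assumes mA: "is_mapping_out A gA a" and mB: "is_mapping_out B gB b"
    and bA: "bounded A" and bB: "bounded B" and oB: "open (\<H> - B)" and AB: "A \<subseteq> B"
  shows "a \<le> b"
proof -
  have "\<forall>\<^sub>F y in at_top. 0 \<le> y * (Im (gA (\<i> * of_real y)) - Im (gB (\<i> * of_real y)))"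
    using is_mapping_out_eventually_notin[OF mB bB] eventually_gt_at_top[of 0]
    by eventually_elim (use is_mapping_out_Im_mono[OF assms] in auto)
  then have "0 \<le> b - a"
    by (rule tendsto_lowerbound[OF is_mapping_out_diff_asymp[OF mA mB bA bB]]) auto
  then show ?thesis by simp
qed

text \<open>The function \<open>f = gA o gB^(-1) - id\<close> has nonnegative imaginary part. If
  \<open>Im f\<close> vanishes somewhere, the open mapping theorem makes \<open>f\<close> a real
  constant, contradicting injectivity of \<open>gA\<close> at a point of \<open>B - A\<close>.
  Otherwise \<open>f\<close> maps into the half-plane, and Schwarz-Pick based at \<open>\<i>\<close>
  forbids decay of \<open>Im f\<close> faster than \<open>1/y\<close>, so \<open>b - a\<close> is
  positive.\<close>

lemma is_mapping_out_strict_mono: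
  assumes mA: "is_mapping_out A gA a" and mB: "is_mapping_out B gB b"
    and bA: "bounded A" and bB: "bounded B" and oB: "open (\<H> - B)" and AB: "A \<subset> B" and BH: "B \<subseteq> \<H>"
  shows "a < b"
proof (rule ccontr)
  assume "\<not> a < b"
  then have ab: "a = b" using is_mapping_out_mono[OF mA mB bA bB oB] AB by auto
  have hB: "gB holomorphic_on \<H> - B" "inj_on gB (\<H> - B)" "gB ` (\<H> - B) = \<H>"
    and hA: "gA holomorphic_on \<H> - A" "inj_on gA (\<H> - A)" "gA ` (\<H> - A) = \<H>"
    using mA mB by (auto simp: is_mapping_out_def)
  obtain k where k: "k holomorphic_on \<H>" "\<And>z. z \<in> \<H> - B \<Longrightarrow> k (gB z) = z"
    using holomorphic_has_inverse[OF hB(1) oB hB(2)] hB(3) by metis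
  have kH: "k ` \<H> \<subseteq> \<H> - B" using k(2) by (subst hB(3)[symmetric]) auto
  have gk: "gB (k w) = w" if "w \<in> \<H>" for w using hB(3) k(2) that by (metis imageE)
  define f where "f = (\<lambda>w. gA (k w) - w)"
  have hk: "(gA \<circ> k) holomorphic_on \<H>"
    by (rule holomorphic_on_compose_gen[OF k(1) hA(1)]) (use kH AB in blast)
  have f1: "f holomorphic_on \<H>"
    using hk unfolding f_def o_def by (intro holomorphic_intros)
  have fz: "f (gB z) = gA z - gB z" if "z \<in> \<H> - B" for z using k(2) that by (simp add: f_def)
  have gB: "gB z \<in> \<H>" if "z \<in> \<H> - B" for z using that hB by auto
  have f0: "0 \<le> Im (f w)" if "w \<in> \<H>" for w
    using is_mapping_out_Im_mono[OF mA mB bA bB oB _ , of "k w"] kH AB that gk by (auto simp: f_def)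
  show False
  proof (cases "\<exists>w\<in>\<H>. Im (f w) = 0")
    case True
    then obtain w0 where w0: "w0 \<in> \<H>" "Im (f w0) = 0" by blast
    have "f constant_on \<H>"
    proof (rule ccontr)
      assume "\<not> f constant_on \<H>"
      then have "open (f ` \<H>)"
        using open_mapping_thm[OF f1 open_upper_half_plane convex_connected[OF convex_upper_half_plane] open_upper_half_plane]
        by blast
      then obtain r where "r > 0" "ball (f w0) r \<subseteq> f ` \<H>" using w0 open_contains_ball by blast
      moreover have "f w0 - \<i> * of_real (r/2) \<in> ball (f w0) r" using \<open>r > 0\<close> by (simp add: dist_norm norm_mult)
      ultimately obtain w where w: "w \<in> \<H>" "f w = f w0 - \<i> * of_real (r/2)" by (metis imageE subsetD)
      then show False using f0[OF w(1)] w0 \<open>r > 0\<close> by simp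
    qed
    then obtain c where c: "\<And>w. w \<in> \<H> \<Longrightarrow> f w = c" by (auto simp: constant_on_def)
    then have c0: "Im c = 0" using w0 by metis
    \<comment> \<open>With \<open>f = c\<close> real, the value \<open>gA p - c\<close> is
      \<open>gB q\<close> for some \<open>q\<close> outside \<open>B\<close>, whence
      \<open>gA q = gA p\<close>.\<close>
    obtain p where p: "p \<in> B" "p \<notin> A" using AB by blast
    then have "gA p \<in> \<H>" using BH hA(3) by blast
    then have "gA p - c \<in> \<H>" using c0 by (simp add: upper_half_plane_def)
    then obtain q where q: "q \<in> \<H> - B" "gB q = gA p - c" using hB(3) by (metis imageE)
    then have "gA q = gA p" using fz[OF q(1)] c[OF gB[OF q(1)]] by simp
    then have "q = p" by (rule inj_onD[OF hA(2)]) (use p q AB BH in auto)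
    then show False using p q by simp
  next
    case False
    then have "Im (f w) > 0" if "w \<in> \<H>" for w using f0[OF that] that by (metis less_eq_real_def)
    then have f2: "f ` \<H> \<subseteq> \<H>" by (auto simp: upper_half_plane_def)
    have iH: "\<i> \<in> \<H>" by (simp add: upper_half_plane_def)
    define m where "m = Im (f \<i>)"
    have m: "m > 0" using f2 iH by (auto simp: m_def upper_half_plane_def image_subset_iff)
    let ?I = "\<lambda>y. \<i> * complex_of_real y"
    \<comment> \<open>Here \<open>norm (f w - cnj (f \<i>))\<close> is bounded below by
      \<open>m\<close>, and the inequality is divided by \<open>y\<close> once; the limit reads
      \<open>m^2 \<le> (b - a) * m\<close>.\<close>
    let ?L = "\<lambda>y. (Im (gB (?I y)) / y) * m\<^sup>2"
    let ?R = "\<lambda>y. (y * (Im (gA (?I y)) - Im (gB (?I y)))) * m * (norm (gB (?I y) - cnj \<i>) / y)\<^sup>2"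
    note asB = is_mapping_out_asymp[OF mB bB]
    have "(?L \<longlongrightarrow> 1 * m\<^sup>2) at_top"
      by (intro tendsto_intros tendsto_Im_div asB)
    moreover have "(?R \<longlongrightarrow> (b - a) * m * 1\<^sup>2) at_top"
      by (intro tendsto_intros is_mapping_out_diff_asymp[OF mA mB bA bB] tendsto_norm_diff_div asB)
    moreover have "\<forall>\<^sub>F y in at_top. ?L y \<le> ?R y"
      using is_mapping_out_eventually_notin[OF mB bB] eventually_gt_at_top[of 0]
    proof eventually_elim
      case (elim y)
      have w: "gB (?I y) \<in> \<H>" using gB elim by blast
      then have wp: "0 < Im (gB (?I y))" by (simp add: upper_half_plane_def)
      have "Im (gB (?I y)) * m\<^sup>2 \<le> Im (gB (?I y)) * (norm (f (gB (?I y)) - cnj (f \<i>)))\<^sup>2"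
      proof (intro mult_left_mono power_mono)
        have "m \<le> Im (f (gB (?I y)) - cnj (f \<i>))" using f0[OF w] by (simp add: m_def)
        also have "\<dots> \<le> norm (f (gB (?I y)) - cnj (f \<i>))"
          using abs_Im_le_cmod abs_le_D1 by blast
        finally show "m \<le> norm (f (gB (?I y)) - cnj (f \<i>))" .
      qed (use m wp in auto)
      also have "\<dots> \<le> Im (f (gB (?I y))) * m * (norm (gB (?I y) - cnj \<i>))\<^sup>2"
        using Schwarz_Pick_half_plane[OF f1 f2 iH w] by (simp add: m_def)
      also have "Im (f (gB (?I y))) = Im (gA (?I y)) - Im (gB (?I y))"
        using fz[OF elim(1)] by simp
      finally have "Im (gB (?I y)) * m\<^sup>2 \<le> (Im (gA (?I y)) - Im (gB (?I y))) * m * (norm (gB (?I y) - cnj \<i>))\<^sup>2" .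
      then have "Im (gB (?I y)) * m\<^sup>2 / y \<le> (Im (gA (?I y)) - Im (gB (?I y))) * m * (norm (gB (?I y) - cnj \<i>))\<^sup>2 / y"
        using elim(2) by (intro divide_right_mono) auto
      then show ?case using elim(2) by (simp add: power_divide power2_eq_square mult_ac)
    qed
    ultimately have "1 * m\<^sup>2 \<le> (b - a) * m * 1\<^sup>2"
      by (intro tendsto_le[of at_top ?R _ ?L]) auto
    then show False using ab m by simp
  qed
qed

text \<open>Monotonicity applied to \<open>A \<subseteq> A\<close> in both directions gives
  uniqueness of the coefficient, hence meaning to the definite description.\<close>

lemma hcap_hull_eq:
  assumes "is_mapping_out A g b" "bounded A" "open (\<H> - A)"
  shows "hcap_hull A = b"
  unfolding hcap_hull_def
proof (rule the_equality)
  show "\<exists>g. is_mapping_out A g b" using assms by blast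
  fix b' assume "\<exists>g. is_mapping_out A g b'"
  then show "b' = b" using is_mapping_out_mono assms by (metis order_antisym subset_refl)
qed

lemma is_mapping_out_empty: "is_mapping_out {} (\<lambda>z. z) 0"
  unfolding is_mapping_out_def by (auto intro!: exI[of _ 0] holomorphic_intros)

lemma is_mapping_out_Im_le:
  assumes "is_mapping_out A g b" "bounded A" "open (\<H> - A)" "z \<in> \<H> - A"
  shows "Im (g z) \<le> Im z"
  using is_mapping_out_Im_mono[OF is_mapping_out_empty assms(1)] assms by auto

text \<open>The comparison function \<open>4 R \<delta> Im (-1 / (z + iR))\<close> is positive and harmonic in the half-plane, at
  least \<open>\<delta>\<close> on the half-disc of radius \<open>R\<close>, and decays like \<open>1/y\<close> along the imaginary axis.\<close>

lemma is_mapping_out_le_add: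
  assumes mA: "is_mapping_out A gA a" and mB: "is_mapping_out B gB b"
    and bA: "bounded A" and bB: "bounded B" and oA: "open (\<H> - A)" and oB: "open (\<H> - B)"
    and bd: "\<And>p \<epsilon>. p \<notin> \<H> - A \<Longrightarrow> \<epsilon> > 0 \<Longrightarrow> \<forall>\<^sub>F z in at p within \<H> - A. Im (gA z) < \<epsilon>"
    and small: "\<And>z. z \<in> B - A \<Longrightarrow> Im (gA z) \<le> \<delta>"
    and R: "R > 0" "B \<subseteq> \<H> \<inter> cball 0 R" and d: "\<delta> \<ge> 0"
  shows "b \<le> a + 4 * R * \<delta>"
proof -
  define \<Omega> where "\<Omega> = \<H> - (A \<union> B)"
  have sub: "\<Omega> \<subseteq> \<H> - A" "\<Omega> \<subseteq> \<H> - B" by (auto simp: \<Omega>_def)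
  have oO: "open \<Omega>"
    using open_Int[OF oA oB] by (metis \<Omega>_def Diff_Un)
  have hB: "gB holomorphic_on \<H> - B" "gB ` (\<H> - B) = \<H>"
    and hA: "gA holomorphic_on \<H> - A" "gA ` (\<H> - A) = \<H>"
    using mA mB by (auto simp: is_mapping_out_def)
  define P where "P = (\<lambda>z. - Im (of_real (4 * R * \<delta>) / (z + \<i> * of_real R)))"
  have P: "P z = 4 * R * \<delta> * (Im z + R) / (norm (z + \<i> * of_real R))\<^sup>2" for z
    unfolding P_def by (simp add: Im_divide cmod_power2)
  have P0: "P z \<ge> 0" if "z \<in> \<H>" for z
    using that R d by (simp add: P upper_half_plane_def)
  have nz: "z + \<i> * of_real R \<noteq> 0" if "z \<in> \<H>" for z
    using that R by (auto simp: upper_half_plane_def complex_eq_iff)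
  have P1: "P z \<ge> \<delta>" if "z \<in> \<H>" "norm z \<le> R" for z
  proof -
    have "norm (z + \<i> * of_real R) \<le> norm z + norm (\<i> * complex_of_real R)"
      by (rule norm_triangle_ineq)
    then have "norm (z + \<i> * of_real R) \<le> 2 * R"
      using that R by (simp add: norm_mult)
    then have "(norm (z + \<i> * of_real R))\<^sup>2 \<le> (2 * R)\<^sup>2" by (rule power_mono) simp
    \<comment> \<open>On the half-disc the squared distance to \<open>- i R\<close> is at most
      \<open>4 R^2\<close>, which is what the constant 4 compensates.\<close>
    moreover have "4 * R * (Im z + R) \<ge> (2 * R)\<^sup>2"
      using that R by (simp add: upper_half_plane_def power2_eq_square algebra_simps)
    ultimately have "(norm (z + \<i> * of_real R))\<^sup>2 \<le> 4 * R * (Im z + R)" by linarith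
    then have "\<delta> * (norm (z + \<i> * of_real R))\<^sup>2 \<le> \<delta> * (4 * R * (Im z + R))"
      using d by (rule mult_left_mono)
    then show ?thesis
      using nz[OF that(1)] by (simp add: P pos_le_divide_eq mult_ac)
  qed
  define f where "f = (\<lambda>z. - \<i> * (gA z - gB z + of_real (4 * R * \<delta>) / (z + \<i> * of_real R)))"
  have Ref: "Re (f z) = Im (gA z) - Im (gB z) - P z" for z
    by (simp add: f_def P_def)
  have gBp: "Im (gB z) > 0" if "z \<in> \<Omega>" for z
    using hB(2) sub that by (auto simp: upper_half_plane_def)
  have key: "Re (f z) \<le> 0" if "z \<in> \<Omega>" for z
  proof (rule Re_nonpos_maximum_principle[OF oO _ _ _ that])
    show "f holomorphic_on \<Omega>"
      unfolding f_def
      by (intro holomorphic_intros holomorphic_on_subset[OF hA(1)] holomorphic_on_subset[OF hB(1)] sub)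
         (use nz in \<open>auto simp: \<Omega>_def\<close>)
  next
    fix p and \<epsilon> :: real assume p: "p \<notin> \<Omega>" and e: "\<epsilon> > 0"
    show "\<forall>\<^sub>F z in at p within \<Omega>. Re (f z) < \<epsilon>"
    \<comment> \<open>Since \<open>- Im gB\<close> and \<open>- P\<close> are nonpositive, vanishing
      of \<open>Im gA\<close> settles boundary points outside \<open>\<H> - A\<close>. The remaining
      ones lie in \<open>B - A\<close>, where \<open>Im gA \<le> \<delta> \<le> P\<close>.\<close>
    proof (cases "p \<in> \<H> - A")
      case False
      then have "\<forall>\<^sub>F z in at p within \<Omega>. Im (gA z) < \<epsilon>"
        using bd[OF False e] filter_leD[OF at_le[OF sub(1)]] by blast
      moreover have "\<forall>\<^sub>F z in at p within \<Omega>. z \<in> \<Omega>"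
        by (simp add: eventually_at_filter)
      ultimately show ?thesis
      proof eventually_elim
        case (elim z)
        then show ?case using gBp[OF elim(2)] P0[of z] by (simp add: Ref \<Omega>_def)
      qed
    next
      case True
      then have pB: "p \<in> B" using p by (auto simp: \<Omega>_def)
      have "isCont gA p"
        using hA(1) oA True by (metis continuous_on_eq_continuous_at holomorphic_on_imp_continuous_on)
      moreover have "isCont P p"
        unfolding P_def using nz[of p] True by (intro continuous_intros) auto
      ultimately have "isCont (\<lambda>z. Im (gA z) - P z) p" by simp
      then have "((\<lambda>z. Im (gA z) - P z) \<longlongrightarrow> Im (gA p) - P p) (at p within \<Omega>)"
        using isCont_def tendsto_within_subset by blast
      moreover have "Im (gA p) - P p < \<epsilon>"
      proof -
        have "norm p \<le> R" using R(2) pB by (auto simp: dist_norm)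
        then have "P p \<ge> \<delta>" using P1 True by blast
        moreover have "Im (gA p) \<le> \<delta>" using small pB True by auto
        ultimately show ?thesis using e by linarith
      qed
      ultimately have "\<forall>\<^sub>F z in at p within \<Omega>. Im (gA z) - P z < \<epsilon>"
        by (rule order_tendstoD)
      moreover have "\<forall>\<^sub>F z in at p within \<Omega>. z \<in> \<Omega>"
        by (simp add: eventually_at_filter)
      ultimately show ?thesis
      proof eventually_elim
        case (elim z)
        then show ?case using gBp[OF elim(2)] by (simp add: Ref)
      qed
    qed
  next
    fix \<epsilon> :: real assume e: "\<epsilon> > 0"
    obtain CA RA where A: "\<forall>z \<in> \<H> - A. norm z > RA \<longrightarrow>
        norm (gA z - z - complex_of_real a / z) \<le> CA / (norm z)^2"
      using mA by (auto simp: is_mapping_out_def)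
    obtain CB RB where B: "\<forall>z \<in> \<H> - B. norm z > RB \<longrightarrow>
        norm (gB z - z - complex_of_real b / z) \<le> CB / (norm z)^2"
      using mB by (auto simp: is_mapping_out_def)
    have "((\<lambda>x. (\<bar>a\<bar> + \<bar>b\<bar>) / x + (CA + CB) / x\<^sup>2) \<longlongrightarrow> 0) at_top" by real_asymp
    then have "\<forall>\<^sub>F x in at_top. (\<bar>a\<bar> + \<bar>b\<bar>) / x + (CA + CB) / x\<^sup>2 < \<epsilon>"
      by (rule order_tendstoD) (use e in auto)
    then obtain N where N: "\<And>x. x \<ge> N \<Longrightarrow> (\<bar>a\<bar> + \<bar>b\<bar>) / x + (CA + CB) / x\<^sup>2 < \<epsilon>"
      unfolding eventually_at_top_linorder by blast
    show "\<exists>R. \<forall>z\<in>\<Omega>. norm z > R \<longrightarrow> Re (f z) < \<epsilon>"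
    proof (intro exI[of _ "max N (max RA RB)"] ballI impI)
      fix z assume z: "z \<in> \<Omega>" "max N (max RA RB) < norm z"
      have "gA z - gB z = (gA z - z - of_real a / z) - (gB z - z - of_real b / z) + (of_real a / z - of_real b / z)"
        by simp
      also have "norm \<dots> \<le> norm ((gA z - z - of_real a / z) - (gB z - z - of_real b / z)) + norm (of_real a / z - of_real b / z)"
        by (rule norm_triangle_ineq)
      also have "\<dots> \<le> (CA / (norm z)\<^sup>2 + CB / (norm z)\<^sup>2) + (\<bar>a\<bar> / norm z + \<bar>b\<bar> / norm z)"
      proof (rule add_mono)
        have "norm (gA z - z - of_real a / z) \<le> CA / (norm z)\<^sup>2" "norm (gB z - z - of_real b / z) \<le> CB / (norm z)\<^sup>2"
          using A B z sub by auto
        then show "norm ((gA z - z - of_real a / z) - (gB z - z - of_real b / z)) \<le> CA / (norm z)\<^sup>2 + CB / (norm z)\<^sup>2"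
          by (meson add_mono norm_triangle_ineq4 order_trans)
        show "norm (of_real a / z - of_real b / z) \<le> \<bar>a\<bar> / norm z + \<bar>b\<bar> / norm z"
          using norm_triangle_ineq4[of "of_real a / z" "of_real b / z"] by (simp add: norm_divide)
      qed
      also have "\<dots> = (\<bar>a\<bar> + \<bar>b\<bar>) / norm z + (CA + CB) / (norm z)\<^sup>2" by (simp add: add_divide_distrib)
      also have "\<dots> < \<epsilon>" using N[of "norm z"] z by simp
      finally have "norm (gA z - gB z) < \<epsilon>" .
      moreover have "Im (gA z) - Im (gB z) \<le> norm (gA z - gB z)"
        using abs_Im_le_cmod[of "gA z - gB z"] by simp
      ultimately show "Re (f z) < \<epsilon>" using P0[of z] z by (simp add: Ref \<Omega>_def)
    qed
  qed
  \<comment> \<open>On the imaginary axis \<open>P\<close> equals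
    \<open>4 R \<delta> / (y + R)\<close>, so multiplication by \<open>y\<close> converts the
    pointwise bound into the bound on \<open>b - a\<close>.\<close>
  have "\<forall>\<^sub>F y in at_top. y * (Im (gA (\<i> * of_real y)) - Im (gB (\<i> * of_real y))) \<le> 4 * R * \<delta>"
    using is_mapping_out_eventually_notin[OF mA bA] is_mapping_out_eventually_notin[OF mB bB] eventually_gt_at_top[of 0]
  proof eventually_elim
    case (elim y)
    have "Im (gA (\<i> * of_real y)) - Im (gB (\<i> * of_real y)) \<le> P (\<i> * of_real y)"
      using key[of "\<i> * of_real y"] elim by (simp add: Ref \<Omega>_def)
    also have "P (\<i> * of_real y) = 4 * R * \<delta> * (y + R) / (y + R)\<^sup>2"
    proof -
      have "(norm (\<i> * of_real y + \<i> * complex_of_real R))\<^sup>2 = (y + R)\<^sup>2" by (simp add: cmod_power2)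
      then show ?thesis by (simp add: P)
    qed
    also have "\<dots> = 4 * R * \<delta> / (y + R)"
      using elim R by (simp add: power2_eq_square)
    also have "\<dots> \<le> 4 * R * \<delta> / y" using elim R d by (intro divide_left_mono) auto
    finally show ?case using elim(3) by (simp add: pos_le_divide_eq mult.commute)
  qed
  then have "b - a \<le> 4 * R * \<delta>"
    by (rule tendsto_upperbound[OF is_mapping_out_diff_asymp[OF mA mB bA bB]]) auto
  then show ?thesis by simp
qed

section \<open>Hulls attached to the origin\<close>

text \<open>A checkable sufficient condition for \<open>is_hull\<close>: adjoining the root 0 makes
  the set compact and connected, and simple connectivity of the complement is replaced by
  connectedness. The empty set qualifies.\<close>

definition rooted_hull :: "complex set \<Rightarrow> bool" where
  "rooted_hull A \<longleftrightarrow> A \<subseteq> \<H> \<and> compact (insert 0 A) \<and> connected (insert 0 A) \<and> connected (\<H> - A)"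

lemma zero_notin_upper_half_plane: "0 \<notin> \<H>"
  by (simp add: upper_half_plane_def)

lemma rooted_hull_bounded: "rooted_hull A \<Longrightarrow> bounded A"
  unfolding rooted_hull_def using bounded_subset compact_imp_bounded by blast

lemma rooted_hull_open:
  assumes "rooted_hull A"
  shows "open (\<H> - A)"
proof -
  have "\<H> - A = \<H> - insert 0 A" using zero_notin_upper_half_plane by auto
  then show ?thesis
    using assms open_upper_half_plane compact_imp_closed by (auto simp: rooted_hull_def)
qed

text \<open>The complement of \<open>\<H> - A\<close> is the closed lower half-plane joined to
  \<open>A\<close> at 0, thus connected and unbounded; a connected open plane set whose complement
  has only unbounded components is simply connected.\<close>

lemma rooted_hull_simply_connected:
  assumes "rooted_hull A"
  shows "simply_connected (\<H> - A)"
proof -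
  have eq: "- (\<H> - A) = {z. Im z \<le> 0} \<union> insert 0 A"
    by (auto simp: upper_half_plane_def)
  have "connected {z. Im z \<le> 0}"
    by (intro convex_connected convex_halfspace_Im_le)
  then have c: "connected (- (\<H> - A))"
    unfolding eq using assms by (intro connected_Un) (auto simp: rooted_hull_def)
  have "\<not> bounded (- (\<H> - A))"
  proof
    assume "bounded (- (\<H> - A))"
    then obtain M where M: "\<And>z. z \<in> - (\<H> - A) \<Longrightarrow> norm z \<le> M" by (auto simp: bounded_iff)
    have "norm (complex_of_real (\<bar>M\<bar> + 1)) \<le> M"
      by (rule M) (auto simp: upper_half_plane_def)
    then show False unfolding norm_of_real by linarith
  qed
  then have "\<forall>C\<in>components (- (\<H> - A)). \<not> bounded C"
    using c by (metis bounded_empty components_eq_sing_iff singletonD)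
  then show ?thesis
    using assms rooted_hull_open simply_connected_eq_unbounded_complement_components
    by (auto simp: rooted_hull_def)
qed

lemma rooted_hull_is_hull:
  assumes "rooted_hull A"
  shows "is_hull A"
proof -
  have "closure A \<subseteq> insert 0 A"
    using assms by (intro closure_minimal) (auto simp: rooted_hull_def compact_imp_closed)
  then have "A = \<H> \<inter> closure A"
    using assms closure_subset[of A] zero_notin_upper_half_plane by (auto simp: rooted_hull_def)
  then show ?thesis
    unfolding is_hull_def using assms rooted_hull_bounded rooted_hull_simply_connected by blast
qed

lemma rooted_hull_fill:
  assumes "rooted_hull A"
  shows "hull_fill A = A"
  unfolding hull_fill_def
  by (rule the_equality) (use rooted_hull_is_hull[OF assms] in auto)

lemma rooted_hull_hcap:
  assumes "rooted_hull A" "is_mapping_out A g b"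
  shows "hcap A = b"
  unfolding hcap_def rooted_hull_fill[OF assms(1)]
  using assms hcap_hull_eq rooted_hull_bounded rooted_hull_open by blast

section \<open>Symmetric Riemann maps, Taylor remainders and the Joukowski map\<close>

lemma cnj_image_eq:
  assumes "\<And>z. z \<in> S \<Longrightarrow> cnj z \<in> S"
  shows "cnj ` S = S"
proof (intro equalityI subsetI)
  fix x assume "x \<in> S"
  then have "cnj (cnj x) \<in> cnj ` S" by (intro imageI assms)
  then show "x \<in> cnj ` S" by simp
qed (use assms in auto)

text \<open>A Riemann map \<open>p\<close> fixing 0 and its conjugate \<open>p'\<close> differ by a
  disc automorphism fixing 0, that is, a rotation by \<open>\<alpha>\<close>. Distributing a square
  root of \<open>\<alpha>\<close> makes the map commute with conjugation.\<close>

lemma symmetric_Riemann_map: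
  assumes D: "open D" "simply_connected D" "0 \<in> D" "D \<noteq> UNIV"
    and sym: "\<And>z. z \<in> D \<Longrightarrow> cnj z \<in> D"
  obtains \<phi> \<psi> where "\<phi> holomorphic_on D" "\<psi> holomorphic_on ball 0 1"
    "\<And>z. z \<in> D \<Longrightarrow> \<phi> z \<in> ball 0 1 \<and> \<psi> (\<phi> z) = z"
    "\<And>w. w \<in> ball 0 1 \<Longrightarrow> \<psi> w \<in> D \<and> \<phi> (\<psi> w) = w"
    "\<phi> 0 = 0" "\<And>z. z \<in> D \<Longrightarrow> \<phi> (cnj z) = cnj (\<phi> z)"
proof -
  obtain f g where f: "f holomorphic_on D" "\<And>z. z \<in> D \<Longrightarrow> f z \<in> ball 0 1 \<and> g (f z) = z"
    and g: "g holomorphic_on ball 0 1" "\<And>z. z \<in> ball 0 1 \<Longrightarrow> g z \<in> D \<and> f (g z) = z"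
    using simply_connected_eq_biholomorphic_to_disc[OF D(1)] D by blast
  obtain m n where mn: "m (f 0) = 0"
    "m holomorphic_on ball 0 1" "m ` ball 0 1 \<subseteq> ball 0 1"
    "n holomorphic_on ball 0 1" "n ` ball 0 1 \<subseteq> ball 0 1"
    "\<And>z. z \<in> ball 0 1 \<Longrightarrow> m (n z) = z" "\<And>z. z \<in> ball 0 1 \<Longrightarrow> n (m z) = z"
    using ball_biholomorphism_exists[of "f 0"] f D by blast
  define p where "p = m \<circ> f"
  define q where "q = g \<circ> n"
  have p: "p holomorphic_on D"
    unfolding p_def by (rule holomorphic_on_compose_gen[OF f(1) mn(2)]) (use f in auto)
  have q: "q holomorphic_on ball 0 1"
    unfolding q_def by (rule holomorphic_on_compose_gen[OF mn(4) g(1)]) (use mn in auto)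
  have pq: "p z \<in> ball 0 1" "q (p z) = z" if "z \<in> D" for z
  proof -
    have fz: "f z \<in> ball 0 1" using f(2)[OF that] by blast
    then show "p z \<in> ball 0 1" using mn(3) by (auto simp: p_def image_subset_iff)
    show "q (p z) = z" using mn(7)[OF fz] f(2)[OF that] by (simp add: p_def q_def)
  qed
  have qp: "q w \<in> D" "p (q w) = w" if "w \<in> ball 0 1" for w
  proof -
    have "n w \<in> ball 0 1" using mn(5) that by blast
    then show "q w \<in> D" "p (q w) = w" using g(2) mn(6)[OF that] by (auto simp: p_def q_def)
  qed
  have p0: "p 0 = 0" by (simp add: p_def mn)
  have q0: "q 0 = 0" using pq(2)[OF D(3)] p0 by simp
  have cD: "cnj ` D = D" by (rule cnj_image_eq[OF sym])
  have cb: "cnj ` ball 0 1 = ball 0 1"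
    by (rule cnj_image_eq) simp
  define p' where "p' = cnj \<circ> p \<circ> cnj"
  define q' where "q' = cnj \<circ> q \<circ> cnj"
  have p': "p' holomorphic_on D"
    unfolding p'_def by (rule holomorphic_on_compose_cnj_cnj) (use p cD D in auto)
  have q': "q' holomorphic_on ball 0 1"
    unfolding q'_def by (rule holomorphic_on_compose_cnj_cnj) (use q cb in auto)
  have p'b: "p' z \<in> ball 0 1" if "z \<in> D" for z using pq(1)[of "cnj z"] sym[OF that] by (simp add: p'_def)
  have q'D: "q' w \<in> D" if "w \<in> ball 0 1" for w using qp(1)[of "cnj w"] sym that by (simp add: q'_def)
  have p'q': "p' (q' w) = w" if "w \<in> ball 0 1" for w using qp(2)[of "cnj w"] that by (simp add: q'_def p'_def)
  have q'p': "q' (p' z) = z" if "z \<in> D" for z using pq(2)[of "cnj z"] sym that by (simp add: q'_def p'_def)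
  have F: "(p' \<circ> q) holomorphic_on ball 0 1"
    by (rule holomorphic_on_compose_gen[OF q p']) (use qp in auto)
  have G: "(p \<circ> q') holomorphic_on ball 0 1"
    by (rule holomorphic_on_compose_gen[OF q' p]) (use q'D in auto)
  have Fn: "norm ((p' \<circ> q) w) \<le> norm w" if "norm w < 1" for w
    by (rule Schwarz_Lemma(1)[OF F]) (use that qp p'b in \<open>auto simp: q0 p0 p'_def\<close>)
  have Gn: "norm ((p \<circ> q') w) \<le> norm w" if "norm w < 1" for w
    by (rule Schwarz_Lemma(1)[OF G]) (use that pq q'D in \<open>auto simp: q0 p0 q'_def\<close>)
  \<comment> \<open>\<open>p \<circ> q'\<close> is the inverse of \<open>p' \<circ> q\<close> and
    also obeys the Schwarz bound, which forces equality.\<close>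
  have Fe: "norm ((p' \<circ> q) w) = norm w" if "norm w < 1" for w
  proof (rule antisym[OF Fn[OF that]])
    have "norm ((p' \<circ> q) w) < 1" using Fn[OF that] that by simp
    then have "norm ((p \<circ> q') ((p' \<circ> q) w)) \<le> norm ((p' \<circ> q) w)" by (rule Gn)
    moreover have "(p \<circ> q') ((p' \<circ> q) w) = w" using q'p'[of "q w"] qp[of w] that by simp
    ultimately show "norm w \<le> norm ((p' \<circ> q) w)" by simp
  qed
  have "\<exists>\<alpha>. (\<forall>w. norm w < 1 \<longrightarrow> (p' \<circ> q) w = \<alpha> * w) \<and> norm \<alpha> = 1"
  proof (rule Schwarz_Lemma(3)[OF F, of 0])
    show "(\<exists>z. norm z < 1 \<and> z \<noteq> 0 \<and> norm ((p' \<circ> q) z) = norm z) \<or> norm (deriv (p' \<circ> q) 0) = 1"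
      using Fe[of "1/2"] by (intro disjI1 exI[of _ "1/2"]) auto
  qed (use qp p'b in \<open>auto simp: q0 p0 p'_def\<close>)
  then obtain \<alpha> where al: "\<And>w. norm w < 1 \<Longrightarrow> p' (q w) = \<alpha> * w" "norm \<alpha> = 1" by auto
  have p'p: "p' z = \<alpha> * p z" if "z \<in> D" for z using al(1)[of "p z"] pq[OF that] by simp
  \<comment> \<open>Multiplying by \<open>\<beta>\<close> works because
    \<open>cnj \<beta> * \<alpha> = cnj \<beta> * \<beta>^2 = \<beta>\<close>.\<close>
  define \<beta> where "\<beta> = csqrt \<alpha>"
  have b2: "\<beta>\<^sup>2 = \<alpha>" by (simp add: \<beta>_def)
  have bn: "norm \<beta> = 1" using al(2) by (simp add: \<beta>_def)
  then have bb: "cnj \<beta> * \<beta> = 1" "\<beta> \<noteq> 0"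
    using complex_norm_square[of \<beta>] by (auto simp: mult.commute)
  have cb2: "cnj \<beta> * \<alpha> = \<beta>" using bb by (simp add: b2[symmetric] power2_eq_square mult.assoc[symmetric])
  show ?thesis
  proof (rule that[of "\<lambda>z. \<beta> * p z" "\<lambda>w. q (w / \<beta>)"])
    show "(\<lambda>z. \<beta> * p z) holomorphic_on D" by (intro holomorphic_intros p)
    have "(q \<circ> (\<lambda>w. w / \<beta>)) holomorphic_on ball 0 1"
      by (rule holomorphic_on_compose_gen[OF _ q])
         (use bb bn in \<open>auto intro!: holomorphic_intros simp: norm_divide\<close>)
    then show "(\<lambda>w. q (w / \<beta>)) holomorphic_on ball 0 1" by (simp add: o_def)
    show "\<beta> * p z \<in> ball 0 1 \<and> q (\<beta> * p z / \<beta>) = z" if "z \<in> D" for z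
      using pq[OF that] bb bn by (simp add: norm_mult)
    show "q (w / \<beta>) \<in> D \<and> \<beta> * p (q (w / \<beta>)) = w" if "w \<in> ball 0 1" for w
      using qp[of "w / \<beta>"] that bb bn by (simp add: norm_divide)
    show "\<beta> * p 0 = 0" by (simp add: p0)
    fix z assume z: "z \<in> D"
    have "p' z = cnj (p (cnj z))" by (simp add: p'_def)
    then have "p (cnj z) = cnj (\<alpha> * p z)" using p'p[OF z] by (metis complex_cnj_cnj)
    then have "\<beta> * p (cnj z) = cnj (cnj \<beta> * \<alpha> * p z)" by (simp add: mult_ac)
    then show "\<beta> * p (cnj z) = cnj (\<beta> * p z)" by (simp only: cb2)
  qed
qed

text \<open>Three successive divided differences at 0 remain holomorphic, since the singularity is
  removable; the last one is bounded on a small closed disc and supplies \<open>C\<close>.\<close>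

lemma holomorphic_quadratic_approx:
  assumes f: "f holomorphic_on D" and D: "open D" "0 \<in> D"
  obtains c1 c2 C r where "r > 0" "ball 0 r \<subseteq> D" "C \<ge> 0"
    "\<And>z. z \<in> ball 0 r \<Longrightarrow> norm (f z - (f 0 + c1 * z + c2 * z\<^sup>2)) \<le> C * norm z ^ 3"
proof -
  define S where "S = (\<lambda>(f::complex\<Rightarrow>complex) z. if z = 0 then deriv f 0 else (f z - f 0) / (z - 0))"
  have S: "S f holomorphic_on D" if "f holomorphic_on D" for f
    unfolding S_def by (rule pole_lemma_open[OF that D(1)])
  have Se: "f z = f 0 + z * S f z" for f z by (simp add: S_def)
  define h where "h = S (S (S f))"
  have h: "h holomorphic_on D" unfolding h_def by (intro S f)
  obtain r where r: "r > 0" "cball 0 r \<subseteq> D" using D open_contains_cball by blast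
  have "compact (h ` cball 0 r)"
    by (intro compact_continuous_image holomorphic_on_imp_continuous_on holomorphic_on_subset[OF h] r) auto
  then obtain C where C: "\<And>z. z \<in> cball 0 r \<Longrightarrow> norm (h z) \<le> C"
    using compact_imp_bounded by (force simp: bounded_iff)
  have C0: "C \<ge> 0" using C[of 0] r by (meson centre_in_cball less_imp_le norm_ge_zero order_trans)
  have exp: "f z = f 0 + S f 0 * z + S (S f) 0 * z\<^sup>2 + h z * z ^ 3" for z
    using Se[of f z] Se[of "S f" z] Se[of "S (S f)" z]
    by (simp add: h_def power2_eq_square power3_eq_cube algebra_simps)
  show ?thesis
  proof (rule that[OF r(1) _ C0, of "S f 0" "S (S f) 0"])
    show "ball 0 r \<subseteq> D" using r by auto
    fix z :: complex assume z: "z \<in> ball 0 r"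
    have "f z - (f 0 + S f 0 * z + S (S f) 0 * z\<^sup>2) = h z * z ^ 3" using exp[of z] by simp
    then show "norm (f z - (f 0 + S f 0 * z + S (S f) 0 * z\<^sup>2)) \<le> C * norm z ^ 3"
      using C[of z] z by (simp add: norm_mult norm_power mult_right_mono)
  qed
qed

text \<open>Serves to show that the Taylor coefficients of a function real on the real axis are
  real: it is applied to their imaginary parts.\<close>

lemma quadratic_approx_zero:
  fixes a b C r :: real
  assumes r: "r > 0" and le: "\<And>x. 0 < x \<Longrightarrow> x < r \<Longrightarrow> \<bar>a * x + b * x\<^sup>2\<bar> \<le> C * x ^ 3"
  shows "a = 0" "b = 0"
proof -
  have ev: "\<forall>\<^sub>F x in at_right 0. 0 < x \<and> x < r"
    using r by (auto simp: eventually_at_right_field)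
  have "((\<lambda>x. a + b * x) \<longlongrightarrow> 0) (at_right 0)"
  proof (rule Lim_null_comparison)
    show "\<forall>\<^sub>F x in at_right 0. norm (a + b * x) \<le> C * x\<^sup>2"
      using ev
    proof eventually_elim
      case (elim x)
      have "x * \<bar>a + b * x\<bar> = \<bar>x * (a + b * x)\<bar>" using elim by (simp add: abs_mult)
      also have "\<dots> = \<bar>a * x + b * x\<^sup>2\<bar>" by (simp add: power2_eq_square algebra_simps)
      also have "\<dots> \<le> x * (C * x\<^sup>2)" using le[of x] elim by (simp add: power3_eq_cube power2_eq_square mult_ac)
      finally show ?case using elim by simp
    qed
    show "((\<lambda>x. C * x\<^sup>2) \<longlongrightarrow> 0) (at_right 0)" by (auto intro!: tendsto_eq_intros)
  qed
  moreover have "((\<lambda>x. a + b * x) \<longlongrightarrow> a) (at_right 0)" by (auto intro!: tendsto_eq_intros)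
  ultimately show a: "a = 0" using tendsto_unique trivial_limit_at_right_real by blast
  have "((\<lambda>x::real. b) \<longlongrightarrow> 0) (at_right 0)"
  proof (rule Lim_null_comparison)
    show "\<forall>\<^sub>F x in at_right 0. norm b \<le> C * x"
      using ev
    proof eventually_elim
      case (elim x)
      have "x\<^sup>2 * \<bar>b\<bar> \<le> x\<^sup>2 * (C * x)" using le[of x] elim a
        by (simp add: power3_eq_cube power2_eq_square mult_ac abs_mult)
      then show ?case using elim by simp
    qed
    show "((\<lambda>x. C * x) \<longlongrightarrow> 0) (at_right 0)" by (auto intro!: tendsto_eq_intros)
  qed
  then show "b = 0" using tendsto_unique[OF trivial_limit_at_right_real tendsto_const] by metis
qed

lemma Joukowski_inj:
  fixes w v :: complex
  assumes "w + 1 / w = v + 1 / v" "norm w < 1" "norm v < 1" "w \<noteq> 0" "v \<noteq> 0"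
  shows "w = v"
proof -
  have "(w - v) * (w * v - 1) = 0" using assms(1,4,5) by (simp add: field_simps)
  moreover have "norm (w * v) < 1" using assms norm_mult_less[of w 1 v 1] by simp
  then have "w * v - 1 \<noteq> 0" by auto
  ultimately show ?thesis by simp
qed

text \<open>The roots \<open>u\<close>, \<open>v\<close> of \<open>w^2 - t w + 1\<close> have
  product 1, so one lies in the open disc unless both lie on the circle; then
  \<open>v = cnj u\<close> and \<open>t\<close> would be real.\<close>

lemma Joukowski_surj:
  fixes t :: complex
  assumes t: "Im t \<noteq> 0"
  obtains w where "w \<noteq> 0" "norm w < 1" "w + 1 / w = t"
proof -
  define u where "u = (t + csqrt (t\<^sup>2 - 4)) / 2"
  define v where "v = (t - csqrt (t\<^sup>2 - 4)) / 2"
  have uv: "u * v = 1"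
    by (simp add: u_def v_def field_simps) (simp add: algebra_simps power2_eq_square[symmetric])
  have s: "u + v = t" by (simp add: u_def v_def field_simps)
  have nz: "u \<noteq> 0" "v \<noteq> 0" using uv by auto
  have iv: "1 / u = v" "1 / v = u" using uv nz by (auto simp: field_simps)
  have nn: "norm u * norm v = 1" using uv by (metis norm_mult norm_one)
  have "norm u \<noteq> 1"
  proof
    assume "norm u = 1"
    then have "v = cnj u" using iv(1) complex_div_cnj[of 1 u] by simp
    then have "Im t = 0" using s by auto
    then show False using t by simp
  qed
  consider "norm u < 1" | "norm v < 1"
  proof (cases "norm u < 1")
    case False
    then have "norm u > 1" using \<open>norm u \<noteq> 1\<close> by simp
    moreover have "norm v = 1 / norm u" using nn nz by (simp add: field_simps)
    ultimately have "norm v < 1" by (simp add: divide_less_eq_1)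
    then show ?thesis using that by blast
  qed (use that in auto)
  then show ?thesis
    by cases (use that nz iv s in \<open>auto simp: add.commute\<close>)
qed

section \<open>Existence of the mapping-out function\<close>

lemma connected_cnj_image: "connected S \<Longrightarrow> connected (cnj ` S)"
  by (intro connected_continuous_image continuous_intros)

text \<open>The domain \<open>\<H> - A\<close> is doubled across the real axis outside \<open>[-1, 1]\<close>, and \<open>\<infinity>\<close> is moved to
  the point \<open>0\<close> by \<open>z \<mapsto> 1 / (z - 1)\<close>; the Riemann map \<open>\<phi>\<close> of the resulting simply connected domain is
  symmetric, so \<open>\<phi> + 1 / \<phi>\<close> is real exactly on the real axis.\<close>

lemma rooted_hull_mapping_out:
  assumes A: "rooted_hull A"
  obtains g b where "is_mapping_out A g b"
    "\<And>p \<epsilon>. p \<notin> \<H> - A \<Longrightarrow> \<epsilon> > 0 \<Longrightarrow> \<forall>\<^sub>F z in at p within \<H> - A. Im (g z) < \<epsilon>"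
proof -
  define K0 where "K0 = insert 0 A"
  \<comment> \<open>The segment provides an endpoint 1 off \<open>K0\<close> that can be sent to
    infinity: removing it leaves \<open>K\<close> connected, whereas 0 may be a cut point. It also
    keeps \<open>K\<close> from being a single point when \<open>A\<close> is empty.\<close>
  define I where "I = closed_segment (-1::complex) 1"
  define K where "K = K0 \<union> cnj ` K0 \<union> I"
  \<comment> \<open>The value \<open>s = 0\<close> stands for infinity and is added by hand:
    division by zero yields 0, so \<open>1 + 1 / s\<close> would be the point 1 of
    \<open>K\<close>.\<close>
  define D where "D = {s. s = 0 \<or> 1 + 1 / s \<notin> K}"
  have AH: "A \<subseteq> \<H>" and cK0: "compact K0" and conK0: "connected K0" and conHA: "connected (\<H> - A)"
    using A by (auto simp: rooted_hull_def K0_def)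
  have I_iff: "z \<in> I \<longleftrightarrow> Im z = 0 \<and> \<bar>Re z\<bar> \<le> 1" for z
  proof -
    have "I = closed_segment (of_real (-1)) (of_real 1)" by (simp add: I_def)
    also have "\<dots> = of_real ` {-1..1}" by (simp only: closed_segment_of_real) (simp add: closed_segment_eq_real_ivl)
    finally show ?thesis by (auto simp: complex_eq_iff image_iff intro!: bexI[of _ "Re z"])
  qed
  have cnjK: "cnj z \<in> K \<longleftrightarrow> z \<in> K" for z
  proof -
    have "cnj z \<in> K" if "z \<in> K" for z using that by (auto simp: K_def I_iff image_iff)
    then show ?thesis by (metis complex_cnj_cnj)
  qed
  have cK: "compact K"
    unfolding K_def I_def using cK0
    by (intro compact_Un compact_continuous_image continuous_intros) auto
  have HK: "z \<in> K \<longleftrightarrow> z \<in> A" if "z \<in> \<H>" for z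
    using that AH by (auto simp: K_def K0_def I_iff upper_half_plane_def)
  have oneK: "1 \<in> K" by (simp add: K_def I_iff)
  have oneK0: "1 \<notin> K0" using AH by (auto simp: K0_def upper_half_plane_def)
  have con: "connected (- K)"
  proof -
    \<comment> \<open>The upper domain with the two real rays attached lies between
      \<open>\<H> - A\<close> and its closure, so it is connected; it meets its mirror image in the
      rays.\<close>
    define T where "T = (\<H> - A) \<union> {z. Im z = 0 \<and> \<bar>Re z\<bar> > 1}"
    have "{z. Im z = 0 \<and> \<bar>Re z\<bar> > 1} \<subseteq> closure (\<H> - A)"
    proof
      fix z :: complex assume z: "z \<in> {z. Im z = 0 \<and> \<bar>Re z\<bar> > 1}"
      then have "z \<notin> K0" using AH by (auto simp: K0_def upper_half_plane_def)
      then obtain r where r: "r > 0" "ball z r \<inter> K0 = {}"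
        using cK0 compact_imp_closed by (metis ComplI closed_def disjoint_eq_subset_Compl open_contains_ball)
      show "z \<in> closure (\<H> - A)"
      proof (subst closure_approachable, intro allI impI)
        fix e :: real assume e: "e > 0"
        define y where "y = z + \<i> * of_real (min e r / 2)"
        have d: "dist y z = min e r / 2" using e r by (simp add: y_def dist_norm norm_mult)
        have dd: "dist y z < r" "dist y z < e"
          using d e r(1) min.cobounded1[of e r] min.cobounded2[of e r] by linarith+
        then have "y \<in> ball z r" by (simp add: dist_commute)
        then have "y \<notin> A" using r by (auto simp: K0_def)
        moreover have "y \<in> \<H>" using z e r by (auto simp: y_def upper_half_plane_def)
        ultimately show "\<exists>y\<in>\<H> - A. dist y z < e" using dd by (intro bexI[of _ y]) auto
      qed
    qed
    then have "connected T"
      using closure_subset[of "\<H> - A"] unfolding T_def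
      by (intro connected_intermediate_closure[OF conHA]) auto
    moreover have "- K = T \<union> cnj ` T"
    proof -
      have "z \<in> - K \<longleftrightarrow> z \<in> T \<or> cnj z \<in> T" for z
      proof -
        consider "Im z > 0" | "Im z < 0" | "Im z = 0" by linarith
        then show ?thesis
        proof cases
          case 1 then show ?thesis using HK[of z] by (auto simp: T_def upper_half_plane_def)
        next
          case 2 then show ?thesis using HK[of "cnj z"] cnjK by (auto simp: T_def upper_half_plane_def)
        next
          case 3
          then have "z \<in> K \<longleftrightarrow> \<bar>Re z\<bar> \<le> 1"
            using AH by (auto simp: K_def K0_def I_iff upper_half_plane_def complex_eq_iff)
          then show ?thesis using 3 by (auto simp: T_def upper_half_plane_def)
        qed
      qed
      moreover have "z \<in> cnj ` T \<longleftrightarrow> cnj z \<in> T" for z by (metis complex_cnj_cnj image_iff)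
      ultimately show ?thesis by blast
    qed
    moreover have "2 \<in> T \<inter> cnj ` T" by (auto simp: T_def image_iff intro!: bexI[of _ 2])
    ultimately show ?thesis using connected_cnj_image[of T] connected_Un by fastforce
  qed
  obtain M where M: "\<And>z. z \<in> K \<Longrightarrow> norm z \<le> M" "M > 0"
    using compact_imp_bounded[OF cK] bounded_pos by blast
  define \<rho> where "\<rho> = 1 / (M + 2)"
  have rho: "\<rho> > 0" using M by (simp add: \<rho>_def)
  have ballD: "ball 0 \<rho> \<subseteq> D"
  proof
    fix s :: complex assume s: "s \<in> ball 0 \<rho>"
    show "s \<in> D"
    proof (cases "s = 0")
      case False
      have "norm s < \<rho>" using s by simp
      then have "M + 2 < 1 / norm s" using False M by (simp add: \<rho>_def field_simps)
      then have "norm (1 + 1 / s) > M"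
        using norm_diff_ineq[of "1 / s" 1] by (simp add: norm_divide add.commute)
      then show ?thesis using M(1)[of "1 + 1/s"] by (auto simp: D_def)
    qed (simp add: D_def)
  qed
  have inv_im: "D - {0} = (\<lambda>z. 1 / (z - 1)) ` (- K)"
  proof (intro equalityI subsetI)
    fix s assume "s \<in> D - {0}"
    then show "s \<in> (\<lambda>z. 1 / (z - 1)) ` (- K)"
      by (intro image_eqI[of _ _ "1 + 1 / s"]) (auto simp: D_def)
  qed (use oneK in \<open>auto simp: D_def\<close>)
  have openD: "open D"
  proof -
    have "open ((- {0}) \<inter> (\<lambda>s. 1 + 1 / s) -` (- K))"
      by (rule continuous_open_preimage) (auto intro!: continuous_intros simp: cK compact_imp_closed)
    moreover have "D = ball 0 \<rho> \<union> ((- {0}) \<inter> (\<lambda>s. 1 + 1 / s) -` (- K))"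
      using ballD rho by (auto simp: D_def)
    ultimately show ?thesis by (metis open_Un open_ball)
  qed
  have conD: "connected D"
  proof -
    have "connected (D - {0})"
      unfolding inv_im by (intro connected_continuous_image con continuous_intros) (use oneK in auto)
    moreover have "D = (D - {0}) \<union> ball 0 \<rho>" using ballD rho by auto
    moreover have "of_real (\<rho>/2) \<in> (D - {0}) \<inter> ball 0 \<rho>" using ballD rho by auto
    ultimately show ?thesis using connected_Un[of "D - {0}" "ball 0 \<rho>"] by (metis connected_ball empty_iff)
  qed
  have Dc: "- D = (\<lambda>z. 1 / (z - 1)) ` (K - {1})"
  proof (intro equalityI subsetI)
    fix s assume "s \<in> - D"
    then show "s \<in> (\<lambda>z. 1 / (z - 1)) ` (K - {1})"
      by (intro image_eqI[of _ _ "1 + 1 / s"]) (auto simp: D_def)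
  qed (auto simp: D_def)
  have "connected (K - {1})"
  proof -
    have one': "1 \<notin> cnj ` K0" using oneK0 by (metis complex_cnj_one complex_cnj_cnj image_iff)
    have iff: "z \<in> of_real ` {-1..<1} \<longleftrightarrow> Im z = 0 \<and> -1 \<le> Re z \<and> Re z < 1" for z
      by (auto simp: complex_eq_iff image_iff intro!: bexI[of _ "Re z"])
    have "z \<in> K - {1} \<longleftrightarrow> z \<in> (K0 \<union> cnj ` K0) \<union> of_real ` {-1..<1}" for z
    proof (cases "z = 1")
      case True
      then show ?thesis using oneK0 one' iff[of 1] by simp
    next
      case False
      then have "\<not> (Re z = 1 \<and> Im z = 0)" by (simp add: complex_eq_iff)
      then show ?thesis using False by (auto simp: K_def I_iff iff)
    qed
    then have "K - {1} = (K0 \<union> cnj ` K0) \<union> of_real ` {-1..<1}" by blast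
    moreover have "connected (complex_of_real ` {-1..<1})"
      by (intro connected_continuous_image continuous_intros) auto
    moreover have "0 \<in> complex_of_real ` {-1..<1}" by (auto simp: image_iff intro!: bexI[of _ 0])
    moreover have "0 \<in> K0" "0 \<in> cnj ` K0" by (auto simp: K0_def image_iff)
    ultimately show ?thesis
      using conK0 connected_cnj_image[OF conK0] by (auto intro!: connected_Un)
  qed
  then have conDc: "connected (- D)"
    unfolding Dc by (intro connected_continuous_image continuous_intros) auto
  have "\<not> bounded (- D)"
  proof
    assume "bounded (- D)"
    then obtain B where B: "\<And>s. s \<in> - D \<Longrightarrow> norm s \<le> B" by (auto simp: bounded_iff)
    \<comment> \<open>The point \<open>1 - x\<close> of \<open>K\<close> is sent to a point of
      modulus \<open>1 / x = \<bar>B\<bar> + 1\<close>, beyond the supposed bound.\<close>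
    define x where "x = 1 / (\<bar>B\<bar> + 1)"
    have x: "0 < x" "x \<le> 1" by (auto simp: x_def)
    have "complex_of_real (1 - x) \<in> K - {1}" using x by (auto simp: K_def I_iff)
    then have "1 / (complex_of_real (1 - x) - 1) \<in> - D" unfolding Dc by blast
    then have "norm (1 / (complex_of_real (1 - x) - 1)) \<le> B" by (rule B)
    moreover have "norm (1 / (complex_of_real (1 - x) - 1)) = \<bar>B\<bar> + 1"
    proof -
      have "norm (1 / (complex_of_real (1 - x) - 1)) = 1 / x" using x by (simp add: norm_divide)
      then show ?thesis by (simp add: x_def)
    qed
    ultimately show False by linarith
  qed
  then have "\<forall>C\<in>components (- D). \<not> bounded C"
    using conDc by (metis bounded_empty components_eq_sing_iff singletonD)
  then have scD: "simply_connected D"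
    using conD openD simply_connected_eq_unbounded_complement_components by blast
  have D0: "0 \<in> D" by (simp add: D_def)
  have DU: "D \<noteq> UNIV" using \<open>\<not> bounded (- D)\<close> by auto
  have cnjD: "cnj s \<in> D" if "s \<in> D" for s
  proof -
    have "1 + 1 / cnj s = cnj (1 + 1 / s)" by simp
    then show ?thesis using that cnjK unfolding D_def by (metis (mono_tags, lifting) complex_cnj_zero_iff mem_Collect_eq)
  qed
  obtain \<phi> \<psi> where phi: "\<phi> holomorphic_on D" and psi: "\<psi> holomorphic_on ball 0 1"
    and phiD: "\<And>z. z \<in> D \<Longrightarrow> \<phi> z \<in> ball 0 1 \<and> \<psi> (\<phi> z) = z"
    and psiD: "\<And>w. w \<in> ball 0 1 \<Longrightarrow> \<psi> w \<in> D \<and> \<phi> (\<psi> w) = w"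
    and phi0: "\<phi> 0 = 0" and phic: "\<And>z. z \<in> D \<Longrightarrow> \<phi> (cnj z) = cnj (\<phi> z)"
    using symmetric_Riemann_map[OF openD scD D0 DU cnjD] by metis
  have psi0: "\<psi> 0 = 0" using phiD[OF D0] phi0 by simp
  have phinz: "\<phi> s \<noteq> 0" if "s \<in> D" "s \<noteq> 0" for s using phiD[OF that(1)] that(2) psi0 by auto
  have injphi: "inj_on \<phi> D" using phiD by (metis inj_onI)
  define \<kappa> where "\<kappa> = deriv \<phi> 0"
  have knz: "\<kappa> \<noteq> 0" unfolding \<kappa>_def by (rule holomorphic_injective_imp_regular[OF phi openD injphi D0])
  have kreal: "Im \<kappa> = 0"
  proof -
    have "(\<phi> has_field_derivative \<kappa>) (at 0)"
      unfolding \<kappa>_def using phi openD D0 holomorphic_derivI by blast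
    then have "((\<lambda>h. \<phi> h / h) \<longlongrightarrow> \<kappa>) (at 0)" by (simp add: DERIV_def phi0)
    moreover have "filterlim complex_of_real (at 0) (at_right 0)"
      unfolding filterlim_at
      by (auto intro!: tendsto_eq_intros simp: eventually_at_filter)
    ultimately have "((\<lambda>x. \<phi> (of_real x) / of_real x) \<longlongrightarrow> \<kappa>) (at_right 0)"
      by (rule filterlim_compose)
    then have "((\<lambda>x. Im (\<phi> (of_real x) / of_real x)) \<longlongrightarrow> Im \<kappa>) (at_right 0)" by (rule tendsto_Im)
    moreover have "\<forall>\<^sub>F x in at_right 0. Im (\<phi> (of_real x) / of_real x) = 0"
    proof -
      have "\<forall>\<^sub>F x in at_right 0. 0 < x \<and> x < \<rho>"
        using rho by (auto simp: eventually_at_right_field)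
      then show ?thesis
      proof eventually_elim
        case (elim x)
        then have "complex_of_real x \<in> D" using ballD by auto
        then have "\<phi> (of_real x) = cnj (\<phi> (of_real x))" using phic by (metis complex_cnj_complex_of_real)
        then have "Im (\<phi> (of_real x)) = 0" by (metis cnj.simps(2) neg_equal_zero)
        then show ?case by (simp add: Im_divide_of_real)
      qed
    qed
    ultimately have "((\<lambda>x::real. 0) \<longlongrightarrow> Im \<kappa>) (at_right 0)" using Lim_transform_eventually by fastforce
    then show ?thesis using tendsto_unique[OF trivial_limit_at_right_real tendsto_const] by metis
  qed
  define q where "q = (\<lambda>s. if s = 0 then deriv \<phi> 0 else (\<phi> s - \<phi> 0) / (s - 0))"
  have q: "q holomorphic_on D" unfolding q_def by (rule pole_lemma_open[OF phi openD])
  have qnz: "q s \<noteq> 0" if "s \<in> D" for s using that knz phinz by (auto simp: q_def \<kappa>_def phi0)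
  \<comment> \<open>For nonzero \<open>s\<close> this is
    \<open>s * \<kappa> * (\<phi> s + 1 / \<phi> s)\<close>; the divided difference \<open>q\<close>
    removes the singularity at 0, and the factor \<open>\<kappa>\<close> normalises the value there
    to 1.\<close>
  define Q where "Q = (\<lambda>s. \<kappa> / q s + \<kappa> * s * \<phi> s)"
  have Q: "Q holomorphic_on D" unfolding Q_def by (intro holomorphic_intros q phi qnz)
  have Q0: "Q 0 = 1" using knz by (simp add: Q_def q_def \<kappa>_def)
  have Qs: "Q s = s * \<kappa> * (\<phi> s + 1 / \<phi> s)" if "s \<noteq> 0" "s \<in> D" for s
    using that phinz[OF that(2,1)] by (simp add: Q_def q_def phi0 field_simps)
  have kc: "cnj \<kappa> = \<kappa>" using kreal by (simp add: complex_eq_iff)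
  have Qc: "Q (cnj s) = cnj (Q s)" if "s \<in> D" for s
  proof (cases "s = 0")
    case False
    then show ?thesis using Qs[of s] Qs[of "cnj s"] cnjD[OF that] phic[OF that] kc that by simp
  qed (simp add: Q0)
  obtain c1 c2 C r where r: "r > 0" "ball 0 r \<subseteq> D" "C \<ge> 0"
    and est: "\<And>z. z \<in> ball 0 r \<Longrightarrow> norm (Q z - (Q 0 + c1 * z + c2 * z\<^sup>2)) \<le> C * norm z ^ 3"
    using holomorphic_quadratic_approx[OF Q openD D0] by metis
  have creal: "Im c1 = 0" "Im c2 = 0"
  proof -
    have "\<bar>Im c1 * x + Im c2 * x\<^sup>2\<bar> \<le> C * x ^ 3" if "0 < x" "x < r" for x
    proof -
      have xD: "complex_of_real x \<in> D" and xb: "complex_of_real x \<in> ball 0 r" using that r by auto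
      have "Q (of_real x) = cnj (Q (of_real x))" using Qc[OF xD] by simp
      then have "Im (Q (of_real x)) = 0" by (metis cnj.simps(2) neg_equal_zero)
      then have "Im (Q (of_real x) - (Q 0 + c1 * of_real x + c2 * (of_real x)\<^sup>2)) = - (Im c1 * x + Im c2 * x\<^sup>2)"
        by (simp add: Q0 power2_eq_square)
      then have "\<bar>Im c1 * x + Im c2 * x\<^sup>2\<bar> \<le> norm (Q (of_real x) - (Q 0 + c1 * of_real x + c2 * (of_real x)\<^sup>2))"
        by (metis abs_Im_le_cmod abs_minus_cancel)
      also have "\<dots> \<le> C * x ^ 3" using est[OF xb] that by simp
      finally show ?thesis .
    qed
    then show "Im c1 = 0" "Im c2 = 0" using quadratic_approx_zero[OF r(1)] by blast+
  qed
  \<comment> \<open>As \<open>1 / s = z - 1\<close>, the expansion of \<open>Q s / s\<close> is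
    \<open>z - 1 + c1 + c2 * s + O(s^2)\<close>. The summand \<open>1 - c1\<close> cancels its
    constant term, and \<open>c2\<close> becomes the capacity.\<close>
  define g where "g = (\<lambda>z. \<kappa> * (\<phi> (1 / (z - 1)) + 1 / \<phi> (1 / (z - 1))) + (1 - c1))"
  define b where "b = Re c2"
  have c2b: "c2 = of_real b" using creal by (simp add: b_def complex_eq_iff)
  have sD: "1 / (z - 1) \<in> D" "1 / (z - 1) \<noteq> 0" if "z \<notin> K" for z
    using that oneK by (auto simp: D_def)
  have gc: "g (cnj z) = cnj (g z)" if "z \<notin> K" for z
  proof -
    have "1 / (cnj z - 1) = cnj (1 / (z - 1))" by simp
    moreover have "cnj c1 = c1" using creal by (simp add: complex_eq_iff)
    ultimately show ?thesis using phic[OF sD(1)[OF that]] kc by (simp add: g_def)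
  qed
  have ginj: "z = z'" if "g z = g z'" "z \<notin> K" "z' \<notin> K" for z z'
  proof -
    define s s' where "s = 1 / (z - 1)" and "s' = 1 / (z' - 1)"
    have s: "s \<in> D" "s \<noteq> 0" "s' \<in> D" "s' \<noteq> 0" using sD that by (auto simp: s_def s'_def)
    have "\<phi> s + 1 / \<phi> s = \<phi> s' + 1 / \<phi> s'" using that(1) knz by (simp add: g_def s_def s'_def)
    then have "\<phi> s = \<phi> s'" by (rule Joukowski_inj) (use phiD[OF s(1)] phiD[OF s(3)] phinz s in auto)
    then have "s = s'" using injphi s by (auto dest: inj_onD)
    then show ?thesis by (simp add: s_def s'_def divide_cancel_left)
  qed
  \<comment> \<open>Because \<open>\<kappa>\<close> and \<open>c1\<close> are real, undoing the
    affine normalisation keeps \<open>w\<close> off the real axis, where the Joukowski map has a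
    preimage in the disc.\<close>
  have gsurj: "\<exists>z. z \<notin> K \<and> g z = w" if "Im w \<noteq> 0" for w
  proof -
    define t where "t = (w - (1 - c1)) / \<kappa>"
    have "\<kappa> = of_real (Re \<kappa>)" using kreal by (simp add: complex_eq_iff)
    then have "t = (w - (1 - c1)) / of_real (Re \<kappa>)" by (simp add: t_def)
    then have "Im t = Im w / Re \<kappa>" using creal by (simp add: Im_divide_of_real)
    then have "Im t \<noteq> 0" using that knz kreal by (auto simp: complex_eq_iff)
    then obtain u where u: "u \<noteq> 0" "norm u < 1" "u + 1 / u = t" using Joukowski_surj by blast
    define s where "s = \<psi> u"
    have s: "s \<in> D" "\<phi> s = u" using psiD[of u] u by (auto simp: s_def)
    then have snz: "s \<noteq> 0" using u phi0 by auto
    then have "1 + 1 / s \<notin> K" using s by (auto simp: D_def)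
    moreover have "g (1 + 1 / s) = w" using u s snz knz by (simp add: g_def t_def)
    ultimately show ?thesis by blast
  qed
  have gap: "\<forall>z. z \<notin> K \<and> norm z > max 2 (2 / r) \<longrightarrow> norm (g z - z - of_real b / z) \<le> (2 * \<bar>b\<bar> + 4 * C) / (norm z)\<^sup>2"
  proof (intro allI impI, elim conjE)
    fix z assume z: "z \<notin> K" "norm z > max 2 (2 / r)"
    define s where "s = 1 / (z - 1)"
    have s: "s \<in> D" "s \<noteq> 0" using sD z by (auto simp: s_def)
    have zz: "z = 1 / s + 1" using s by (simp add: s_def)
    have z1: "norm (z - 1) \<ge> norm z / 2"
      using norm_triangle_ineq2[of z 1] z by simp
    have znz: "norm z > 0" using z by auto
    have sn: "norm s \<le> 2 / norm z"
      using frac_le[of 1 1 "norm z / 2" "norm (z - 1)"] z1 znz by (simp add: s_def norm_divide)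
    have "2 / norm z < r" using z r znz by (simp add: field_simps)
    then have sb: "s \<in> ball 0 r" using sn by simp
    have "g z = Q s / s + (1 - c1)" using Qs[OF s(2,1)] s by (simp add: g_def s_def)
    then have "g z - z - of_real b * s = Q s / s + (1 - c1) - (1 / s + 1) - of_real b * s"
      by (simp only: zz[symmetric])
    also have "\<dots> = (Q s - (Q 0 + c1 * s + c2 * s\<^sup>2)) / s"
      using s by (simp add: Q0 c2b field_simps power2_eq_square)
    finally have "g z - z - of_real b * s = (Q s - (Q 0 + c1 * s + c2 * s\<^sup>2)) / s" .
    then have "norm (g z - z - of_real b * s) = norm (Q s - (Q 0 + c1 * s + c2 * s\<^sup>2)) / norm s"
      by (simp add: norm_divide)
    also have "\<dots> \<le> C * norm s ^ 3 / norm s" by (intro divide_right_mono est sb) simp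
    also have "\<dots> = C * (norm s)\<^sup>2" using s by (simp add: power3_eq_cube power2_eq_square)
    also have "\<dots> \<le> C * (2 / norm z)\<^sup>2" using r sn by (intro mult_left_mono power_mono) auto
    finally have e1: "norm (g z - z - of_real b * s) \<le> 4 * C / (norm z)\<^sup>2"
      by (simp add: power_divide mult.commute)
    \<comment> \<open>The expansion is in powers of \<open>1 / (z - 1)\<close>; passing from
      \<open>b * s\<close> to \<open>b / z\<close> costs only
      \<open>O(1 / \<bar>z\<bar>^2)\<close>.\<close>
    have "z - 1 \<noteq> 0" "z \<noteq> 0" using z oneK znz by auto
    then have "of_real b * s - of_real b / z = of_real b * s / z" by (simp add: s_def field_simps)
    then have "norm (of_real b * s - of_real b / z) = \<bar>b\<bar> * norm s / norm z" by (simp add: norm_divide norm_mult)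
    also have "\<dots> \<le> \<bar>b\<bar> * (2 / norm z) / norm z" by (intro divide_right_mono mult_left_mono sn) auto
    finally have e2: "norm (of_real b * s - of_real b / z) \<le> 2 * \<bar>b\<bar> / (norm z)\<^sup>2"
      by (simp add: power2_eq_square mult.commute)
    have "norm (g z - z - of_real b / z) \<le> norm (g z - z - of_real b * s) + norm (of_real b * s - of_real b / z)"
      using norm_triangle_ineq[of "g z - z - of_real b * s" "of_real b * s - of_real b / z"]
      by (simp only: diff_add_cancel add_diff_eq)
    also have "\<dots> \<le> (2 * \<bar>b\<bar> + 4 * C) / (norm z)\<^sup>2" using e1 e2 by (simp add: add_divide_distrib)
    finally show "norm (g z - z - of_real b / z) \<le> (2 * \<bar>b\<bar> + 4 * C) / (norm z)\<^sup>2" .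
  qed
  have notK: "z \<notin> K" if "z \<in> \<H> - A" for z using HK that by auto
  have ghol: "g holomorphic_on \<H> - A"
  proof -
    have "(\<phi> \<circ> (\<lambda>z. 1 / (z - 1))) holomorphic_on \<H> - A"
      by (rule holomorphic_on_compose_gen[OF _ phi])
         (use sD notK in \<open>auto intro!: holomorphic_intros\<close>)
    then show ?thesis
      unfolding g_def o_def by (intro holomorphic_intros) (use sD notK phinz in auto)
  qed
  \<comment> \<open>A real value would be shared by \<open>z\<close> and \<open>cnj z\<close>,
    against injectivity of \<open>g\<close> on the doubled domain.\<close>
  have gim: "Im (g z) \<noteq> 0" if "z \<in> \<H> - A" for z
  proof
    assume "Im (g z) = 0"
    then have "g (cnj z) = g z" using gc notK[OF that] by (simp add: complex_eq_iff)
    then have "cnj z = z" using ginj notK[OF that] cnjK by blast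
    then show False using that by (auto simp: upper_half_plane_def complex_eq_iff)
  qed
  \<comment> \<open>\<open>Im g\<close> has no zero on the connected set \<open>\<H> - A\<close>, so
    its sign is constant; it is positive high up on the imaginary axis by the expansion.\<close>
  have gpos: "Im (g z) > 0" if "z \<in> \<H> - A" for z
  proof (rule ccontr)
    assume "\<not> Im (g z) > 0"
    then have "Im (g z) < 0" using gim that by force
    obtain z0 where z0: "z0 \<in> \<H> - A" "Im (g z0) > 0"
    proof -
      have "filterlim (\<lambda>y. y - (\<bar>b\<bar> / y + (2 * \<bar>b\<bar> + 4 * C) / y\<^sup>2)) at_top at_top" by real_asymp
      then have "\<forall>\<^sub>F y in at_top. 0 < y - (\<bar>b\<bar> / y + (2 * \<bar>b\<bar> + 4 * C) / y\<^sup>2)"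
        unfolding filterlim_at_top_dense by blast
      then have "\<forall>\<^sub>F y in at_top. 0 < y - (\<bar>b\<bar> / y + (2 * \<bar>b\<bar> + 4 * C) / y\<^sup>2) \<and> y > max M (max 2 (2 / r))"
        using eventually_gt_at_top[of "max M (max 2 (2 / r))"] by (rule eventually_conj)
      then obtain y where y: "0 < y - (\<bar>b\<bar> / y + (2 * \<bar>b\<bar> + 4 * C) / y\<^sup>2)" "y > max M (max 2 (2 / r))"
        using eventually_happens'[OF trivial_limit_at_top_linorder] by blast
      define z0 where "z0 = \<i> * complex_of_real y"
      have n: "norm z0 = y" using y by (simp add: z0_def norm_mult)
      have nK: "z0 \<notin> K" using M(1)[of z0] y n by auto
      have H: "z0 \<in> \<H>" using y by (simp add: z0_def upper_half_plane_def)
      have "norm (g z0 - z0 - of_real b / z0) \<le> (2 * \<bar>b\<bar> + 4 * C) / y\<^sup>2"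
        using gap[rule_format, of z0] nK n y(2) by simp
      then have "\<bar>Im (g z0 - z0 - of_real b / z0)\<bar> \<le> (2 * \<bar>b\<bar> + 4 * C) / y\<^sup>2"
        using abs_Im_le_cmod order_trans by blast
      moreover have "Im (g z0 - z0 - of_real b / z0) = Im (g z0) - y + b / y"
        using y by (simp add: z0_def Im_divide power2_eq_square)
      moreover have "b / y \<le> \<bar>b\<bar> / y" using y by (intro divide_right_mono) auto
      ultimately have "Im (g z0) > 0" using y(1) by linarith
      then show ?thesis using that H nK HK by blast
    qed
    have "connected ((\<lambda>z. Im (g z)) ` (\<H> - A))"
      by (intro connected_continuous_image conHA continuous_intros holomorphic_on_imp_continuous_on ghol)
    then have "0 \<in> (\<lambda>z. Im (g z)) ` (\<H> - A)"
      using z0 \<open>Im (g z) < 0\<close> that by (auto intro: connectedD_interval[of _ "Im (g z)" "Im (g z0)"])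
    then show False using gim by auto
  qed
  have gim2: "g ` (\<H> - A) = \<H>"
  proof (intro equalityI subsetI)
    fix w assume w: "w \<in> \<H>"
    then obtain z where z: "z \<notin> K" "g z = w" using gsurj[of w] by (auto simp: upper_half_plane_def)
    consider "Im z > 0" | "Im z < 0" | "Im z = 0" by linarith
    then show "w \<in> g ` (\<H> - A)"
    proof cases
      case 1
      then show ?thesis using z HK[of z] by (auto simp: upper_half_plane_def)
    next
      case 2
      then have "cnj z \<in> \<H> - A" using z HK[of "cnj z"] cnjK by (auto simp: upper_half_plane_def)
      then have "Im (g (cnj z)) > 0" by (rule gpos)
      then show ?thesis using gc[OF z(1)] z(2) w by (simp add: upper_half_plane_def)
    next
      case 3
      then have "cnj z = z" by (simp add: complex_eq_iff)
      then have "Im (g z) = 0" using gc[OF z(1)] by (metis cnj.simps(2) neg_equal_zero)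
      then show ?thesis using z(2) w by (simp add: upper_half_plane_def)
    qed
  qed (use gpos in \<open>auto simp: upper_half_plane_def\<close>)
  have ginj2: "inj_on g (\<H> - A)" using ginj notK by (meson inj_onI)
  have mo: "is_mapping_out A g b"
    unfolding is_mapping_out_def using ghol ginj2 gim2 gap notK by blast
  \<comment> \<open>For bounded \<open>z\<close> the point \<open>s\<close> stays away from 0, hence
    so does \<open>\<phi> s\<close> by continuity of \<open>\<psi>\<close> at 0, and
    \<open>1 / \<phi> s\<close> is bounded.\<close>
  have gbd: "\<exists>N. \<forall>z\<in>\<H> - A. norm z \<le> R \<longrightarrow> norm (g z) \<le> N" for R
  proof -
    have "isCont \<psi> 0" using psi by (metis centre_in_ball continuous_on_eq_continuous_at holomorphic_on_imp_continuous_on open_ball zero_less_one)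
    moreover have "1 / (\<bar>R\<bar> + 2) > 0" by simp
    ultimately obtain m where m: "m > 0" "\<And>w. norm w < m \<Longrightarrow> norm (\<psi> w) < 1 / (\<bar>R\<bar> + 2)"
      unfolding continuous_at_eps_delta using psi0 by (metis dist_0_norm dist_commute)
    show ?thesis
    proof (intro exI[of _ "norm \<kappa> * (1 + 1 / m) + norm (1 - c1)"] ballI impI)
      fix z assume z: "z \<in> \<H> - A" "norm z \<le> R"
      define s where "s = 1 / (z - 1)"
      have s: "s \<in> D" "s \<noteq> 0" using sD notK z by (auto simp: s_def)
      have "norm (z - 1) \<le> \<bar>R\<bar> + 2" using norm_triangle_ineq4[of z 1] z by simp
      moreover have "norm (z - 1) > 0" using s by (auto simp: s_def)
      ultimately have "norm s \<ge> 1 / (\<bar>R\<bar> + 2)" by (simp add: s_def norm_divide frac_le)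
      then have pm: "norm (\<phi> s) \<ge> m" using m(2)[of "\<phi> s"] phiD[OF s(1)] by force
      have "norm (g z) \<le> norm (\<kappa> * (\<phi> s + 1 / \<phi> s)) + norm (1 - c1)"
        unfolding g_def s_def by (rule norm_triangle_ineq)
      also have "norm (\<kappa> * (\<phi> s + 1 / \<phi> s)) = norm \<kappa> * norm (\<phi> s + 1 / \<phi> s)" by (rule norm_mult)
      also have "norm (\<phi> s + 1 / \<phi> s) \<le> norm (\<phi> s) + 1 / norm (\<phi> s)"
        using norm_triangle_ineq[of "\<phi> s" "1 / \<phi> s"] by (simp add: norm_divide)
      also have "\<dots> \<le> 1 + 1 / m"
        using phiD[OF s(1)] pm m(1) frac_le[of 1 1 m "norm (\<phi> s)"] by (intro add_mono) auto
      finally show "norm (g z) \<le> norm \<kappa> * (1 + 1 / m) + norm (1 - c1)"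
        by (simp add: mult_left_mono)
    qed
  qed
  obtain k where k: "k holomorphic_on \<H>" "\<And>z. z \<in> \<H> - A \<Longrightarrow> k (g z) = z"
    using holomorphic_has_inverse[OF ghol rooted_hull_open[OF A] ginj2] gim2 by metis
  have "\<forall>\<^sub>F z in at p within \<H> - A. Im (g z) < \<epsilon>" if p: "p \<notin> \<H> - A" and e: "\<epsilon> > 0" for p \<epsilon>
  proof -
    obtain N where N: "\<forall>z\<in>\<H> - A. norm z \<le> norm p + 1 \<longrightarrow> norm (g z) \<le> N" using gbd by blast
    \<comment> \<open>Points near \<open>p\<close> with \<open>Im g \<ge> \<epsilon>\<close> would
      lie in the image of this compact set under the inverse \<open>k\<close>, a compact subset of
      \<open>\<H> - A\<close> that misses \<open>p\<close>.\<close>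
    define L where "L = cball 0 N \<inter> {w. Im w \<ge> \<epsilon>}"
    have LH: "L \<subseteq> \<H>" using e by (auto simp: L_def upper_half_plane_def)
    have "compact L" unfolding L_def by (intro compact_Int_closed compact_cball closed_halfspace_Im_ge)
    then have "compact (k ` L)"
      by (intro compact_continuous_image continuous_on_subset[OF holomorphic_on_imp_continuous_on[OF k(1)] LH])
    then have "open (- k ` L)" by (simp add: compact_imp_closed open_Compl)
    moreover have "p \<notin> k ` L"
    proof
      assume "p \<in> k ` L"
      then obtain w where "w \<in> \<H>" "p = k w" using LH by blast
      then obtain z where "z \<in> \<H> - A" "p = k (g z)" using gim2 by (metis imageE)
      then show False using p k(2) by metis
    qed
    ultimately have "\<forall>\<^sub>F z in nhds p. z \<in> - k ` L" by (intro eventually_nhds_in_open) auto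
    moreover have "\<forall>\<^sub>F z in nhds p. z \<in> ball p 1" by (rule eventually_nhds_in_open) auto
    ultimately have "\<forall>\<^sub>F z in nhds p. z \<in> \<H> - A \<longrightarrow> Im (g z) < \<epsilon>"
    proof eventually_elim
      case (elim z)
      show ?case
      proof (rule impI, rule ccontr)
        assume z: "z \<in> \<H> - A" and "\<not> Im (g z) < \<epsilon>"
        moreover have "norm z \<le> norm p + 1"
          using elim(2) norm_triangle_ineq2[of z p] by (simp add: dist_norm norm_minus_commute)
        ultimately have "g z \<in> L" using N by (simp add: L_def)
        then have "z \<in> k ` L" using k(2)[OF z] by (metis image_eqI)
        then show False using elim(1) by simp
      qed
    qed
    then show ?thesis by (simp add: eventually_at_filter eventually_mono)
  qed
  with mo that show ?thesis by blast
qed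

section \<open>Capacity of graph slits\<close>

text \<open>The form of the comparison used for capacities: \<open>small\<close> is asked of every
  mapping-out function because a suitable one is chosen inside the proof.\<close>

lemma hcap_le_add:
  assumes A: "rooted_hull A" and B: "rooted_hull B"
    and small: "\<And>g a z. is_mapping_out A g a \<Longrightarrow> z \<in> B - A \<Longrightarrow> Im (g z) \<le> \<delta>"
    and R: "R > 0" "B \<subseteq> cball 0 R" and d: "\<delta> \<ge> 0"
  shows "hcap B \<le> hcap A + 4 * R * \<delta>"
proof -
  obtain gA a where gA: "is_mapping_out A gA a"
    "\<And>p \<epsilon>. p \<notin> \<H> - A \<Longrightarrow> \<epsilon> > 0 \<Longrightarrow> \<forall>\<^sub>F z in at p within \<H> - A. Im (gA z) < \<epsilon>"
    using rooted_hull_mapping_out[OF A] by metis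
  obtain gB b where gB: "is_mapping_out B gB b"
    using rooted_hull_mapping_out[OF B] by metis
  have BH: "B \<subseteq> \<H> \<inter> cball 0 R" using B R by (auto simp: rooted_hull_def)
  have "b \<le> a + 4 * R * \<delta>"
    by (rule is_mapping_out_le_add[OF gA(1) gB rooted_hull_bounded[OF A] rooted_hull_bounded[OF B]
          rooted_hull_open[OF A] rooted_hull_open[OF B] gA(2) small[OF gA(1)] R(1) BH d])
  then show ?thesis using rooted_hull_hcap[OF A gA(1)] rooted_hull_hcap[OF B gB] by simp
qed

lemma hcap_mono:
  assumes A: "rooted_hull A" and B: "rooted_hull B" and AB: "A \<subseteq> B"
  shows "hcap A \<le> hcap B"
proof -
  obtain gA a gB b where "is_mapping_out A gA a" "is_mapping_out B gB b"
    using rooted_hull_mapping_out A B by metis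
  then show ?thesis
    using is_mapping_out_mono rooted_hull_bounded rooted_hull_open rooted_hull_hcap A B AB by metis
qed

lemma hcap_strict_mono:
  assumes A: "rooted_hull A" and B: "rooted_hull B" and AB: "A \<subset> B"
  shows "hcap A < hcap B"
proof -
  obtain gA a gB b where "is_mapping_out A gA a" "is_mapping_out B gB b"
    using rooted_hull_mapping_out A B by metis
  moreover have "B \<subseteq> \<H>" using B by (simp add: rooted_hull_def)
  ultimately show ?thesis
    using is_mapping_out_strict_mono[OF _ _ rooted_hull_bounded[OF A] rooted_hull_bounded[OF B] rooted_hull_open[OF B] AB]
      rooted_hull_hcap A B by metis
qed

section \<open>The empty hull, and capacity under scaling and reflection\<close>

lemma rooted_hull_empty: "rooted_hull {}"
  by (simp add: rooted_hull_def convex_connected convex_upper_half_plane)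

lemma hcap_empty: "hcap {} = 0"
  by (rule rooted_hull_hcap[OF rooted_hull_empty is_mapping_out_empty])

text \<open>Conjugating \<open>g\<close> by the dilation gives \<open>r g (z / r)\<close>, whose
  term \<open>r * b / (z / r)\<close> is \<open>r^2 * b / z\<close>.\<close>

lemma hcap_scale:
  fixes r :: real
  assumes A: "rooted_hull A" and r: "r > 0"
  defines "m \<equiv> (\<lambda>z. of_real r * z)"
  assumes mA: "rooted_hull (m ` A)"
  shows "hcap (m ` A) = r\<^sup>2 * hcap A"
proof -
  obtain g b where g: "is_mapping_out A g b" using rooted_hull_mapping_out[OF A] by metis
  define d where "d = (\<lambda>z. z / complex_of_real r)"
  have md: "m (d z) = z" "d (m z) = z" for z using r by (auto simp: m_def d_def)
  have dH: "d z \<in> \<H> \<longleftrightarrow> z \<in> \<H>" "m z \<in> \<H> \<longleftrightarrow> z \<in> \<H>" for z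
    using r by (auto simp: m_def d_def upper_half_plane_def Im_divide_of_real zero_less_divide_iff zero_less_mult_iff)
  have dA: "d z \<in> \<H> - A \<longleftrightarrow> z \<in> \<H> - m ` A" for z
    using dH md by (metis DiffE DiffI image_iff)
  have hol: "g holomorphic_on \<H> - A" and inj: "inj_on g (\<H> - A)" and im: "g ` (\<H> - A) = \<H>"
    using g by (auto simp: is_mapping_out_def)
  obtain C R where CR: "\<forall>z \<in> \<H> - A. norm z > R \<longrightarrow> norm (g z - z - of_real b / z) \<le> C / (norm z)^2"
    using g by (auto simp: is_mapping_out_def)
  have "is_mapping_out (m ` A) (\<lambda>z. m (g (d z))) (r\<^sup>2 * b)"
    unfolding is_mapping_out_def
  proof (intro conjI)
    have "(g \<circ> d) holomorphic_on \<H> - m ` A"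
      by (rule holomorphic_on_compose_gen[OF _ hol])
         (use dA r in \<open>auto simp: d_def intro!: holomorphic_intros\<close>)
    then show "(\<lambda>z. m (g (d z))) holomorphic_on \<H> - m ` A"
      unfolding m_def o_def by (intro holomorphic_intros)
    show "inj_on (\<lambda>z. m (g (d z))) (\<H> - m ` A)"
      using inj dA md unfolding inj_on_def by metis
    show "(\<lambda>z. m (g (d z))) ` (\<H> - m ` A) = \<H>"
    proof (intro equalityI subsetI)
      fix w assume "w \<in> \<H>"
      then obtain z where z: "z \<in> \<H> - A" "g z = d w" using im dH by (metis imageE)
      then show "w \<in> (\<lambda>z. m (g (d z))) ` (\<H> - m ` A)"
      proof (intro image_eqI[of _ _ "m z"])
        show "w = m (g (d (m z)))" by (simp only: md z)
        show "m z \<in> \<H> - m ` A" using dA[of "m z"] z(1) by (simp only: md)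
      qed
    next
      fix w assume "w \<in> (\<lambda>z. m (g (d z))) ` (\<H> - m ` A)"
      then obtain z where "z \<in> \<H> - m ` A" "w = m (g (d z))" by blast
      moreover then have "g (d z) \<in> \<H>" using dA[of z] im by blast
      ultimately show "w \<in> \<H>" by (simp only: dH)
    qed
    show "\<exists>C R. \<forall>z\<in>\<H> - m ` A. R < norm z \<longrightarrow>
        norm (m (g (d z)) - z - complex_of_real (r\<^sup>2 * b) / z) \<le> C / (norm z)\<^sup>2"
    proof (rule exI[of _ "C * r ^ 3"], rule exI[of _ "R * r"], intro ballI impI)
      fix z assume z: "z \<in> \<H> - m ` A" "R * r < norm z"
      then have "z \<noteq> 0" by (auto simp: upper_half_plane_def)
      have nd: "norm (d z) = norm z / r" using r by (simp add: d_def norm_divide)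
      have "m (g (d z)) - z - of_real (r\<^sup>2 * b) / z = of_real r * (g (d z) - d z - of_real b / d z)"
        using r \<open>z \<noteq> 0\<close> by (simp add: m_def d_def field_simps power2_eq_square)
      then have "norm (m (g (d z)) - z - of_real (r\<^sup>2 * b) / z) = r * norm (g (d z) - d z - of_real b / d z)"
        using r by (simp add: norm_mult)
      also have "\<dots> \<le> r * (C / (norm (d z))\<^sup>2)"
        using CR[rule_format, of "d z"] dA z r nd by (intro mult_left_mono) (auto simp: pos_less_divide_eq)
      also have "\<dots> = C * r ^ 3 / (norm z)\<^sup>2"
        using r by (simp add: nd power_divide power2_eq_square power3_eq_cube)
      finally show "norm (m (g (d z)) - z - of_real (r\<^sup>2 * b) / z) \<le> C * r ^ 3 / (norm z)\<^sup>2" .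
    qed
  qed
  then show ?thesis using rooted_hull_hcap[OF mA] rooted_hull_hcap[OF A g] by simp
qed

text \<open>Conjugation by the antiholomorphic reflection is holomorphic again and keeps the term
  \<open>b / z\<close> because \<open>b\<close> is real.\<close>

lemma hcap_reflect:
  assumes A: "rooted_hull A"
  defines "m \<equiv> (\<lambda>z. - cnj z)"
  assumes mA: "rooted_hull (m ` A)"
  shows "hcap (m ` A) = hcap A"
proof -
  obtain g b where g: "is_mapping_out A g b" using rooted_hull_mapping_out[OF A] by metis
  have mm: "m (m z) = z" for z by (auto simp: m_def)
  have mH: "m z \<in> \<H> \<longleftrightarrow> z \<in> \<H>" for z by (auto simp: m_def upper_half_plane_def)
  have dA: "m z \<in> \<H> - A \<longleftrightarrow> z \<in> \<H> - m ` A" for z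
    using mH mm by (metis DiffE DiffI image_iff)
  have hol: "g holomorphic_on \<H> - A" and inj: "inj_on g (\<H> - A)" and im: "g ` (\<H> - A) = \<H>"
    using g by (auto simp: is_mapping_out_def)
  obtain C R where CR: "\<forall>z \<in> \<H> - A. norm z > R \<longrightarrow> norm (g z - z - of_real b / z) \<le> C / (norm z)^2"
    using g by (auto simp: is_mapping_out_def)
  have "is_mapping_out (m ` A) (\<lambda>z. m (g (m z))) b"
    unfolding is_mapping_out_def
  proof (intro conjI)
    have "(g \<circ> uminus) holomorphic_on cnj ` (\<H> - m ` A)"
      by (rule holomorphic_on_compose_gen[OF _ hol])
         (use dA in \<open>auto simp: m_def intro!: holomorphic_intros\<close>)
    then have "(cnj \<circ> (g \<circ> uminus) \<circ> cnj) holomorphic_on \<H> - m ` A"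
      by (rule holomorphic_on_compose_cnj_cnj[OF _ rooted_hull_open[OF mA]])
    then have "(\<lambda>z. - cnj (g (- cnj z))) holomorphic_on \<H> - m ` A"
      unfolding o_def by (rule holomorphic_on_minus)
    then show "(\<lambda>z. m (g (m z))) holomorphic_on \<H> - m ` A"
      unfolding m_def .
    show "inj_on (\<lambda>z. m (g (m z))) (\<H> - m ` A)"
      using inj dA mm unfolding inj_on_def by metis
    show "(\<lambda>z. m (g (m z))) ` (\<H> - m ` A) = \<H>"
    proof (intro equalityI subsetI)
      fix w assume "w \<in> \<H>"
      then obtain z where z: "z \<in> \<H> - A" "g z = m w" using im mH by (metis imageE)
      then show "w \<in> (\<lambda>z. m (g (m z))) ` (\<H> - m ` A)"
      proof (intro image_eqI[of _ _ "m z"])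
        show "w = m (g (m (m z)))" by (simp only: mm z)
        show "m z \<in> \<H> - m ` A" using dA[of "m z"] z(1) by (simp only: mm)
      qed
    next
      fix w assume "w \<in> (\<lambda>z. m (g (m z))) ` (\<H> - m ` A)"
      then obtain z where "z \<in> \<H> - m ` A" "w = m (g (m z))" by blast
      moreover then have "g (m z) \<in> \<H>" using dA[of z] im by blast
      ultimately show "w \<in> \<H>" by (simp only: mH)
    qed
    show "\<exists>C R. \<forall>z\<in>\<H> - m ` A. R < norm z \<longrightarrow>
        norm (m (g (m z)) - z - complex_of_real b / z) \<le> C / (norm z)\<^sup>2"
    proof (rule exI[of _ C], rule exI[of _ R], intro ballI impI)
      fix z assume z: "z \<in> \<H> - m ` A" "R < norm z"
      have nd: "norm (m z) = norm z" by (simp add: m_def)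
      have "m (g (m z)) - z - of_real b / z = m (g (m z) - m z - of_real b / m z)"
        by (simp add: m_def)
      moreover have "norm (m w) = norm w" for w by (simp add: m_def)
      ultimately have "norm (m (g (m z)) - z - of_real b / z) = norm (g (m z) - m z - of_real b / m z)"
        by simp
      then show "norm (m (g (m z)) - z - of_real b / z) \<le> C / (norm z)\<^sup>2"
        using CR dA z nd by metis
    qed
  qed
  then show ?thesis using rooted_hull_hcap[OF mA] rooted_hull_hcap[OF A g] by simp
qed

section \<open>Graph slits and the topology of their complements\<close>

definition graph_slit :: "(real \<Rightarrow> real) \<Rightarrow> real \<Rightarrow> complex set" where
  "graph_slit \<phi> h = (\<lambda>y. Complex (\<phi> y) y) ` {0<..h}"

text \<open>Everything above the tip is included, in the left side as well, so the two sides overlap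
  there and together fill the complement of the slit.\<close>

definition right_of_graph :: "(real \<Rightarrow> real) \<Rightarrow> real \<Rightarrow> complex set" where
  "right_of_graph \<phi> h = {z. Im z > h} \<union> {z. 0 < Im z \<and> Im z \<le> h \<and> \<phi> (Im z) < Re z}"

definition left_of_graph :: "(real \<Rightarrow> real) \<Rightarrow> real \<Rightarrow> complex set" where
  "left_of_graph \<phi> h = {z. Im z > h} \<union> {z. 0 < Im z \<and> Im z \<le> h \<and> Re z < \<phi> (Im z)}"

lemma mem_graph_slit: "z \<in> graph_slit \<phi> h \<longleftrightarrow> 0 < Im z \<and> Im z \<le> h \<and> Re z = \<phi> (Im z)"
  by (auto simp: graph_slit_def image_iff complex_eq_iff)

lemma graph_slit_mono: "h \<le> h' \<Longrightarrow> graph_slit \<phi> h \<subseteq> graph_slit \<phi> h'"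
  by (auto simp: mem_graph_slit)

lemma graph_slit_subset_upper_half_plane: "graph_slit \<phi> h \<subseteq> \<H>"
  by (auto simp: mem_graph_slit upper_half_plane_def)

text \<open>Each horizontal half-line \<open>R y\<close> reaches the quadrant \<open>V\<close> far
  to the right, and \<open>V\<close> meets the half-plane \<open>U\<close> above the tip.\<close>

lemma connected_right_of_graph:
  assumes "continuous_on {0..h} \<phi>" "h \<ge> 0"
  shows "connected (right_of_graph \<phi> h)"
proof -
  have "compact (\<phi> ` {0..h})" using assms by (intro compact_continuous_image) auto
  then obtain M where M: "\<And>y. y \<in> {0..h} \<Longrightarrow> \<bar>\<phi> y\<bar> \<le> M"
    using compact_imp_bounded by (force simp: bounded_iff)
  define U where "U = {z. Im z > h}"
  define V where "V = {z. Re z > M} \<inter> {z. Im z > 0}"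
  define R where "R = (\<lambda>y. {z. Im z \<le> y} \<inter> {z. Im z \<ge> y} \<inter> {z. Re z > \<phi> y})"
  have cU: "connected U" unfolding U_def by (intro convex_connected convex_halfspace_Im_gt)
  have cV: "connected V"
    unfolding V_def by (intro convex_connected convex_Int convex_halfspace_Im_gt convex_halfspace_Re_gt)
  have cR: "connected (R y)" for y
    unfolding R_def
    by (intro convex_connected convex_Int convex_halfspace_Re_gt convex_halfspace_Im_ge convex_halfspace_Im_le)
  have UV: "Complex (M + 1) (h + 1) \<in> U \<inter> V" using assms by (auto simp: U_def V_def)
  then have cUV: "connected (U \<union> V)" using connected_Un[OF cU cV] by blast
  have eq: "right_of_graph \<phi> h = \<Union> (insert (U \<union> V) ((\<lambda>y. U \<union> V \<union> R y) ` {0<..h}))"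
  proof (intro equalityI subsetI)
    fix z assume "z \<in> right_of_graph \<phi> h"
    then consider "Im z > h" | "0 < Im z" "Im z \<le> h" "\<phi> (Im z) < Re z" by (auto simp: right_of_graph_def)
    then show "z \<in> \<Union> (insert (U \<union> V) ((\<lambda>y. U \<union> V \<union> R y) ` {0<..h}))"
    proof cases
      case 2
      then have "z \<in> R (Im z)" "Im z \<in> {0<..h}" by (auto simp: R_def)
      then show ?thesis by blast
    qed (simp add: U_def)
  next
    fix z assume "z \<in> \<Union> (insert (U \<union> V) ((\<lambda>y. U \<union> V \<union> R y) ` {0<..h}))"
    then consider "z \<in> U" | "z \<in> V" | y where "z \<in> R y" "0 < y" "y \<le> h"
      by (auto split: if_splits)
    then show "z \<in> right_of_graph \<phi> h"
    proof cases
      case 2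
      then show ?thesis using M[of "Im z"] by (auto simp: V_def right_of_graph_def)
    qed (auto simp: U_def R_def right_of_graph_def)
  qed
  show ?thesis
    unfolding eq
  proof (rule connected_Union)
    fix S assume "S \<in> insert (U \<union> V) ((\<lambda>y. U \<union> V \<union> R y) ` {0<..h})"
    then consider "S = U \<union> V" | y where "S = U \<union> V \<union> R y" "0 < y" "y \<le> h" by auto
    then show "connected S"
    proof cases
      case (2 y)
      have "Complex (max M (\<phi> y) + 1) y \<in> (U \<union> V) \<inter> R y" using 2 by (auto simp: V_def R_def)
      then show ?thesis unfolding 2(1) using connected_Un[OF cUV cR[of y]] by blast
    qed (use cUV in simp)
  qed (use UV in blast)
qed

lemma left_of_graph_eq: "left_of_graph \<phi> h = (\<lambda>z. - cnj z) ` right_of_graph (\<lambda>y. - \<phi> y) h"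
proof (intro equalityI subsetI)
  fix z assume "z \<in> left_of_graph \<phi> h"
  then show "z \<in> (\<lambda>z. - cnj z) ` right_of_graph (\<lambda>y. - \<phi> y) h"
    by (intro image_eqI[of _ _ "- cnj z"]) (auto simp: left_of_graph_def right_of_graph_def)
qed (auto simp: left_of_graph_def right_of_graph_def)

lemma connected_left_of_graph:
  assumes "continuous_on {0..h} \<phi>" "h \<ge> 0"
  shows "connected (left_of_graph \<phi> h)"
  unfolding left_of_graph_eq
  by (intro connected_continuous_image connected_right_of_graph continuous_intros assms)

lemma compact_connected_insert_graph_slit:
  assumes "continuous_on {0..h} \<phi>" "\<phi> 0 = 0" "h \<ge> 0"
  shows "compact (insert 0 (graph_slit \<phi> h))" "connected (insert 0 (graph_slit \<phi> h))"
proof -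
  have "{0..h} = insert 0 {0<..h}" using assms by auto
  moreover have "Complex (\<phi> 0) 0 = 0" using assms by (simp add: complex_eq_iff)
  ultimately have eq: "insert 0 (graph_slit \<phi> h) = (\<lambda>y. Complex (\<phi> y) y) ` {0..h}"
    by (simp only: graph_slit_def image_insert)
  have c: "continuous_on {0..h} (\<lambda>y. Complex (\<phi> y) y)" by (intro continuous_intros assms)
  show "compact (insert 0 (graph_slit \<phi> h))" "connected (insert 0 (graph_slit \<phi> h))"
    unfolding eq using c by (auto intro!: compact_continuous_image connected_continuous_image)
qed

lemma rooted_hull_graph_slit:
  assumes "continuous_on {0..h} \<phi>" "\<phi> 0 = 0" "h \<ge> 0"
  shows "rooted_hull (graph_slit \<phi> h)"
  unfolding rooted_hull_def
proof (intro conjI compact_connected_insert_graph_slit assms graph_slit_subset_upper_half_plane)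
  have "\<H> - graph_slit \<phi> h = right_of_graph \<phi> h \<union> left_of_graph \<phi> h"
    using assms(3) by (auto simp: upper_half_plane_def mem_graph_slit right_of_graph_def left_of_graph_def)
  moreover have "Complex 0 (h + 1) \<in> right_of_graph \<phi> h \<inter> left_of_graph \<phi> h"
    by (auto simp: right_of_graph_def left_of_graph_def)
  ultimately show "connected (\<H> - graph_slit \<phi> h)"
    using connected_Un[OF connected_right_of_graph[OF assms(1,3)] connected_left_of_graph[OF assms(1,3)]] by auto
qed

definition symmetric_slits :: "(real \<Rightarrow> real) \<Rightarrow> real \<Rightarrow> complex set" where
  "symmetric_slits \<phi> h = graph_slit \<phi> h \<union> graph_slit (\<lambda>y. - \<phi> y) h"

text \<open>Besides the two outer sides there is the region \<open>Mid\<close> between the slits.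
  Positivity of \<open>\<phi>\<close> keeps the imaginary axis \<open>V\<close> inside it, and
  \<open>V\<close> links all horizontal segments to the half-plane above.\<close>

lemma rooted_hull_symmetric_slits:
  assumes c: "continuous_on {0..h} \<phi>" "\<phi> 0 = 0" "h \<ge> 0"
    and pos: "\<And>y. 0 < y \<Longrightarrow> y \<le> h \<Longrightarrow> \<phi> y > 0"
  shows "rooted_hull (symmetric_slits \<phi> h)"
  unfolding rooted_hull_def
proof (intro conjI)
  have c': "continuous_on {0..h} (\<lambda>y. - \<phi> y)" "- \<phi> 0 = 0" using c by (auto intro!: continuous_intros)
  show "symmetric_slits \<phi> h \<subseteq> \<H>"
    using graph_slit_subset_upper_half_plane by (auto simp: symmetric_slits_def)
  have eq: "insert 0 (symmetric_slits \<phi> h) = insert 0 (graph_slit \<phi> h) \<union> insert 0 (graph_slit (\<lambda>y. - \<phi> y) h)"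
    by (auto simp: symmetric_slits_def)
  show "compact (insert 0 (symmetric_slits \<phi> h))"
    unfolding eq using c c' by (intro compact_Un compact_connected_insert_graph_slit) auto
  show "connected (insert 0 (symmetric_slits \<phi> h))"
    unfolding eq using c c' by (intro connected_Un compact_connected_insert_graph_slit) auto
  define U where "U = {z. Im z > h}"
  define V where "V = (\<lambda>y. Complex 0 y) ` {0<..}"
  define R where "R = (\<lambda>y. (\<lambda>x. Complex x y) ` {-\<phi> y<..<\<phi> y})"
  have cU: "connected U" unfolding U_def by (intro convex_connected convex_halfspace_Im_gt)
  have cV: "connected V" unfolding V_def by (intro connected_continuous_image continuous_intros) auto
  have cR: "connected (R y)" for y unfolding R_def by (intro connected_continuous_image continuous_intros) auto
  have UV: "Complex 0 (h + 1) \<in> U \<inter> V" using c by (auto simp: U_def V_def)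
  then have cUV: "connected (U \<union> V)" using connected_Un[OF cU cV] by blast
  define Mid where "Mid = \<Union> (insert (U \<union> V) ((\<lambda>y. U \<union> V \<union> R y) ` {0<..h}))"
  have cMid: "connected Mid"
    unfolding Mid_def
  proof (rule connected_Union)
    fix S assume "S \<in> insert (U \<union> V) ((\<lambda>y. U \<union> V \<union> R y) ` {0<..h})"
    then consider "S = U \<union> V" | y where "S = U \<union> V \<union> R y" "0 < y" "y \<le> h" by auto
    then show "connected S"
    proof cases
      case (2 y)
      have "Complex 0 y \<in> (U \<union> V) \<inter> R y" using 2 pos by (auto simp: V_def R_def)
      then show ?thesis unfolding 2(1) using connected_Un[OF cUV cR[of y]] by blast
    qed (use cUV in simp)
  qed (use UV in blast)
  have Mid: "z \<in> Mid \<longleftrightarrow> Im z > h \<or> (0 < Im z \<and> Im z \<le> h \<and> \<bar>Re z\<bar> < \<phi> (Im z))" for z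
  proof -
    have V: "z \<in> V \<longleftrightarrow> Re z = 0 \<and> Im z > 0" by (auto simp: V_def image_iff complex_eq_iff)
    have R: "z \<in> R y \<longleftrightarrow> Im z = y \<and> \<bar>Re z\<bar> < \<phi> y" for y
      by (auto simp: R_def image_iff complex_eq_iff intro!: bexI[of _ "Re z"])
    show ?thesis
    proof (cases "Re z = 0")
      case True
      then show ?thesis using pos[of "Im z"] c(3) by (auto simp: Mid_def U_def V R)
    next
      case False
      then show ?thesis by (auto simp: Mid_def U_def V R)
    qed
  qed
  have "\<H> - symmetric_slits \<phi> h = (Mid \<union> right_of_graph \<phi> h) \<union> left_of_graph (\<lambda>y. - \<phi> y) h"
  proof (rule set_eqI)
    fix z
    show "z \<in> \<H> - symmetric_slits \<phi> h \<longleftrightarrow> z \<in> (Mid \<union> right_of_graph \<phi> h) \<union> left_of_graph (\<lambda>y. - \<phi> y) h"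
    proof (cases "0 < Im z \<and> Im z \<le> h")
      case True
      then show ?thesis using pos[of "Im z"]
        by (auto simp: upper_half_plane_def symmetric_slits_def mem_graph_slit Mid right_of_graph_def left_of_graph_def)
    next
      case False
      then show ?thesis using c(3)
        by (auto simp: upper_half_plane_def symmetric_slits_def mem_graph_slit Mid right_of_graph_def left_of_graph_def)
    qed
  qed
  moreover have "Complex 0 (h + 1) \<in> Mid" "Complex 0 (h + 1) \<in> right_of_graph \<phi> h"
    "Complex 0 (h + 1) \<in> left_of_graph (\<lambda>y. - \<phi> y) h"
    by (auto simp: right_of_graph_def left_of_graph_def Mid)
  ultimately show "connected (\<H> - symmetric_slits \<phi> h)"
    using connected_Un[OF connected_Un[OF cMid connected_right_of_graph[OF c(1,3)]] connected_left_of_graph[OF c'(1) c(3)]]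
    by auto
qed

section \<open>The Beurling-type estimate at the tip of a graph slit\<close>

lemma connected_avoiding:
  fixes f :: "'a::topological_space \<Rightarrow> real"
  assumes "connected S" "continuous_on S f" "x0 \<in> S" "f x0 \<in> {a<..<b}" "x \<in> S"
    and "\<And>x. x \<in> S \<Longrightarrow> f x \<noteq> a" "\<And>x. x \<in> S \<Longrightarrow> f x \<noteq> b"
  shows "f x \<in> {a<..<b}"
proof (rule ccontr)
  assume *: "f x \<notin> {a<..<b}"
  have c: "connected (f ` S)" using assms by (intro connected_continuous_image)
  have "a \<in> f ` S \<or> b \<in> f ` S"
    using * assms connectedD_interval[OF c, of "f x" "f x0" a] connectedD_interval[OF c, of "f x0" "f x" b]
    by (auto simp: not_less)
  then show False using assms by auto
qed

text \<open>Beurling-type estimate. On either side of the graph, the branch of \<open>log (-i (z - p))\<close> that is real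
  above the tip \<open>p\<close> has imaginary part in \<open>(-3\<pi>/2, 3\<pi>/2)\<close>, so that the fourth root has
  real part at least \<open>cos (3\<pi>/8)\<close> times its modulus.\<close>

lemma graph_slit_log_branch:
  assumes c: "continuous_on {0..h} \<phi>" "\<phi> 0 = 0" "h > 0"
  defines "p \<equiv> Complex (\<phi> h) h"
  obtains L where "L holomorphic_on \<H> - graph_slit \<phi> h"
    "\<And>z. z \<in> \<H> - graph_slit \<phi> h \<Longrightarrow> exp (L z) = - \<i> * (z - p)"
    "\<And>z. z \<in> \<H> - graph_slit \<phi> h \<Longrightarrow> \<bar>Im (L z)\<bar> < 3 * pi / 2"
proof -
  let ?S = "\<H> - graph_slit \<phi> h"
  have rh: "rooted_hull (graph_slit \<phi> h)" using rooted_hull_graph_slit c by simp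
  have pA: "p \<in> graph_slit \<phi> h" using c by (simp add: p_def mem_graph_slit)
  have nz: "- \<i> * (z - p) \<noteq> 0" if "z \<in> ?S" for z using that pA by auto
  obtain L0 where L0: "L0 holomorphic_on ?S" "\<And>z. z \<in> ?S \<Longrightarrow> - \<i> * (z - p) = exp (L0 z)"
  proof -
    have "(\<lambda>z. - \<i> * (z - p)) holomorphic_on ?S" by (intro holomorphic_intros)
    then show ?thesis
      using that rooted_hull_simply_connected[OF rh] nz
      unfolding simply_connected_eq_holomorphic_log[OF rooted_hull_open[OF rh]] by blast
  qed
  define z0 where "z0 = p + \<i>"
  have z0: "z0 \<in> ?S" using c by (auto simp: z0_def p_def upper_half_plane_def mem_graph_slit)
  \<comment> \<open>Normalised to vanish at \<open>z0 = p + i\<close>, so that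
    \<open>Im (L z)\<close> is the angle of \<open>z - p\<close> measured from the upward
    vertical.\<close>
  define L where "L = (\<lambda>z. L0 z - L0 z0)"
  have "exp (L0 z0) = 1" using L0(2)[OF z0] by (simp add: z0_def)
  then have Lexp: "exp (L z) = - \<i> * (z - p)" if "z \<in> ?S" for z
    using L0(2)[OF that] by (simp add: L_def exp_diff)
  have Lhol: "L holomorphic_on ?S" unfolding L_def by (intro holomorphic_intros L0)
  have Lz0: "L z0 = 0" by (simp add: L_def)
  have right: "right_of_graph \<phi> h \<subseteq> ?S" and left: "left_of_graph \<phi> h \<subseteq> ?S"
    using c by (auto simp: upper_half_plane_def mem_graph_slit right_of_graph_def left_of_graph_def)
  have cont: "continuous_on T (\<lambda>z. Im (L z))" if "T \<subseteq> ?S" for T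
    by (intro continuous_intros continuous_on_subset[OF holomorphic_on_imp_continuous_on[OF Lhol] that])
  have polar: "Re (z - p) = - exp (Re (L z)) * sin (Im (L z))" "Im (z - p) = exp (Re (L z)) * cos (Im (L z))"
    if "z \<in> ?S" for z
  proof -
    have "z - p = \<i> * exp (L z)" using Lexp[OF that] by simp
    then show "Re (z - p) = - exp (Re (L z)) * sin (Im (L z))" "Im (z - p) = exp (Re (L z)) * cos (Im (L z))"
      by (simp_all add: Re_exp Im_exp)
  qed
  have c32: "cos (3 * pi / 2) = 0" "sin (3 * pi / 2) = -1"
    using cos_periodic_pi[of "pi / 2"] sin_periodic_pi[of "pi / 2"] by (simp_all add: add_divide_distrib[symmetric] field_simps)
  have R: "Im (L z) \<in> {- (3 * pi / 2)<..<pi / 2}" if z: "z \<in> right_of_graph \<phi> h" for z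
  proof (rule connected_avoiding[where S = "right_of_graph \<phi> h" and ?x0.0 = z0, OF _ cont[OF right] _ _ z])
    show "connected (right_of_graph \<phi> h)" using connected_right_of_graph c by simp
    show "z0 \<in> right_of_graph \<phi> h" by (auto simp: z0_def p_def right_of_graph_def)
    show "Im (L z0) \<in> {- (3 * pi / 2)<..<pi / 2}" by (simp add: Lz0)
    \<comment> \<open>The right side omits the horizontal ray going left from the tip. On that ray
      the angle would be \<open>pi / 2\<close> or \<open>- (3 * pi / 2)\<close>, so neither value is
      ever crossed.\<close>
    have "\<not> (cos (Im (L x)) = 0 \<and> sin (Im (L x)) = 1)" if x: "x \<in> right_of_graph \<phi> h" for x
    proof
      assume cs: "cos (Im (L x)) = 0 \<and> sin (Im (L x)) = 1"
      have xS: "x \<in> ?S" using right x by blast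
      have "Im (x - p) = 0" "Re (x - p) < 0"
        using cs exp_gt_zero[of "Re (L x)"] by (simp_all only: polar[OF xS])
      then show False using x by (auto simp: p_def right_of_graph_def)
    qed
    then show "\<And>x. x \<in> right_of_graph \<phi> h \<Longrightarrow> Im (L x) \<noteq> - (3 * pi / 2)"
      "\<And>x. x \<in> right_of_graph \<phi> h \<Longrightarrow> Im (L x) \<noteq> pi / 2"
      using c32 by (metis cos_minus minus_minus sin_minus, metis cos_pi_half sin_pi_half)
  qed
  have L: "Im (L z) \<in> {- (pi / 2)<..<3 * pi / 2}" if z: "z \<in> left_of_graph \<phi> h" for z
  proof (rule connected_avoiding[where S = "left_of_graph \<phi> h" and ?x0.0 = z0, OF _ cont[OF left] _ _ z])
    show "connected (left_of_graph \<phi> h)" using connected_left_of_graph c by simp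
    show "z0 \<in> left_of_graph \<phi> h" by (auto simp: z0_def p_def left_of_graph_def)
    show "Im (L z0) \<in> {- (pi / 2)<..<3 * pi / 2}" by (simp add: Lz0)
    have "\<not> (cos (Im (L x)) = 0 \<and> sin (Im (L x)) = -1)" if x: "x \<in> left_of_graph \<phi> h" for x
    proof
      assume cs: "cos (Im (L x)) = 0 \<and> sin (Im (L x)) = -1"
      have xS: "x \<in> ?S" using left x by blast
      have "Im (x - p) = 0" "Re (x - p) > 0"
        using cs exp_gt_zero[of "Re (L x)"] by (simp_all only: polar[OF xS])
      then show False using x by (auto simp: p_def left_of_graph_def)
    qed
    then show "\<And>x. x \<in> left_of_graph \<phi> h \<Longrightarrow> Im (L x) \<noteq> - (pi / 2)"
      "\<And>x. x \<in> left_of_graph \<phi> h \<Longrightarrow> Im (L x) \<noteq> 3 * pi / 2"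
      using c32 by (metis cos_minus cos_pi_half sin_minus sin_pi_half, metis)
  qed
  have "\<bar>Im (L z)\<bar> < 3 * pi / 2" if "z \<in> ?S" for z
  proof -
    have "z \<in> right_of_graph \<phi> h \<or> z \<in> left_of_graph \<phi> h"
      using that by (auto simp: upper_half_plane_def mem_graph_slit right_of_graph_def left_of_graph_def)
    then show ?thesis
    proof
      assume "z \<in> right_of_graph \<phi> h"
      then have "- (3 * pi / 2) < Im (L z)" "Im (L z) < pi / 2" using R by auto
      then show ?thesis using pi_gt_zero by linarith
    next
      assume "z \<in> left_of_graph \<phi> h"
      then have "- (pi / 2) < Im (L z)" "Im (L z) < 3 * pi / 2" using L by auto
      then show ?thesis using pi_gt_zero by linarith
    qed
  qed
  then show ?thesis using that Lhol Lexp by blast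
qed

lemma cos_3pi8_pos: "cos (3 * pi / 8) > 0"
  by (rule cos_gt_zero_pi) (use pi_gt_zero in auto)

text \<open>In the unit disc about the tip, \<open>Im k\<close> is dominated by a multiple of the
  positive harmonic function \<open>Re (exp (L z / 4))\<close>: it vanishes at the slit and the real
  line, and is at most \<open>h + 1\<close> on the circle. The bound passes to every hull containing
  the slit since a larger hull has smaller \<open>Im g\<close>.\<close>

lemma graph_slit_Im_le_near_tip:
  assumes c: "continuous_on {0..h} \<phi>" "\<phi> 0 = 0" "h > 0"
    and A: "rooted_hull A" "graph_slit \<phi> h \<subseteq> A" and gA: "is_mapping_out A g a"
    and z: "z \<in> \<H> - A" and d: "dist z (Complex (\<phi> h) h) < 1"
  shows "Im (g z) \<le> (h + 1) / cos (3 * pi / 8) * dist z (Complex (\<phi> h) h) powr (1 / 4)"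
proof -
  let ?S = "\<H> - graph_slit \<phi> h"
  define p where "p = Complex (\<phi> h) h"
  have rh: "rooted_hull (graph_slit \<phi> h)" using rooted_hull_graph_slit c by simp
  obtain k b where k: "is_mapping_out (graph_slit \<phi> h) k b"
    and kbd: "\<And>p \<epsilon>. p \<notin> ?S \<Longrightarrow> \<epsilon> > 0 \<Longrightarrow> \<forall>\<^sub>F z in at p within ?S. Im (k z) < \<epsilon>"
    using rooted_hull_mapping_out[OF rh] by metis
  have khol: "k holomorphic_on ?S" using k by (simp add: is_mapping_out_def)
  obtain L where L: "L holomorphic_on ?S" "\<And>z. z \<in> ?S \<Longrightarrow> exp (L z) = - \<i> * (z - p)"
    "\<And>z. z \<in> ?S \<Longrightarrow> \<bar>Im (L z)\<bar> < 3 * pi / 2"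
    using graph_slit_log_branch[OF c] unfolding p_def by metis
  have pA: "p \<in> graph_slit \<phi> h" using c by (simp add: p_def mem_graph_slit)
  have nL: "norm (exp (L z / 4)) = norm (z - p) powr (1 / 4)" if "z \<in> ?S" for z
  proof -
    have "exp (Re (L z)) = norm (z - p)"
      using L(2)[OF that] by (metis norm_exp_eq_Re norm_mult norm_minus_cancel norm_ii mult_1)
    moreover have "norm (z - p) > 0" using that pA by auto
    ultimately have "Re (L z) = ln (norm (z - p))" by (metis ln_exp)
    then show ?thesis using \<open>norm (z - p) > 0\<close> by (simp add: powr_def)
  qed
  have reL: "Re (exp (L z / 4)) \<ge> norm (z - p) powr (1 / 4) * cos (3 * pi / 8)" if "z \<in> ?S" for z
  proof -
    have "cos (3 * pi / 8) \<le> cos \<bar>Im (L z) / 4\<bar>"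
      using L(3)[OF that] pi_gt_zero by (intro cos_monotone_0_pi_le) auto
    then have "cos (3 * pi / 8) \<le> cos (Im (L z) / 4)" by (simp only: cos_abs_real)
    then have "norm (exp (L z / 4)) * cos (3 * pi / 8) \<le> norm (exp (L z / 4)) * cos (Im (L z) / 4)"
      by (intro mult_left_mono) auto
    then show ?thesis unfolding nL[OF that, symmetric] by (simp add: Re_exp)
  qed
  \<comment> \<open>Chosen so that on the unit circle, where the fourth root has modulus 1, the
    comparison function is at least \<open>h + 1\<close>.\<close>
  define C where "C = (h + 1) / cos (3 * pi / 8)"
  have C: "C > 0" using c cos_3pi8_pos by (simp add: C_def)
  have reL0: "Re (exp (L z / 4)) \<ge> 0" if "z \<in> ?S" for z
    using reL[OF that] cos_3pi8_pos by (smt (verit) mult_nonneg_nonneg powr_ge_zero)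
  define \<Omega> where "\<Omega> = ?S \<inter> ball p 1"
  define f where "f = (\<lambda>z. - \<i> * k z - of_real C * exp (L z / 4))"
  have Ref: "Re (f z) = Im (k z) - C * Re (exp (L z / 4))" for z by (simp add: f_def)
  have fhol: "f holomorphic_on ?S" unfolding f_def by (intro holomorphic_intros khol L) auto
  have zS: "z \<in> ?S" using z A by auto
  have "Re (f z) \<le> 0"
  proof (rule Re_nonpos_maximum_principle[of \<Omega> f z])
    show "open \<Omega>" unfolding \<Omega>_def by (intro open_Int rooted_hull_open[OF rh] open_ball)
    show "f holomorphic_on \<Omega>" by (rule holomorphic_on_subset[OF fhol]) (auto simp: \<Omega>_def)
    show "z \<in> \<Omega>" using zS d by (simp add: \<Omega>_def p_def dist_commute)
  next
    fix w and \<epsilon> :: real assume w: "w \<notin> \<Omega>" and e: "\<epsilon> > 0"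
    have sub: "\<Omega> \<subseteq> ?S" by (auto simp: \<Omega>_def)
    consider "w \<notin> ?S" | "w \<in> ?S" "w \<notin> closure \<Omega>" | "w \<in> ?S" "w \<in> closure \<Omega>" by blast
    then show "\<forall>\<^sub>F z in at w within \<Omega>. Re (f z) < \<epsilon>"
    proof cases
      case 1
      then have "\<forall>\<^sub>F z in at w within \<Omega>. Im (k z) < \<epsilon>"
        using kbd[OF 1 e] filter_leD[OF at_le[OF sub]] by blast
      moreover have "\<forall>\<^sub>F z in at w within \<Omega>. z \<in> \<Omega>" by (simp add: eventually_at_filter)
      ultimately show ?thesis
      proof eventually_elim
        case (elim z)
        then show ?case using reL0[of z] sub C by (simp add: Ref subset_iff) (smt (verit) mult_nonneg_nonneg)
      qed
    next
      case 2
      then show ?thesis by (metis eventually_bot not_in_closure_trivial_limitI trivial_limit_def)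
    next
      \<comment> \<open>A boundary point of \<open>\<Omega>\<close> that is off the slit and inside
        the half-plane must lie on the unit circle.\<close>
      case 3
      have "\<Omega> \<subseteq> cball p 1" by (auto simp: \<Omega>_def)
      then have "w \<in> cball p 1" using 3 closure_minimal[of \<Omega> "cball p 1"] by auto
      then have w1: "norm (w - p) = 1" using w 3 by (auto simp: \<Omega>_def dist_norm norm_minus_commute)
      have "Im (k w) \<le> Im w"
        by (rule is_mapping_out_Im_le[OF k rooted_hull_bounded[OF rh] rooted_hull_open[OF rh] 3(1)])
      also have "Im w \<le> h + 1"
        using abs_Im_le_cmod[of "w - p"] w1 by (simp add: p_def)
      also have "h + 1 = C * (norm (w - p) powr (1 / 4) * cos (3 * pi / 8))"
        using w1 cos_3pi8_pos by (simp add: C_def)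
      also have "\<dots> \<le> C * Re (exp (L w / 4))"
        using reL[OF 3(1)] C by (intro mult_left_mono) auto
      finally have "Re (f w) < \<epsilon>" using e by (simp add: Ref)
      moreover have "isCont f w"
        using fhol rooted_hull_open[OF rh] 3(1) by (metis continuous_on_eq_continuous_at holomorphic_on_imp_continuous_on)
      then have "((\<lambda>z. Re (f z)) \<longlongrightarrow> Re (f w)) (at w within \<Omega>)"
        by (intro tendsto_Re) (use isCont_def tendsto_within_subset in blast)
      ultimately show ?thesis using order_tendstoD(2) by blast
    qed
  next
    fix \<epsilon> :: real
    show "\<exists>R. \<forall>z\<in>\<Omega>. norm z > R \<longrightarrow> Re (f z) < \<epsilon>"
    proof (intro exI[of _ "norm p + 1"] ballI impI)
      fix z assume "z \<in> \<Omega>" "norm p + 1 < norm z"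
      then show "Re (f z) < \<epsilon>"
        using norm_triangle_ineq2[of z p] by (simp add: \<Omega>_def dist_norm norm_minus_commute)
    qed
  qed
  then have "Im (k z) \<le> C * Re (exp (L z / 4))" by (simp add: Ref)
  also have "\<dots> \<le> C * norm (exp (L z / 4))"
    by (intro mult_left_mono complex_Re_le_cmod) (use C in auto)
  also have "\<dots> = C * norm (z - p) powr (1 / 4)" by (simp only: nL[OF zS])
  finally have "Im (k z) \<le> C * norm (z - p) powr (1 / 4)" .
  moreover have "Im (g z) \<le> Im (k z)"
    by (rule is_mapping_out_Im_mono[OF k gA rooted_hull_bounded[OF rh] rooted_hull_bounded[OF A(1)] rooted_hull_open[OF A(1)] A(2) z])
  ultimately show ?thesis by (simp add: C_def p_def dist_norm)
qed

section \<open>The oscillating slits\<close>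

text \<open>The constant of the tip estimate made uniform over heights
  \<open>h \<le> 1\<close>.\<close>

definition tip_const :: real where "tip_const = 2 / cos (3 * pi / 8)"

lemma tip_const_pos: "tip_const > 0"
  using cos_3pi8_pos by (simp add: tip_const_def)

text \<open>Any point of a graph, at height \<open>h\<close> say, is the tip of the part of the slit
  up to that height. The tip estimate thereby controls \<open>Im g\<close> near every point of the
  slit.\<close>

lemma Im_le_of_close_to_graph:
  assumes c: "continuous_on {0..h} \<phi>" "\<phi> 0 = 0" "0 < h" "h \<le> 1"
    and A: "rooted_hull A" "graph_slit \<phi> h \<subseteq> A" and gA: "is_mapping_out A g a"
    and z: "z \<in> \<H> - A" and d: "dist z (Complex (\<phi> h) h) \<le> \<eta>" "\<eta> < 1"
  shows "Im (g z) \<le> tip_const * \<eta> powr (1 / 4)"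
proof -
  have "Im (g z) \<le> (h + 1) / cos (3 * pi / 8) * dist z (Complex (\<phi> h) h) powr (1 / 4)"
    by (rule graph_slit_Im_le_near_tip[OF c(1-3) A gA z]) (use d in linarith)
  also have "\<dots> \<le> tip_const * \<eta> powr (1 / 4)"
    unfolding tip_const_def using c cos_3pi8_pos d
    by (intro mult_mono divide_right_mono powr_mono2) auto
  finally show ?thesis .
qed

section \<open>Continuity of capacity in the height and in the profile\<close>

lemma graph_slit_subset_cball:
  assumes "\<And>y. y \<in> {0..1} \<Longrightarrow> \<bar>\<phi> y\<bar> \<le> M" "t \<le> 1"
  shows "graph_slit \<phi> t \<subseteq> cball 0 (M + 1)"
proof
  fix z assume z: "z \<in> graph_slit \<phi> t"
  have "norm z \<le> \<bar>Re z\<bar> + \<bar>Im z\<bar>" by (rule cmod_le)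
  also have "\<dots> \<le> M + 1" using z assms(2) assms(1)[of "Im z"] by (auto simp: mem_graph_slit)
  finally show "z \<in> cball 0 (M + 1)" by simp
qed

lemma hcap_graph_slit_le_add:
  assumes c: "continuous_on {0..1} \<phi>" "\<phi> 0 = 0" and M: "\<And>y. y \<in> {0..1} \<Longrightarrow> \<bar>\<phi> y\<bar> \<le> M"
    and st: "0 < s" "s \<le> t" "t \<le> 1"
    and d: "\<And>u. u \<in> {s..t} \<Longrightarrow> dist (Complex (\<phi> u) u) (Complex (\<phi> s) s) \<le> \<eta>" "\<eta> < 1"
  shows "hcap (graph_slit \<phi> t) \<le> hcap (graph_slit \<phi> s) + 4 * (M + 1) * (tip_const * \<eta> powr (1 / 4))"
proof (rule hcap_le_add)
  have cs: "continuous_on {0..s} \<phi>" by (rule continuous_on_subset[OF c(1)]) (use st in auto)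
  have ct: "continuous_on {0..t} \<phi>" by (rule continuous_on_subset[OF c(1)]) (use st in auto)
  show rs: "rooted_hull (graph_slit \<phi> s)" and "rooted_hull (graph_slit \<phi> t)"
    using st c cs ct by (auto intro!: rooted_hull_graph_slit)
  show "0 < M + 1" using M[of 0] c by simp
  show "graph_slit \<phi> t \<subseteq> cball 0 (M + 1)" using M st by (intro graph_slit_subset_cball) auto
  show "0 \<le> tip_const * \<eta> powr (1 / 4)" using tip_const_pos by simp
  fix g a z assume g: "is_mapping_out (graph_slit \<phi> s) g a" and z: "z \<in> graph_slit \<phi> t - graph_slit \<phi> s"
  show "Im (g z) \<le> tip_const * \<eta> powr (1 / 4)"
  proof (rule Im_le_of_close_to_graph[OF cs c(2) st(1) _ rs subset_refl g])
    show "z \<in> \<H> - graph_slit \<phi> s" using z graph_slit_subset_upper_half_plane by blast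
    have "z = Complex (\<phi> (Im z)) (Im z)" "Im z \<in> {s..t}"
      using z by (auto simp: mem_graph_slit complex_eq_iff)
    then show "dist z (Complex (\<phi> s) s) \<le> \<eta>" using d(1) by metis
  qed (use st d in auto)
qed

lemma hcap_graph_slit_less:
  assumes c: "continuous_on {0..1} \<phi>" "\<phi> 0 = 0" and st: "0 \<le> s" "s < t" "t \<le> 1"
  shows "hcap (graph_slit \<phi> s) < hcap (graph_slit \<phi> t)"
proof (rule hcap_strict_mono)
  show "rooted_hull (graph_slit \<phi> s)" "rooted_hull (graph_slit \<phi> t)"
    using st c by (auto intro!: rooted_hull_graph_slit continuous_on_subset[OF c(1)])
  have "Complex (\<phi> t) t \<in> graph_slit \<phi> t - graph_slit \<phi> s" using st by (auto simp: mem_graph_slit)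
  then show "graph_slit \<phi> s \<subset> graph_slit \<phi> t" using graph_slit_mono[of s t \<phi>] st by auto
qed

lemma graph_slit_0: "graph_slit \<phi> 0 = {}"
  by (auto simp: mem_graph_slit)

text \<open>For \<open>s > 0\<close> the added piece stays close to the tip at height
  \<open>s\<close>. At \<open>s = 0\<close> there is no tip, and
  \<open>Im g \<le> Im z \<le> t\<close> is used instead.\<close>

lemma continuous_on_hcap_graph_slit:
  assumes c: "continuous_on {0..1} \<phi>" "\<phi> 0 = 0"
  shows "continuous_on {0..1} (\<lambda>h. hcap (graph_slit \<phi> h))"
proof -
  have "compact (\<phi> ` {0..1})" using c by (intro compact_continuous_image) auto
  then obtain M where M: "\<And>y. y \<in> {0..1} \<Longrightarrow> \<bar>\<phi> y\<bar> \<le> M"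
    using compact_imp_bounded by (force simp: bounded_iff)
  have M0: "M \<ge> 0" using M[of 0] c by simp
  have close: "\<exists>d>0. \<forall>s t. 0 \<le> s \<and> s \<le> t \<and> t \<le> 1 \<and> t - s < d \<longrightarrow>
      \<bar>hcap (graph_slit \<phi> t) - hcap (graph_slit \<phi> s)\<bar> < e" if e: "e > 0" for e
  proof -
    have "((\<lambda>\<eta>. 4 * (M + 1) * (tip_const * \<eta> powr (1 / 4))) \<longlongrightarrow> 4 * (M + 1) * (tip_const * 0)) (at_right 0)"
      by (intro tendsto_mult tendsto_const) real_asymp
    then have "\<forall>\<^sub>F \<eta> in at_right 0. 4 * (M + 1) * (tip_const * \<eta> powr (1 / 4)) < e"
      by (rule order_tendstoD) (use e in simp)
    moreover have "\<forall>\<^sub>F \<eta> in at_right (0::real). 0 < \<eta> \<and> \<eta> < 1"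
      by (auto simp: eventually_at_right_field intro!: exI[of _ 1])
    ultimately have "\<forall>\<^sub>F \<eta> in at_right 0. 4 * (M + 1) * (tip_const * \<eta> powr (1 / 4)) < e \<and> 0 < \<eta> \<and> \<eta> < 1"
      by eventually_elim auto
    then obtain \<eta> where eta: "4 * (M + 1) * (tip_const * \<eta> powr (1 / 4)) < e" "0 < \<eta>" "\<eta> < 1"
      using eventually_happens'[OF trivial_limit_at_right_real] by blast
    have "uniformly_continuous_on {0..1} (\<lambda>y. Complex (\<phi> y) y)"
      by (intro compact_uniformly_continuous continuous_intros c) auto
    then obtain d where d: "d > 0" "\<And>u s. u \<in> {0..1} \<Longrightarrow> s \<in> {0..1} \<Longrightarrow> dist u s < d \<Longrightarrow>
        dist (Complex (\<phi> u) u) (Complex (\<phi> s) s) < \<eta>"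
      unfolding uniformly_continuous_on_def using eta(2) by metis
    show ?thesis
    \<comment> \<open>The second entry of the minimum serves the case \<open>s = 0\<close>, where
      the increment is at most \<open>4 * (M + 1) * t\<close>.\<close>
    proof (rule exI[of _ "min d (e / (4 * (M + 1)))"], intro conjI allI impI)
      show "0 < min d (e / (4 * (M + 1)))" using d e M0 by simp
      fix s t assume st: "0 \<le> s \<and> s \<le> t \<and> t \<le> 1 \<and> t - s < min d (e / (4 * (M + 1)))"
      have r: "rooted_hull (graph_slit \<phi> u)" if "0 \<le> u" "u \<le> 1" for u
        using that c by (auto intro!: rooted_hull_graph_slit continuous_on_subset[OF c(1)])
      have "hcap (graph_slit \<phi> s) \<le> hcap (graph_slit \<phi> t)"
        using st r graph_slit_mono by (intro hcap_mono) auto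
      moreover have "hcap (graph_slit \<phi> t) < hcap (graph_slit \<phi> s) + e"
      proof (cases "s = 0")
        case True
        have "hcap (graph_slit \<phi> t) \<le> hcap {} + 4 * (M + 1) * t"
        proof (rule hcap_le_add[OF rooted_hull_empty])
          show "rooted_hull (graph_slit \<phi> t)" using r st by auto
          show "graph_slit \<phi> t \<subseteq> cball 0 (M + 1)" using M st by (intro graph_slit_subset_cball) auto
          fix g a z assume g: "is_mapping_out {} g a" and z: "z \<in> graph_slit \<phi> t - {}"
          have "Im (g z) \<le> Im z"
            by (rule is_mapping_out_Im_le[OF g]) (use z graph_slit_subset_upper_half_plane[of \<phi> t] open_upper_half_plane in auto)
          then show "Im (g z) \<le> t" using z by (simp add: mem_graph_slit)
        qed (use M0 st in auto)
        also have "\<dots> < hcap {} + e" using True st M0 by (simp add: pos_less_divide_eq mult.commute)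
        finally show ?thesis using True by (simp add: graph_slit_0)
      next
        case False
        have "hcap (graph_slit \<phi> t) \<le> hcap (graph_slit \<phi> s) + 4 * (M + 1) * (tip_const * \<eta> powr (1 / 4))"
        proof (rule hcap_graph_slit_le_add[OF c M])
          fix u assume "u \<in> {s..t}"
          then show "dist (Complex (\<phi> u) u) (Complex (\<phi> s) s) \<le> \<eta>"
            using st by (intro less_imp_le d) (auto simp: dist_real_def)
        qed (use False st eta in auto)
        then show ?thesis using eta by linarith
      qed
      ultimately show "\<bar>hcap (graph_slit \<phi> t) - hcap (graph_slit \<phi> s)\<bar> < e" by linarith
    qed
  qed
  show ?thesis
    unfolding continuous_on_iff
  proof (intro ballI allI impI)
    fix x e :: real assume x: "x \<in> {0..1}" and e: "0 < e"
    obtain d where d: "d > 0" "\<And>s t. 0 \<le> s \<Longrightarrow> s \<le> t \<Longrightarrow> t \<le> 1 \<Longrightarrow> t - s < d \<Longrightarrow>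
      \<bar>hcap (graph_slit \<phi> t) - hcap (graph_slit \<phi> s)\<bar> < e" using close[OF e] by blast
    show "\<exists>d>0. \<forall>x'\<in>{0..1}. dist x' x < d \<longrightarrow> dist (hcap (graph_slit \<phi> x')) (hcap (graph_slit \<phi> x)) < e"
    proof (rule exI[of _ d], intro conjI d ballI impI)
      fix x' assume x': "x' \<in> {0..1}" "dist x' x < d"
      show "dist (hcap (graph_slit \<phi> x')) (hcap (graph_slit \<phi> x)) < e"
      proof (cases "x' \<le> x")
        case True
        then show ?thesis using d(2)[of x' x] x x' by (simp add: dist_real_def abs_minus_commute)
      next
        case False
        then show ?thesis using d(2)[of x x'] x x' by (simp add: dist_real_def)
      qed
    qed
  qed
qed

text \<open>Points of the two graphs are compared at equal height: the first graph, cut off at that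
  height, has its tip at horizontal distance at most \<open>\<epsilon>\<close>.\<close>

lemma Im_le_of_close_graphs:
  assumes c: "continuous_on {0..1} \<phi>" "\<phi> 0 = 0"
    and A: "rooted_hull A" "graph_slit \<phi> 1 \<subseteq> A" and gA: "is_mapping_out A g a"
    and z: "z \<in> graph_slit \<psi> 1 - A" and d: "\<And>y. y \<in> {0..1} \<Longrightarrow> \<bar>\<psi> y - \<phi> y\<bar> \<le> \<epsilon>" "\<epsilon> < 1"
  shows "Im (g z) \<le> tip_const * \<epsilon> powr (1 / 4)"
proof -
  define v where "v = Im z"
  have v: "0 < v" "v \<le> 1" "z = Complex (\<psi> v) v" using z by (auto simp: v_def mem_graph_slit complex_eq_iff)
  show ?thesis
  proof (rule Im_le_of_close_to_graph[where \<phi> = \<phi> and h = v, OF _ c(2) v(1,2) A(1) _ gA])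
    show "continuous_on {0..v} \<phi>" by (rule continuous_on_subset[OF c(1)]) (use v in auto)
    show "graph_slit \<phi> v \<subseteq> A" using graph_slit_mono[OF v(2)] A(2) by blast
    show "z \<in> \<H> - A" using z graph_slit_subset_upper_half_plane by blast
    have "dist z (Complex (\<phi> v) v) = \<bar>\<psi> v - \<phi> v\<bar>"
      by (simp add: v(3) dist_norm cmod_def)
    then show "dist z (Complex (\<phi> v) v) \<le> \<epsilon>" using d(1)[of v] v by simp
  qed fact
qed

lemma hcap_graph_slit_close:
  assumes c: "continuous_on {0..1} \<phi>" "\<phi> 0 = 0" "continuous_on {0..1} \<psi>" "\<psi> 0 = 0"
    and M: "\<And>y. y \<in> {0..1} \<Longrightarrow> \<bar>\<psi> y\<bar> \<le> M"
    and d: "\<And>y. y \<in> {0..1} \<Longrightarrow> \<bar>\<psi> y - \<phi> y\<bar> \<le> \<epsilon>" "\<epsilon> < 1"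
  shows "hcap (graph_slit \<psi> 1) \<le> hcap (graph_slit \<phi> 1) + 4 * (M + 1) * (tip_const * \<epsilon> powr (1 / 4))"
proof (rule hcap_le_add)
  show r: "rooted_hull (graph_slit \<phi> 1)" "rooted_hull (graph_slit \<psi> 1)"
    using c by (auto intro!: rooted_hull_graph_slit)
  show "graph_slit \<psi> 1 \<subseteq> cball 0 (M + 1)" using M by (intro graph_slit_subset_cball) auto
  show "0 < M + 1" using M[of 0] c by simp
  show "0 \<le> tip_const * \<epsilon> powr (1 / 4)" using tip_const_pos by simp
  show "Im (g z) \<le> tip_const * \<epsilon> powr (1 / 4)"
    if "is_mapping_out (graph_slit \<phi> 1) g a" "z \<in> graph_slit \<psi> 1 - graph_slit \<phi> 1" for g a z
    by (rule Im_le_of_close_graphs[OF c(1,2) r(1) subset_refl that d])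
qed

text \<open>Each half is compared with its own counterpart, so the error depends on \<open>M\<close>
  and \<open>\<epsilon>\<close> but not on the gap between the halves. The hull property is assumed
  directly in order to admit \<open>\<phi> = 0\<close>, where both halves coincide.\<close>

lemma hcap_symmetric_slits_close:
  assumes c: "continuous_on {0..1} \<phi>" "\<phi> 0 = 0" "continuous_on {0..1} \<psi>" "\<psi> 0 = 0"
    and r: "rooted_hull (symmetric_slits \<phi> 1)" "rooted_hull (symmetric_slits \<psi> 1)"
    and M: "\<And>y. y \<in> {0..1} \<Longrightarrow> \<bar>\<psi> y\<bar> \<le> M"
    and d: "\<And>y. y \<in> {0..1} \<Longrightarrow> \<bar>\<psi> y - \<phi> y\<bar> \<le> \<epsilon>" "\<epsilon> < 1"
  shows "hcap (symmetric_slits \<psi> 1) \<le> hcap (symmetric_slits \<phi> 1) + 4 * (M + 1) * (tip_const * \<epsilon> powr (1 / 4))"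
proof (rule hcap_le_add[OF r])
  show "symmetric_slits \<psi> 1 \<subseteq> cball 0 (M + 1)"
    unfolding symmetric_slits_def using M by (intro Un_least graph_slit_subset_cball) auto
  show "0 < M + 1" using M[of 0] c by simp
  show "0 \<le> tip_const * \<epsilon> powr (1 / 4)" using tip_const_pos by simp
  fix g a z assume g: "is_mapping_out (symmetric_slits \<phi> 1) g a"
    and z: "z \<in> symmetric_slits \<psi> 1 - symmetric_slits \<phi> 1"
  then consider "z \<in> graph_slit \<psi> 1 - symmetric_slits \<phi> 1"
    | "z \<in> graph_slit (\<lambda>y. - \<psi> y) 1 - symmetric_slits \<phi> 1"
    by (auto simp: symmetric_slits_def)
  then show "Im (g z) \<le> tip_const * \<epsilon> powr (1 / 4)"
  proof cases
    case 1
    show ?thesis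
      by (rule Im_le_of_close_graphs[OF c(1,2) r(1) _ g 1 d]) (auto simp: symmetric_slits_def)
  next
    case 2
    show ?thesis
    proof (rule Im_le_of_close_graphs[OF _ _ r(1) _ g 2 _ d(2)])
      show "continuous_on {0..1} (\<lambda>y. - \<phi> y)" "- \<phi> 0 = 0" using c by (auto intro!: continuous_intros)
      show "\<bar>- \<psi> y - - \<phi> y\<bar> \<le> \<epsilon>" if "y \<in> {0..1}" for y using d(1)[OF that] by linarith
    qed (auto simp: symmetric_slits_def)
  qed
qed

lemma tendsto_of_powr_bound:
  fixes f :: "nat \<Rightarrow> real"
  assumes "\<epsilon> \<longlonglongrightarrow> 0" "\<And>n. 0 < \<epsilon> n"
    and "\<And>n. \<epsilon> n < 1 \<Longrightarrow> \<bar>f n - l\<bar> \<le> C * \<epsilon> n powr (1 / 4)"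
  shows "f \<longlonglongrightarrow> l"
proof -
  have "\<forall>\<^sub>F n in sequentially. \<epsilon> n < 1" by (rule order_tendstoD(2)[OF assms(1)]) simp
  then have ev: "\<forall>\<^sub>F n in sequentially. norm (f n - l) \<le> C * \<epsilon> n powr (1 / 4)"
    by eventually_elim (use assms(3) in auto)
  have "(\<lambda>n. \<epsilon> n powr (1 / 4)) \<longlonglongrightarrow> 0 powr (1 / 4)"
    by (rule tendsto_powr'[OF assms(1) tendsto_const]) (use assms(2) in \<open>auto simp: less_imp_le\<close>)
  then have "(\<lambda>n. C * \<epsilon> n powr (1 / 4)) \<longlonglongrightarrow> C * 0" by (intro tendsto_intros) simp
  then have "(\<lambda>n. f n - l) \<longlonglongrightarrow> 0" using Lim_null_comparison[OF ev] by simp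
  then show ?thesis using Lim_null by blast
qed

section \<open>Rescaled slits and the oscillating profile\<close>

lemma scaled_graph_slit:
  assumes "h > 0"
  shows "graph_slit \<phi> h = (\<lambda>z. of_real h * z) ` graph_slit (\<lambda>v. \<phi> (h * v) / h) 1"
proof (intro equalityI subsetI)
  fix z assume "z \<in> graph_slit \<phi> h"
  then show "z \<in> (\<lambda>z. of_real h * z) ` graph_slit (\<lambda>v. \<phi> (h * v) / h) 1"
    using assms by (intro image_eqI[of _ _ "z / of_real h"])
      (auto simp: mem_graph_slit Im_divide_of_real Re_divide_of_real)
next
  fix z assume "z \<in> (\<lambda>z. of_real h * z) ` graph_slit (\<lambda>v. \<phi> (h * v) / h) 1"
  then show "z \<in> graph_slit \<phi> h"
    using assms by (auto simp: mem_graph_slit mult_le_cancel_left1)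
qed

lemma scaled_symmetric_slits:
  assumes "h > 0"
  shows "symmetric_slits \<phi> h = (\<lambda>z. of_real h * z) ` symmetric_slits (\<lambda>v. \<phi> (h * v) / h) 1"
  unfolding symmetric_slits_def image_Un
  using scaled_graph_slit[OF assms, of \<phi>] scaled_graph_slit[OF assms, of "\<lambda>y. - \<phi> y"] by simp

text \<open>The slope \<open>\<phi>(y)/y\<close> oscillates between \<open>0\<close> and \<open>2\<close>, but so slowly that on the scale \<open>y\<close> the graph is
  nearly a straight line. The summand \<open>y\<close> keeps it off the imaginary axis.\<close>

definition osc :: "real \<Rightarrow> real" where
  "osc y = y * (1 + sin (ln (1 - ln y)) + y)"

lemma osc_0: "osc 0 = 0" by (simp add: osc_def)

lemma osc_pos:
  assumes "0 < y" shows "osc y > 0"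
proof -
  have "1 + sin (ln (1 - ln y)) + y > 0" using assms sin_ge_minus_one[of "ln (1 - ln y)"] by linarith
  then show ?thesis using assms by (simp add: osc_def)
qed

lemma osc_le:
  assumes "y \<in> {0..1}" shows "\<bar>osc y\<bar> \<le> 3 * y"
proof -
  have "0 \<le> y" "y \<le> 1" using assms by auto
  then have "\<bar>1 + sin (ln (1 - ln y)) + y\<bar> \<le> 3"
    using sin_ge_minus_one[of "ln (1 - ln y)"] sin_le_one[of "ln (1 - ln y)"] by linarith
  then have "y * \<bar>1 + sin (ln (1 - ln y)) + y\<bar> \<le> y * 3" using assms by (intro mult_left_mono) auto
  then show ?thesis using assms by (simp add: osc_def abs_mult)
qed

lemma continuous_on_osc: "continuous_on {0..1} osc"
  unfolding continuous_on_eq_continuous_within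
proof
  fix x :: real assume x: "x \<in> {0..1}"
  show "continuous (at x within {0..1}) osc"
  proof (cases "x = 0")
    case True
    have "(osc \<longlongrightarrow> 0) (at 0 within {0..1})"
    proof (rule Lim_null_comparison)
      show "\<forall>\<^sub>F y in at 0 within {0..1}. norm (osc y) \<le> 3 * y"
        using osc_le by (auto simp: eventually_at_filter)
      show "((\<lambda>y. 3 * y) \<longlongrightarrow> 0) (at (0::real) within {0..1})" by (auto intro!: tendsto_eq_intros)
    qed
    then show ?thesis using True by (simp add: continuous_within osc_0)
  next
    case False
    then have x0: "0 < x" and "ln x \<le> 0" using x by auto
    \<comment> \<open>Keeps the argument \<open>1 - ln x\<close> of the outer logarithm
      nonzero.\<close>
    then have "ln x \<noteq> 1" by linarith
    with x0 have "continuous (at x) osc"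
      unfolding osc_def by (intro continuous_intros) auto
    then show ?thesis by (rule continuous_at_imp_continuous_within)
  qed
qed

lemma abs_sin_diff_le: "\<bar>sin a - sin b\<bar> \<le> \<bar>a - b\<bar>" for a b :: real
proof -
  have "\<bar>sin a - sin b\<bar> = 2 * (\<bar>sin ((a - b) / 2)\<bar> * \<bar>cos ((a + b) / 2)\<bar>)"
    by (simp add: sin_diff_sin abs_mult)
  also have "\<dots> \<le> 2 * (\<bar>(a - b) / 2\<bar> * 1)"
    by (intro mult_left_mono mult_mono abs_sin_x_le_abs_x abs_cos_le_one) auto
  finally show ?thesis by simp
qed

text \<open>With \<open>a = 1 - ln h\<close> and \<open>b = - ln v\<close>, the change of the sine
  is at most \<open>ln (1 + b / a) \<le> b / a\<close>. The weight \<open>v\<close> makes this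
  uniform, since \<open>v * b = v * ln (1 / v) \<le> 1\<close>; the extra \<open>h\<close> comes
  from the summand \<open>y\<close> in \<open>osc\<close>.\<close>

lemma osc_scaled_close:
  assumes h: "0 < h" "h \<le> 1" and v: "v \<in> {0..1}"
  shows "\<bar>osc (h * v) / h - (1 + sin (ln (1 - ln h))) * v\<bar> \<le> 1 / (1 - ln h) + h"
proof (cases "v = 0")
  case True
  have "ln h \<le> 0" using h by simp
  then have "0 \<le> 1 / (1 - ln h)" by (intro divide_nonneg_nonneg) linarith+
  then show ?thesis using True h by (simp add: osc_0)
next
  case False
  then have v0: "0 < v" "v \<le> 1" using v by auto
  define a where "a = 1 - ln h"
  define b where "b = - ln v"
  have a: "a \<ge> 1" using h by (simp add: a_def)
  have b: "b \<ge> 0" using v0 by (simp add: b_def)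
  have lnhv: "1 - ln (h * v) = a + b" using h v0 by (simp add: a_def b_def ln_mult)
  have vb: "v * b \<le> 1"
  proof -
    have "ln (1 / v) \<le> 1 / v - 1" using v0 by (intro ln_le_minus_one) auto
    then have "b \<le> 1 / v - 1" using v0 by (simp add: b_def ln_div)
    then have "v * b \<le> v * (1 / v - 1)" using v0 by (intro mult_left_mono) auto
    then show ?thesis using v0 by (simp add: algebra_simps)
  qed
  have "\<bar>sin (ln (a + b)) - sin (ln a)\<bar> \<le> \<bar>ln (a + b) - ln a\<bar>" by (rule abs_sin_diff_le)
  also have "\<dots> = ln (a + b) - ln a" using a b by simp
  also have "\<dots> = ln (1 + b / a)" 
  proof -
    have "ln ((a + b) / a) = ln (a + b) - ln a" using ln_divide_pos[of "a + b" a] a b by simp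
    moreover have "(a + b) / a = 1 + b / a" using a by (simp add: add_divide_distrib)
    ultimately show ?thesis by simp
  qed
  also have "\<dots> \<le> b / a" using a b by (intro ln_add_one_self_le_self) auto
  finally have "v * \<bar>sin (ln (a + b)) - sin (ln a)\<bar> \<le> v * (b / a)" using v0 by (intro mult_left_mono) auto
  also have "\<dots> \<le> 1 / a" using vb a by (simp add: divide_right_mono)
  finally have 1: "v * \<bar>sin (ln (a + b)) - sin (ln a)\<bar> \<le> 1 / a" .
  have "v * (h * v) \<le> 1 * (h * 1)" using v0 h by (intro mult_mono) auto
  then have 2: "v * (h * v) \<le> h" by simp
  have "osc (h * v) / h - (1 + sin (ln (1 - ln h))) * v = v * (sin (ln (a + b)) - sin (ln a)) + v * (h * v)"
    using h unfolding osc_def lnhv a_def[symmetric] by (simp add: field_simps)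
  also have "\<bar>\<dots>\<bar> \<le> \<bar>v * (sin (ln (a + b)) - sin (ln a))\<bar> + \<bar>v * (h * v)\<bar>" by (rule abs_triangle_ineq)
  also have "\<dots> = v * \<bar>sin (ln (a + b)) - sin (ln a)\<bar> + v * (h * v)" using v0 h by (simp add: abs_mult)
  also have "\<dots> \<le> 1 / a + h" using 1 2 by linarith
  finally show ?thesis by (simp add: a_def)
qed

text \<open>Solves \<open>ln (1 - ln h) = 2 pi (n + 1) + \<sigma> pi / 2\<close>, the heights at
  which the sine in \<open>osc\<close> equals \<open>\<sigma>\<close>. The shift to
  \<open>n + 1\<close> keeps this phase nonnegative also for \<open>\<sigma> = -1\<close>, so that
  \<open>h \<le> 1\<close>.\<close>

definition osc_scale :: "real \<Rightarrow> nat \<Rightarrow> real" where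
  "osc_scale \<sigma> n = exp (1 - exp (2 * pi * (real n + 1) + \<sigma> * (pi / 2)))"

lemma osc_scale:
  assumes s: "\<sigma> = 1 \<or> \<sigma> = -1"
  shows "0 < osc_scale \<sigma> n" "osc_scale \<sigma> n \<le> 1" "sin (ln (1 - ln (osc_scale \<sigma> n))) = \<sigma>"
    "(\<lambda>n. 1 / (1 - ln (osc_scale \<sigma> n)) + osc_scale \<sigma> n) \<longlonglongrightarrow> 0" "osc_scale \<sigma> \<longlonglongrightarrow> 0"
proof -
  show "0 < osc_scale \<sigma> n" by (simp add: osc_scale_def)
  have "0 \<le> 2 * pi * real n" by simp
  then have "0 \<le> 2 * pi * (real n + 1) + \<sigma> * (pi / 2)"
    using s pi_gt_zero by (auto simp: algebra_simps)
  then have "1 \<le> exp (2 * pi * (real n + 1) + \<sigma> * (pi / 2))" by simp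
  then show "osc_scale \<sigma> n \<le> 1" by (simp add: osc_scale_def)
  have ln: "1 - ln (osc_scale \<sigma> n) = exp (2 * pi * (real n + 1) + \<sigma> * (pi / 2))" for n
    by (simp add: osc_scale_def)
  have "sin (2 * pi * (real n + 1) + \<sigma> * (pi / 2)) = sin (\<sigma> * (pi / 2) + real (n + 1) * (2 * pi))"
    by (simp add: algebra_simps)
  also have "\<dots> = sin (\<sigma> * (pi / 2))"
    using sin.plus_of_nat[of "\<sigma> * (pi / 2)" "n + 1"] by simp
  also have "\<dots> = \<sigma>" using s by auto
  finally show "sin (ln (1 - ln (osc_scale \<sigma> n))) = \<sigma>" by (simp add: ln)
  have "filterlim (\<lambda>n. 2 * pi * (real n + 1) + \<sigma> * (pi / 2)) at_top sequentially"
    by real_asymp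
  then have e: "filterlim (\<lambda>n. exp (2 * pi * (real n + 1) + \<sigma> * (pi / 2))) at_top sequentially"
    by (rule filterlim_compose[OF exp_at_top])
  then have "(\<lambda>n. inverse (exp (2 * pi * (real n + 1) + \<sigma> * (pi / 2)))) \<longlonglongrightarrow> 0"
    by (rule tendsto_inverse_0_at_top)
  then have i: "(\<lambda>n. 1 / (1 - ln (osc_scale \<sigma> n))) \<longlonglongrightarrow> 0" unfolding ln by (simp add: inverse_eq_divide)
  have "((\<lambda>x::real. exp (1 - x)) \<longlongrightarrow> 0) at_top" by real_asymp
  then show o: "osc_scale \<sigma> \<longlonglongrightarrow> 0"
    unfolding osc_scale_def by (rule filterlim_compose[OF _ e])
  show "(\<lambda>n. 1 / (1 - ln (osc_scale \<sigma> n)) + osc_scale \<sigma> n) \<longlonglongrightarrow> 0"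
    using tendsto_add[OF i o] by simp
qed

text \<open>The vertical case is separate: the two halves coincide and there is no region between
  them.\<close>

lemma rooted_symmetric_line:
  assumes "m \<ge> 0"
  shows "rooted_hull (symmetric_slits (\<lambda>v. m * v) 1)"
proof (cases "m = 0")
  case True
  then have "symmetric_slits (\<lambda>v. m * v) 1 = graph_slit (\<lambda>v. m * v) 1" by (simp add: symmetric_slits_def)
  moreover have "rooted_hull (graph_slit (\<lambda>v. m * v) 1)"
    by (rule rooted_hull_graph_slit) (auto intro!: continuous_intros)
  ultimately show ?thesis by simp
next
  case False
  then show ?thesis
    using assms by (intro rooted_hull_symmetric_slits) (auto intro!: continuous_intros)
qed

text \<open>Dilation to unit height multiplies both capacities by the same factor, which cancels;
  numerator and denominator then converge because the rescaled profiles converge uniformly to the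
  line of slope \<open>1 + \<sigma>\<close>.\<close>

lemma hcap_osc_ratio_tendsto:
  assumes s: "\<sigma> = 1 \<or> \<sigma> = -1"
  shows "(\<lambda>n. hcap (symmetric_slits osc (osc_scale \<sigma> n)) / hcap (graph_slit osc (osc_scale \<sigma> n)))
    \<longlonglongrightarrow> hcap (symmetric_slits (\<lambda>v. (1 + \<sigma>) * v) 1) / hcap (graph_slit (\<lambda>v. (1 + \<sigma>) * v) 1)"
proof -
  define h where "h = osc_scale \<sigma>"
  note sc = osc_scale[OF s, folded h_def]
  define P where "P = (\<lambda>n v. osc (h n * v) / h n)"
  define l where "l = (\<lambda>v::real. (1 + \<sigma>) * v)"
  define \<epsilon> where "\<epsilon> = (\<lambda>n. 1 / (1 - ln (h n)) + h n)"
  have eps: "\<epsilon> \<longlonglongrightarrow> 0" unfolding \<epsilon>_def by (rule sc(4))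
  have eps0: "0 < \<epsilon> n" for n
  proof -
    have "ln (h n) \<le> 0" using sc(1,2)[of n] by simp
    then have "0 \<le> 1 / (1 - ln (h n))" by (intro divide_nonneg_nonneg) linarith+
    then show ?thesis using sc(1)[of n] unfolding \<epsilon>_def by linarith
  qed
  have hv: "h n * v \<in> {0..1}" if "v \<in> {0..1}" for n v
    using sc(1,2)[of n] that by (auto intro!: mult_le_one)
  have cP: "continuous_on {0..1} (P n)" for n
    unfolding P_def
    by (intro continuous_intros continuous_on_compose2[OF continuous_on_osc])
       (use sc(1,2)[of n] hv in auto)
  have P0: "P n 0 = 0" for n by (simp add: P_def osc_0)
  have cl: "continuous_on {0..1} l" "l 0 = 0" by (auto simp: l_def intro!: continuous_intros)
  have Pb: "\<bar>P n v\<bar> \<le> 3" if "v \<in> {0..1}" for n v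
  proof -
    have "\<bar>osc (h n * v)\<bar> \<le> 3 * (h n * v)" by (rule osc_le[OF hv[OF that]])
    also have "\<dots> \<le> 3 * h n" using sc(1)[of n] that by (simp add: mult_le_cancel_left1)
    finally show ?thesis using sc(1)[of n] by (simp add: P_def pos_divide_le_eq)
  qed
  have lb: "\<bar>l v\<bar> \<le> 3" if "v \<in> {0..1}" for v using that s by (auto simp: l_def)
  have close: "\<bar>P n v - l v\<bar> \<le> \<epsilon> n" if "v \<in> {0..1}" for n v
    using osc_scaled_close[OF sc(1,2) that, of n] by (simp add: P_def l_def \<epsilon>_def sc(3))
  have close': "\<bar>l v - P n v\<bar> \<le> \<epsilon> n" if "v \<in> {0..1}" for n v
    using close[OF that, of n] by (simp add: abs_minus_commute)
  have rS: "rooted_hull (symmetric_slits (P n) 1)" for n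
  proof (rule rooted_hull_symmetric_slits[OF cP P0])
    show "0 < P n y" if "0 < y" for y using sc(1)[of n] that osc_pos[of "h n * y"] by (simp add: P_def)
  qed simp
  have rl: "rooted_hull (symmetric_slits l 1)" unfolding l_def using s by (intro rooted_symmetric_line) auto
  have rG: "rooted_hull (graph_slit (P n) 1)" for n by (rule rooted_hull_graph_slit[OF cP P0]) simp
  \<comment> \<open>The factor 16 is \<open>4 * (M + 1)\<close> with the common bound
    \<open>M = 3\<close>; closeness is used in both directions for the two-sided estimate.\<close>
  have "\<bar>hcap (graph_slit (P n) 1) - hcap (graph_slit l 1)\<bar> \<le> (16 * tip_const) * \<epsilon> n powr (1 / 4)"
    if "\<epsilon> n < 1" for n
    using hcap_graph_slit_close[OF cP P0 cl lb close' that]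
      hcap_graph_slit_close[OF cl cP P0 Pb close that] by simp
  then have tG: "(\<lambda>n. hcap (graph_slit (P n) 1)) \<longlonglongrightarrow> hcap (graph_slit l 1)"
    by (rule tendsto_of_powr_bound[OF eps eps0])
  have "\<bar>hcap (symmetric_slits (P n) 1) - hcap (symmetric_slits l 1)\<bar> \<le> (16 * tip_const) * \<epsilon> n powr (1 / 4)"
    if "\<epsilon> n < 1" for n
    using hcap_symmetric_slits_close[OF cP P0 cl rS rl lb close' that]
      hcap_symmetric_slits_close[OF cl cP P0 rl rS Pb close that] by simp
  then have tS: "(\<lambda>n. hcap (symmetric_slits (P n) 1)) \<longlonglongrightarrow> hcap (symmetric_slits l 1)"
    by (rule tendsto_of_powr_bound[OF eps eps0])
  have "hcap (graph_slit l 0) < hcap (graph_slit l 1)" by (rule hcap_graph_slit_less[OF cl]) auto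
  then have pos: "hcap (graph_slit l 1) > 0" by (simp add: graph_slit_0 hcap_empty)
  have "hcap (symmetric_slits osc (h n)) / hcap (graph_slit osc (h n))
      = hcap (symmetric_slits (P n) 1) / hcap (graph_slit (P n) 1)" for n
  proof -
    have h0: "h n > 0" by (rule sc(1))
    have co: "continuous_on {0..h n} osc" by (rule continuous_on_subset[OF continuous_on_osc]) (use sc(2)[of n] in auto)
    have eS: "symmetric_slits osc (h n) = (\<lambda>z. of_real (h n) * z) ` symmetric_slits (P n) 1"
      and eG: "graph_slit osc (h n) = (\<lambda>z. of_real (h n) * z) ` graph_slit (P n) 1"
      using scaled_symmetric_slits[OF h0] scaled_graph_slit[OF h0] by (simp_all add: P_def)
    have r: "rooted_hull (symmetric_slits osc (h n))" "rooted_hull (graph_slit osc (h n))"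
      using h0 osc_pos by (auto intro!: rooted_hull_symmetric_slits rooted_hull_graph_slit co osc_0)
    have "hcap (symmetric_slits osc (h n)) = (h n)\<^sup>2 * hcap (symmetric_slits (P n) 1)"
      using hcap_scale[OF rS h0] r(1) unfolding eS by blast
    moreover have "hcap (graph_slit osc (h n)) = (h n)\<^sup>2 * hcap (graph_slit (P n) 1)"
      using hcap_scale[OF rG h0] r(2) unfolding eG by blast
    ultimately show ?thesis using h0 by simp
  qed
  then show ?thesis
    using tendsto_divide[OF tS tG] pos by (simp add: h_def l_def)
qed

section \<open>The two curves and the failure of differentiability\<close>

lemma hcap_graph_slit_uminus:
  assumes c: "continuous_on {0..h} \<phi>" "\<phi> 0 = 0" "h \<ge> 0"
  shows "hcap (graph_slit (\<lambda>y. - \<phi> y) h) = hcap (graph_slit \<phi> h)"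
proof -
  have eq: "graph_slit (\<lambda>y. - \<phi> y) h = (\<lambda>z. - cnj z) ` graph_slit \<phi> h"
    by (auto simp: graph_slit_def image_image complex_eq_iff intro!: image_cong)
  have "rooted_hull (graph_slit (\<lambda>y. - \<phi> y) h)"
    using c by (intro rooted_hull_graph_slit) (auto intro!: continuous_intros)
  then show ?thesis
    using hcap_reflect[OF rooted_hull_graph_slit[OF c]] unfolding eq by blast
qed

lemma closure_graph_slit:
  assumes c: "continuous_on {0..h} \<phi>" "\<phi> 0 = 0" "h > 0"
  shows "closure (graph_slit \<phi> h) = insert 0 (graph_slit \<phi> h)"
proof
  show "closure (graph_slit \<phi> h) \<subseteq> insert 0 (graph_slit \<phi> h)"
    using compact_connected_insert_graph_slit(1)[of h \<phi>] c
    by (intro closure_minimal) (auto simp: compact_imp_closed)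
  have cl: "closure {0<..h} = {0..h}" using c by simp
  have "(\<lambda>y. Complex (\<phi> y) y) ` closure {0<..h} \<subseteq> closure (graph_slit \<phi> h)"
    by (rule image_closure_subset)
       (auto simp: cl graph_slit_def closure_subset intro!: continuous_intros c subsetD[OF closure_subset])
  moreover have "Complex (\<phi> 0) 0 \<in> (\<lambda>y. Complex (\<phi> y) y) ` closure {0<..h}"
    unfolding cl by (rule image_eqI[of _ _ 0]) (use c in auto)
  moreover have "Complex (\<phi> 0) 0 = 0" using c by (simp add: complex_eq_iff)
  ultimately have "0 \<in> closure (graph_slit \<phi> h)" by (metis subsetD)
  then show "insert 0 (graph_slit \<phi> h) \<subseteq> closure (graph_slit \<phi> h)" using closure_subset by auto
qed

text \<open>The capacity \<open>\<tau>\<close> is a continuous strictly increasing function of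
  height, and its inverse \<open>\<rho>\<close> reparametrises both graphs. A derivative
  \<open>D\<close> of \<open>c\<close> at 0 would have to equal the limits of \<open>c(t)/t\<close>
  along both families of scales.\<close>

theorem theorem21:
  shows "\<exists>(\<gamma>1 :: real \<Rightarrow> complex) (\<gamma>2 :: real \<Rightarrow> complex) (T1::real) (T2::real).
     is_slit_curve \<gamma>1 T1 \<and> is_slit_curve \<gamma>2 T2 \<and>
     closure (\<gamma>1 ` {0<..T1}) \<inter> closure (\<gamma>2 ` {0<..T2}) = {0} \<and>
     (\<forall>t \<in> {0..hcap (\<gamma>1 ` {0<..T1})}. hcap (\<gamma>1 ` {0<..t}) = t) \<and>
     (\<forall>t \<in> {0..hcap (\<gamma>2 ` {0<..T2})}. hcap (\<gamma>2 ` {0<..t}) = t) \<and>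
     \<not> ((\<lambda>t. hcap (\<gamma>1 ` {0<..t} \<union> \<gamma>2 ` {0<..t}))
           differentiable (at 0 within {0..min T1 T2}))"
proof -
  note c = continuous_on_osc osc_0
  define \<tau> where "\<tau> = (\<lambda>h. hcap (graph_slit osc h))"
  have tau0: "\<tau> 0 = 0" by (simp add: \<tau>_def graph_slit_0 hcap_empty)
  have ct: "continuous_on {0..1} \<tau>" unfolding \<tau>_def by (rule continuous_on_hcap_graph_slit[OF c])
  have less: "\<tau> s < \<tau> t" if "0 \<le> s" "s < t" "t \<le> 1" for s t
    unfolding \<tau>_def by (rule hcap_graph_slit_less[OF c that])
  then have le_iff: "\<tau> s \<le> \<tau> t \<longleftrightarrow> s \<le> t" if "s \<in> {0..1}" "t \<in> {0..1}" for s t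
    using that by (metis atLeastAtMost_iff linorder_not_less order_le_less)
  then have inj: "inj_on \<tau> {0..1}" by (intro inj_onI) (metis order_antisym order_refl)
  define T where "T = \<tau> 1"
  have T: "T > 0" using less[of 0 1] tau0 by (simp add: T_def)
  have im: "\<tau> ` {0..1} = {0..T}"
  proof (intro equalityI subsetI)
    fix t assume "t \<in> \<tau> ` {0..1}"
    then obtain s where "s \<in> {0..1}" "t = \<tau> s" by blast
    then show "t \<in> {0..T}" using le_iff[of 0 s] le_iff[of s 1] tau0 by (auto simp: T_def)
  next
    fix t assume "t \<in> {0..T}"
    then obtain s where "0 \<le> s" "s \<le> 1" "\<tau> s = t"
      using IVT'[of \<tau> 0 t 1] ct tau0 by (auto simp: T_def)
    then show "t \<in> \<tau> ` {0..1}" by auto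
  qed
  define \<rho> where "\<rho> = the_inv_into {0..1} \<tau>"
  have rt: "\<rho> (\<tau> s) = s" if "s \<in> {0..1}" for s unfolding \<rho>_def by (rule the_inv_into_f_f[OF inj that])
  have tr: "\<rho> t \<in> {0..1}" "\<tau> (\<rho> t) = t" if "t \<in> {0..T}" for t
    using that rt unfolding im[symmetric] by auto
  have cr: "continuous_on {0..T} \<rho>"
    unfolding im[symmetric] \<rho>_def by (rule continuous_on_inv_into[OF ct compact_Icc inj])
  have r0: "\<rho> 0 = 0" using rt[of 0] tau0 by simp
  have rle: "\<rho> s \<le> \<rho> t \<longleftrightarrow> s \<le> t" if "s \<in> {0..T}" "t \<in> {0..T}" for s t
    using le_iff[of "\<rho> s" "\<rho> t"] tr[OF that(1)] tr[OF that(2)] by simp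
  \<comment> \<open>The half-open parameter interval corresponds exactly to the heights in
    \<open>{0<..\<rho> t}\<close>, which identifies the traced curve with a graph slit.\<close>
  have img: "\<rho> ` {0<..t} = {0<..\<rho> t}" if t: "t \<in> {0..T}" for t
  proof (intro equalityI subsetI)
    fix s assume "s \<in> \<rho> ` {0<..t}"
    then obtain u where u: "0 < u" "u \<le> t" "s = \<rho> u" by auto
    then show "s \<in> {0<..\<rho> t}" using rle[of u t] rle[of u 0] r0 t by auto
  next
    fix s assume s: "s \<in> {0<..\<rho> t}"
    then have s1: "s \<in> {0..1}" using tr[OF t] by auto
    then have "\<tau> s \<le> t" using le_iff[of s "\<rho> t"] s tr[OF t] by simp
    moreover have "0 < \<tau> s" using less[of 0 s] s s1 tau0 by simp
    ultimately show "s \<in> \<rho> ` {0<..t}" using rt[OF s1] by (intro image_eqI[of _ _ "\<tau> s"]) auto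
  qed
  define curve where "curve = (\<lambda>\<phi> t. Complex (\<phi> (\<rho> t)) (\<rho> t))" for \<phi> :: "real \<Rightarrow> real"
  define nosc where "nosc = (\<lambda>y. - osc y)"
  have cn: "continuous_on {0..1} nosc" "nosc 0 = 0"
    unfolding nosc_def by (auto intro!: continuous_intros c simp: osc_0)
  have curve_im: "curve \<phi> ` {0<..t} = graph_slit \<phi> (\<rho> t)" if "t \<in> {0..T}" for \<phi> t
    unfolding graph_slit_def img[OF that, symmetric] by (simp add: curve_def image_image)
  have slit: "is_slit_curve (curve \<phi>) T" if "continuous_on {0..1} \<phi>" for \<phi>
    unfolding is_slit_curve_def
  proof (intro conjI T)
    show "continuous_on {0..T} (curve \<phi>)"
      unfolding curve_def
      by (intro continuous_intros continuous_on_compose2[OF that cr] cr) (use tr in auto)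
    show "inj_on (curve \<phi>) {0..T}"
      using tr(2) by (intro inj_onI) (metis complex.inject curve_def)
    show "Im (curve \<phi> 0) = 0" by (simp add: curve_def r0)
    show "curve \<phi> ` {0<..T} \<subseteq> \<H>"
      using T graph_slit_subset_upper_half_plane by (simp add: curve_im)
  qed
  have rT: "\<rho> T = 1" using rt[of 1] by (simp add: T_def)
  have hc: "hcap (curve osc ` {0<..t}) = t" if "t \<in> {0..T}" for t
    using tr(2)[OF that] by (simp add: curve_im[OF that] \<tau>_def)
  have hn: "hcap (curve nosc ` {0<..t}) = t" if "t \<in> {0..T}" for t
  proof -
    have "hcap (graph_slit nosc (\<rho> t)) = hcap (graph_slit osc (\<rho> t))"
      unfolding nosc_def
      by (rule hcap_graph_slit_uminus) (use tr[OF that] in \<open>auto intro!: continuous_on_subset[OF c(1)] osc_0\<close>)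
    then show ?thesis using tr(2)[OF that] by (simp add: curve_im[OF that] \<tau>_def)
  qed
  have clos: "closure (curve osc ` {0<..T}) \<inter> closure (curve nosc ` {0<..T}) = {0}"
  proof -
    have "closure (curve osc ` {0<..T}) = insert 0 (graph_slit osc 1)"
      "closure (curve nosc ` {0<..T}) = insert 0 (graph_slit nosc 1)"
      using T c cn by (simp_all add: curve_im rT closure_graph_slit)
    moreover have "z \<notin> graph_slit nosc 1" if "z \<in> graph_slit osc 1" for z
      using that osc_pos[of "Im z"] by (auto simp: mem_graph_slit nosc_def)
    ultimately show ?thesis by blast
  qed
  define cc where "cc = (\<lambda>t. hcap (curve osc ` {0<..t} \<union> curve nosc ` {0<..t}))"
  have cc: "cc t = hcap (symmetric_slits osc (\<rho> t))" if "t \<in> {0..T}" for t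
    by (simp add: cc_def curve_im[OF that] symmetric_slits_def nosc_def)
  \<comment> \<open>At time 0 the interval \<open>{0<..0}\<close> is empty, so the difference
    quotient at 0 is simply \<open>cc t / t\<close>.\<close>
  have cc0: "cc 0 = 0" by (simp add: cc_def hcap_empty)
  have "\<not> cc differentiable (at 0 within {0..T})"
  proof
    assume "cc differentiable (at 0 within {0..T})"
    then obtain D where "(cc has_real_derivative D) (at 0 within {0..T})"
      by (auto simp: real_differentiable_def)
    then have D: "((\<lambda>t. cc t / t) \<longlongrightarrow> D) (at 0 within {0..T})"
      by (simp add: has_field_derivative_iff cc0)
    have lim: "D = hcap (symmetric_slits (\<lambda>v. (1 + \<sigma>) * v) 1) / hcap (graph_slit (\<lambda>v. (1 + \<sigma>) * v) 1)"
      if s: "\<sigma> = 1 \<or> \<sigma> = -1" for \<sigma>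
    proof -
      note sc = osc_scale[OF s]
      have y: "osc_scale \<sigma> n \<in> {0..1}" for n using sc(1,2)[of n] by simp
      have tp: "\<tau> (osc_scale \<sigma> n) > 0" for n using less[of 0 "osc_scale \<sigma> n"] sc(1,2)[of n] tau0 by simp
      have "(\<lambda>n. \<tau> (osc_scale \<sigma> n)) \<longlonglongrightarrow> \<tau> 0"
        by (rule continuous_on_tendsto_compose[OF ct sc(5)]) (use y in auto)
      \<comment> \<open>The capacity times belonging to the chosen heights are nonzero, stay in the
        parameter interval and tend to 0, so the derivative can be evaluated along them.\<close>
      then have "filterlim (\<lambda>n. \<tau> (osc_scale \<sigma> n)) (at 0 within {0..T}) sequentially"
        unfolding filterlim_at using tp y im tau0 by (auto simp: less_imp_neq[symmetric] intro!: always_eventually)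
      then have "(\<lambda>n. cc (\<tau> (osc_scale \<sigma> n)) / \<tau> (osc_scale \<sigma> n)) \<longlonglongrightarrow> D"
        by (rule filterlim_compose[OF D])
      moreover have "cc (\<tau> (osc_scale \<sigma> n)) = hcap (symmetric_slits osc (osc_scale \<sigma> n))" for n
      proof -
        have "\<tau> (osc_scale \<sigma> n) \<in> {0..T}" using im y by blast
        then show ?thesis using cc rt[OF y] by simp
      qed
      ultimately have "(\<lambda>n. hcap (symmetric_slits osc (osc_scale \<sigma> n)) / hcap (graph_slit osc (osc_scale \<sigma> n))) \<longlonglongrightarrow> D"
        by (simp add: \<tau>_def)
      then show ?thesis using hcap_osc_ratio_tendsto[OF s] LIMSEQ_unique by blast
    qed
    have pos: "hcap (graph_slit (\<lambda>v. m * v) 1) > 0" for m :: real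
      using hcap_graph_slit_less[of "\<lambda>v. m * v" 0 1]
      by (auto simp: graph_slit_0 hcap_empty intro!: continuous_intros)
    \<comment> \<open>For \<open>\<sigma> = -1\<close> the slope is 0: the symmetric pair collapses
      to the one vertical segment, and numerator and denominator agree.\<close>
    have "D = 1"
      using lim[of "-1"] pos[of 0] by (simp add: symmetric_slits_def)
    moreover have "hcap (graph_slit (\<lambda>v. 2 * v) 1) < hcap (symmetric_slits (\<lambda>v. 2 * v) 1)"
    proof (rule hcap_strict_mono)
      show "rooted_hull (graph_slit (\<lambda>v. 2 * v) 1)"
        by (rule rooted_hull_graph_slit) (auto intro!: continuous_intros)
      show "rooted_hull (symmetric_slits (\<lambda>v. 2 * v) 1)" by (rule rooted_symmetric_line) simp
      have "Complex (-2) 1 \<in> symmetric_slits (\<lambda>v. 2 * v) 1 - graph_slit (\<lambda>v. 2 * v) 1"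
        by (simp add: symmetric_slits_def mem_graph_slit)
      then show "graph_slit (\<lambda>v. 2 * v) 1 \<subset> symmetric_slits (\<lambda>v. 2 * v) 1"
        by (auto simp: symmetric_slits_def)
    qed
    then have "1 < hcap (symmetric_slits (\<lambda>v. 2 * v) 1) / hcap (graph_slit (\<lambda>v. 2 * v) 1)"
      using pos[of 2] by simp
    ultimately show False using lim[of 1] by simp
  qed
  then show ?thesis
    using slit[OF c(1)] slit[OF cn(1)] clos hc hn T
    by (intro exI[of _ "curve osc"] exI[of _ "curve nosc"] exI[of _ T]) (auto simp: cc_def)
qed

end
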